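(* Let $k$ be a field of odd characteristic, $C_2=\langle g\mid g^2=1\rangle$, and let $A=k_J[u,v]=k\langle u,v\rangle/(vu-uv+v^2)$ be the Jordan plane with $kC_2$-action $g\cdot u=-u$, $g\cdot v=-v$. Then $A\otimes A^{\mathrm{op}}$ is the algebra generated by $u,v,u',v'$ subject to the relations $$r_1:=vu-uv+v^2,\quad r_2:=v'u'-u'v'-v'^2,\quad r_3:=uu'-u'u,$$ $$r_4:=vu'-u'v,\quad r_5:=uv'-v'u,\quad r_6:=vv'-v'v.$$ The algebra $(A\otimes A^{\mathrm{op}})\# kC_2$ admits a 3-parameter PBW deformation $$\mathcal{D}_{A\otimes A^{\mathrm{op}},\kappa}=\frac{k\langle u,v,u',v'\rangle\# kC_2}{(r_i-\kappa(r_i)\mid 1\le i\le 6)},$$ where $\kappa(r_i)=\alpha_i\in k$ for $i=1,2,3$, and $\kappa(r_j)=0$ for $j=4,5,6$. Moreover, all PBW deformations $\mathcal{D}_{A\otimes A^{\mathrm{op}},\kappa}$ with $\kappa$ a $k$-linear map from $I=\operatorname{span}_k(r_1,\dots,r_6)$ to $kC_2$ are of this form.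
   Context: $A\otimes A^{\mathrm{op}}$ is the ordinary tensor product algebra of $A$ with its opposite (the braided product of $A$ with its braided opposite for the trivial braiding, i.e. the flip). $u',v'$ denote the copies of $u,v$ in $A^{\mathrm{op}}$, with $g\cdot u'=-u'$, $g\cdot v'=-v'$. For a Hopf algebra $H$ and an $H$-module algebra $R$ (an algebra with left $H$-action satisfying $h\cdot(aa')=\sum(h_1\cdot a)(h_2\cdot a')$, $h\cdot1=\epsilon(h)1$), $R\# H$ is $R\otimes H$ with product $(a\otimes h)(a'\otimes h')=\sum a(h_1\cdot a')\otimes h_2h'$. The algebra $\mathcal{D}_{R,\kappa}$ is filtered by giving $H$ degree $0$ and the generators $u,v,u',v'$ degree $1$; it is a PBW deformation of $R\# H$ if its associated graded algebra is isomorphic to $R\# H$ as an $\mathbb{N}$-graded algebra. *)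

theory Defs
  imports
    "HOL-Library.Poly_Mapping"
    "HOL-Library.FuncSet"
    "HOL-Algebra.QuotRing"
    "HOL-Algebra.Module"
    "HOL-Algebra.Elementary_Groups"
begin

section \<open>Algebras over a field\<close>

text \<open>
  The ground field is a type \<open>'k\<close> of class \<open>field\<close>. An associative unital \<open>'k\<close>-algebra,
  not necessarily commutative, is given by a record of type \<open>('k, 'a) module\<close>. (The locale
  \<open>algebra\<close> of HOL-Algebra covers commutative algebras only.)
\<close>

locale k_algebra = ring A for A :: "('k::field, 'a) module" (structure) +
  assumes smult_closed: "x \<in> carrier A \<Longrightarrow> c \<odot> x \<in> carrier A"
    and smult_add_left: "x \<in> carrier A \<Longrightarrow> (c + d) \<odot> x = c \<odot> x \<oplus> d \<odot> x"
    and smult_add_right: "\<lbrakk>x \<in> carrier A; y \<in> carrier A\<rbrakk> \<Longrightarrow> c \<odot> (x \<oplus> y) = c \<odot> x \<oplus> c \<odot> y"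
    and smult_smult: "x \<in> carrier A \<Longrightarrow> (c * d) \<odot> x = c \<odot> (d \<odot> x)"
    and smult_unit: "x \<in> carrier A \<Longrightarrow> 1 \<odot> x = x"
    and smult_mult_left: "\<lbrakk>x \<in> carrier A; y \<in> carrier A\<rbrakk> \<Longrightarrow> (c \<odot> x) \<otimes> y = c \<odot> (x \<otimes> y)"
    and smult_mult_right: "\<lbrakk>x \<in> carrier A; y \<in> carrier A\<rbrakk> \<Longrightarrow> x \<otimes> (c \<odot> y) = c \<odot> (x \<otimes> y)"

definition alg_iso :: "('k, 'a) module \<Rightarrow> ('k, 'b) module \<Rightarrow> ('a \<Rightarrow> 'b) set" where
  "alg_iso A B = {f \<in> ring_iso A B. \<forall>c. \<forall>x\<in>carrier A. f (c \<odot>\<^bsub>A\<^esub> x) = c \<odot>\<^bsub>B\<^esub> f x}"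

definition linear_maps_on :: "'a set \<Rightarrow> ('k, 'a) module \<Rightarrow> ('k, 'b) module \<Rightarrow> ('a \<Rightarrow> 'b) set" where
  "linear_maps_on S A B = {f.
     (\<forall>x\<in>S. f x \<in> carrier B) \<and>
     (\<forall>x\<in>S. \<forall>y\<in>S. f (x \<oplus>\<^bsub>A\<^esub> y) = f x \<oplus>\<^bsub>B\<^esub> f y) \<and>
     (\<forall>c. \<forall>x\<in>S. f (c \<odot>\<^bsub>A\<^esub> x) = c \<odot>\<^bsub>B\<^esub> f x)}"

definition alg_quot :: "('k, 'a) module \<Rightarrow> 'a set \<Rightarrow> ('k, 'a set) module" where
  "alg_quot A I =
    \<lparr>carrier = carrier (A Quot I), mult = mult (A Quot I), one = one (A Quot I),
     zero = zero (A Quot I), add = add (A Quot I),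
     smult = (\<lambda>c X. \<Union>x\<in>X. I +>\<^bsub>A\<^esub> (c \<odot>\<^bsub>A\<^esub> x))\<rparr>"

definition opp_alg :: "('k, 'a) module \<Rightarrow> ('k, 'a) module" where
  "opp_alg A = A\<lparr>mult := \<lambda>x y. y \<otimes>\<^bsub>A\<^esub> x\<rparr>"

text \<open>
  The monoid algebra of \<open>M\<close>, with basis \<open>Poly_Mapping.single m 1\<close>, \<open>m \<in> carrier M\<close>.
\<close>

definition monoid_alg :: "('m, 'z) monoid_scheme \<Rightarrow> ('k::field, 'm \<Rightarrow>\<^sub>0 'k) module" where
  "monoid_alg M =
    \<lparr>carrier = {p. Poly_Mapping.keys p \<subseteq> carrier M},
     mult = (\<lambda>p q. \<Sum>a\<in>Poly_Mapping.keys p. \<Sum>b\<in>Poly_Mapping.keys q.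
               Poly_Mapping.single (a \<otimes>\<^bsub>M\<^esub> b) (Poly_Mapping.lookup p a * Poly_Mapping.lookup q b)),
     one = Poly_Mapping.single \<one>\<^bsub>M\<^esub> 1, zero = 0, add = (+),
     smult = (\<lambda>c. Poly_Mapping.map ((*) c))\<rparr>"

definition free_monoid :: "'x list monoid" where
  "free_monoid = \<lparr>carrier = UNIV, mult = (@), one = []\<rparr>"

abbreviation free_alg :: "('k::field, 'x list \<Rightarrow>\<^sub>0 'k) module" where
  "free_alg \<equiv> monoid_alg free_monoid"

abbreviation word :: "'x list \<Rightarrow> ('x list \<Rightarrow>\<^sub>0 'k::field)" where
  "word w \<equiv> Poly_Mapping.single w 1"


subsection \<open>Tensor products\<close>

text \<open>
  \<open>A \<otimes>\<^sub>k B\<close> is the vector space on the symbols \<open>(a, b)\<close> modulo the bilinearity relations. On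
  symbols the product of \<open>A \<otimes>\<^sub>k B\<close> is \<open>(a, b)(a', b') = (a a', b b')\<close>, so the free vector space
  is the monoid algebra of \<open>A \<times>\<times> B\<close>. Multiplying a bilinearity relation by a symbol gives
  another bilinearity relation, hence their linear span is the ideal they generate.
\<close>

definition bilinear_rels :: "('k::field, 'a) module \<Rightarrow> ('k, 'b) module \<Rightarrow> ('a \<times> 'b \<Rightarrow>\<^sub>0 'k) set" where
  "bilinear_rels A B =
     {Poly_Mapping.single (a \<oplus>\<^bsub>A\<^esub> a', b) 1 - Poly_Mapping.single (a, b) 1 - Poly_Mapping.single (a', b) 1 |
        a a' b. a \<in> carrier A \<and> a' \<in> carrier A \<and> b \<in> carrier B} \<union>
     {Poly_Mapping.single (a, b \<oplus>\<^bsub>B\<^esub> b') 1 - Poly_Mapping.single (a, b) 1 - Poly_Mapping.single (a, b') 1 |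
        a b b'. a \<in> carrier A \<and> b \<in> carrier B \<and> b' \<in> carrier B} \<union>
     {Poly_Mapping.single (c \<odot>\<^bsub>A\<^esub> a, b) 1 - Poly_Mapping.single (a, b) c |
        c a b. a \<in> carrier A \<and> b \<in> carrier B} \<union>
     {Poly_Mapping.single (a, c \<odot>\<^bsub>B\<^esub> b) 1 - Poly_Mapping.single (a, b) c |
        c a b. a \<in> carrier A \<and> b \<in> carrier B}"

definition tensor_ideal :: "('k::field, 'a) module \<Rightarrow> ('k, 'b) module \<Rightarrow> ('a \<times> 'b \<Rightarrow>\<^sub>0 'k) set" where
  "tensor_ideal A B = genideal (monoid_alg (A \<times>\<times> B)) (bilinear_rels A B)"

definition tensor_alg ::
    "('k::field, 'a) module \<Rightarrow> ('k, 'b) module \<Rightarrow> ('k, ('a \<times> 'b \<Rightarrow>\<^sub>0 'k) set) module" where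
  "tensor_alg A B = alg_quot (monoid_alg (A \<times>\<times> B)) (tensor_ideal A B)"

definition tensor_class ::
    "('k::field, 'a) module \<Rightarrow> ('k, 'b) module \<Rightarrow> ('a \<times> 'b \<Rightarrow>\<^sub>0 'k) \<Rightarrow> ('a \<times> 'b \<Rightarrow>\<^sub>0 'k) set" where
  "tensor_class A B p = tensor_ideal A B +>\<^bsub>monoid_alg (A \<times>\<times> B)\<^esub> p"

definition pure_tensor ::
    "('k::field, 'a) module \<Rightarrow> ('k, 'b) module \<Rightarrow> 'a \<Rightarrow> 'b \<Rightarrow> ('a \<times> 'b \<Rightarrow>\<^sub>0 'k) set" where
  "pure_tensor A B a b = tensor_class A B (Poly_Mapping.single (a, b) 1)"

text \<open>
  \<open>f \<otimes> h\<close> for linear endomorphisms \<open>f\<close> of \<open>A\<close> and \<open>h\<close> of \<open>B\<close>; the class does not depend on the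
  representative \<open>p\<close>, so that the union is over equal sets.
\<close>

definition tensor_map ::
    "('k::field, 'a) module \<Rightarrow> ('k, 'b) module \<Rightarrow> ('a \<Rightarrow> 'a) \<Rightarrow> ('b \<Rightarrow> 'b) \<Rightarrow>
      ('a \<times> 'b \<Rightarrow>\<^sub>0 'k) set \<Rightarrow> ('a \<times> 'b \<Rightarrow>\<^sub>0 'k) set" where
  "tensor_map A B f h X =
     (\<Union>p\<in>X. tensor_class A B
        (\<Sum>ab\<in>Poly_Mapping.keys p. Poly_Mapping.single (map_prod f h ab) (Poly_Mapping.lookup p ab)))"

text \<open>\<open>(A \<otimes> B)\<^sub>n = \<Sum>\<^bsub>i+j=n\<^esub> A\<^sub>i \<otimes> B\<^sub>j\<close>.\<close>

definition tensor_grade ::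
    "('k::field, 'a) module \<Rightarrow> ('k, 'b) module \<Rightarrow> (nat \<Rightarrow> 'a set) \<Rightarrow> (nat \<Rightarrow> 'b set) \<Rightarrow>
      nat \<Rightarrow> ('a \<times> 'b \<Rightarrow>\<^sub>0 'k) set set" where
  "tensor_grade A B \<A> \<B> n =
     tensor_class A B ` {p. Poly_Mapping.keys p \<subseteq> (\<Union>i\<le>n. \<A> i \<times> \<B> (n - i))}"


subsection \<open>Smash products with the group algebra of a finite group\<close>

text \<open>
  For the Hopf algebra \<open>H = kG\<close>, where \<open>\<Delta>(g) = g \<otimes> g\<close>, the elements of \<open>R \<otimes> kG\<close> are uniquely of
  the form \<open>\<Sum>\<^sub>g f(g) \<otimes> g\<close> and are represented by \<open>f : G \<rightarrow> R\<close>. The product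
  \<open>(a \<otimes> h)(a' \<otimes> h') = \<Sum> a (h\<^sub>1 \<cdot> a') \<otimes> h\<^sub>2 h'\<close> of \<open>R # H\<close> becomes
  \<open>(a \<otimes> g)(a' \<otimes> g') = a (g \<cdot> a') \<otimes> g g'\<close> for \<open>g, g' \<in> G\<close>.
\<close>

definition smash ::
    "('k, 'r) module \<Rightarrow> ('g, 'z) monoid_scheme \<Rightarrow> ('g \<Rightarrow> 'r \<Rightarrow> 'r) \<Rightarrow> ('k, 'g \<Rightarrow> 'r) module" where
  "smash R G act =
    \<lparr>carrier = carrier G \<rightarrow>\<^sub>E carrier R,
     mult = (\<lambda>f f'. \<lambda>x\<in>carrier G. \<Oplus>\<^bsub>R\<^esub>g\<in>carrier G. f g \<otimes>\<^bsub>R\<^esub> act g (f' (inv\<^bsub>G\<^esub> g \<otimes>\<^bsub>G\<^esub> x))),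
     one = (\<lambda>x\<in>carrier G. if x = \<one>\<^bsub>G\<^esub> then \<one>\<^bsub>R\<^esub> else \<zero>\<^bsub>R\<^esub>),
     zero = (\<lambda>x\<in>carrier G. \<zero>\<^bsub>R\<^esub>),
     add = (\<lambda>f f'. \<lambda>x\<in>carrier G. f x \<oplus>\<^bsub>R\<^esub> f' x),
     smult = (\<lambda>c f. \<lambda>x\<in>carrier G. c \<odot>\<^bsub>R\<^esub> f x)\<rparr>"

text \<open>The canonical embeddings \<open>a \<mapsto> a \<otimes> 1\<close> and \<open>h \<mapsto> 1 \<otimes> h\<close> of \<open>R\<close> and \<open>kG\<close> into \<open>R # kG\<close>.\<close>

definition smash_left :: "('k, 'r) module \<Rightarrow> ('g, 'z) monoid_scheme \<Rightarrow> 'r \<Rightarrow> 'g \<Rightarrow> 'r" where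
  "smash_left R G a = (\<lambda>x\<in>carrier G. if x = \<one>\<^bsub>G\<^esub> then a else \<zero>\<^bsub>R\<^esub>)"

definition smash_right ::
    "('k::field, 'r) module \<Rightarrow> ('g, 'z) monoid_scheme \<Rightarrow> ('g \<Rightarrow>\<^sub>0 'k) \<Rightarrow> 'g \<Rightarrow> 'r" where
  "smash_right R G h = (\<lambda>x\<in>carrier G. Poly_Mapping.lookup h x \<odot>\<^bsub>R\<^esub> \<one>\<^bsub>R\<^esub>)"

text \<open>\<open>S \<otimes> kG\<close> for a subspace \<open>S\<close> of \<open>R\<close>: the group algebra has degree \<open>0\<close>.\<close>

definition smash_part :: "('g, 'z) monoid_scheme \<Rightarrow> 'r set \<Rightarrow> ('g \<Rightarrow> 'r) set" where
  "smash_part G S = carrier G \<rightarrow>\<^sub>E S"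


section \<open>Associated graded algebras and PBW deformations\<close>

definition filt_below :: "('k, 'a) module \<Rightarrow> (nat \<Rightarrow> 'a set) \<Rightarrow> nat \<Rightarrow> 'a set" where
  "filt_below A F n = (case n of 0 \<Rightarrow> {\<zero>\<^bsub>A\<^esub>} | Suc m \<Rightarrow> F m)"

text \<open>
  \<open>gr A = \<Oplus>\<^sub>n F\<^sub>n / F\<^sub>n\<^sub>-\<^sub>1\<close> with \<open>F\<^sub>-\<^sub>1 = 0\<close>. Products and scalar multiples are computed on
  representatives; the unions are over equal cosets.
\<close>

definition assoc_gr :: "('k, 'a) module \<Rightarrow> (nat \<Rightarrow> 'a set) \<Rightarrow> ('k, nat \<Rightarrow> 'a set) module" where
  "assoc_gr A F =
    \<lparr>carrier = {f. (\<forall>n. \<exists>a\<in>F n. f n = filt_below A F n +>\<^bsub>A\<^esub> a) \<and>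
                   finite {n. f n \<noteq> filt_below A F n}},
     mult = (\<lambda>f f' n. \<Union>x\<in>Pi {..n} f. \<Union>y\<in>Pi {..n} f'.
               filt_below A F n +>\<^bsub>A\<^esub> (\<Oplus>\<^bsub>A\<^esub>i\<in>{..n}. x i \<otimes>\<^bsub>A\<^esub> y (n - i))),
     one = (\<lambda>n. if n = 0 then filt_below A F 0 +>\<^bsub>A\<^esub> \<one>\<^bsub>A\<^esub> else filt_below A F n),
     zero = filt_below A F,
     add = (\<lambda>f f' n. f n <+>\<^bsub>A\<^esub> f' n),
     smult = (\<lambda>c f n. \<Union>x\<in>f n. filt_below A F n +>\<^bsub>A\<^esub> (c \<odot>\<^bsub>A\<^esub> x))\<rparr>"

definition assoc_gr_part :: "('k, 'a) module \<Rightarrow> (nat \<Rightarrow> 'a set) \<Rightarrow> nat \<Rightarrow> (nat \<Rightarrow> 'a set) set" where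
  "assoc_gr_part A F n = {f \<in> carrier (assoc_gr A F). \<forall>m. m \<noteq> n \<longrightarrow> f m = filt_below A F m}"

definition graded_alg_iso ::
    "('k, 'a) module \<Rightarrow> (nat \<Rightarrow> 'a set) \<Rightarrow> ('k, 'b) module \<Rightarrow> (nat \<Rightarrow> 'b set) \<Rightarrow> ('a \<Rightarrow> 'b) set" where
  "graded_alg_iso A \<A> B \<B> = {f \<in> alg_iso A B. \<forall>n. f ` \<A> n = \<B> n}"

text \<open>The algebra \<open>D\<close> filtered by \<open>F\<close> is a PBW deformation of the algebra \<open>S\<close> graded by \<open>\<S>\<close>.\<close>

definition PBW_deformation ::
    "('k, 'a) module \<Rightarrow> (nat \<Rightarrow> 'a set) \<Rightarrow> ('k, 'b) module \<Rightarrow> (nat \<Rightarrow> 'b set) \<Rightarrow> bool" where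
  "PBW_deformation D F S \<S> \<longleftrightarrow>
     graded_alg_iso (assoc_gr D F) (assoc_gr_part D F) S \<S> \<noteq> {}"


section \<open>The Jordan plane and its enveloping algebra\<close>

abbreviation C2 :: "int monoid" where
  "C2 \<equiv> integer_mod_group 2"

text \<open>
  The action of \<open>C\<^sub>2\<close> (written additively, with generator \<open>g = 1\<close>) on a free algebra by algebra
  automorphisms for which \<open>g\<close> sends each free generator to its negative.
\<close>

definition sign_act :: "int \<Rightarrow> ('x list \<Rightarrow>\<^sub>0 'k::field) \<Rightarrow> ('x list \<Rightarrow>\<^sub>0 'k)" where
  "sign_act x p = (if x = 0 then p else Poly_Mapping.mapp (\<lambda>w c. (- 1) ^ length w * c) p)"

definition words_of_degree :: "nat \<Rightarrow> ('x list \<Rightarrow>\<^sub>0 'k::field) set" where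
  "words_of_degree n = {p. \<forall>w\<in>Poly_Mapping.keys p. length w = n}"

definition words_upto_degree :: "nat \<Rightarrow> ('x list \<Rightarrow>\<^sub>0 'k::field) set" where
  "words_upto_degree n = {p. \<forall>w\<in>Poly_Mapping.keys p. length w \<le> n}"

datatype jgen = Ju | Jv

definition jordan_ideal :: "(jgen list \<Rightarrow>\<^sub>0 'k::field) set" where
  "jordan_ideal = genideal free_alg {word [Jv, Ju] - word [Ju, Jv] + word [Jv, Jv]}"

definition jordan_class :: "(jgen list \<Rightarrow>\<^sub>0 'k::field) \<Rightarrow> (jgen list \<Rightarrow>\<^sub>0 'k) set" where
  "jordan_class p = jordan_ideal +>\<^bsub>free_alg\<^esub> p"

definition jordan_plane :: "('k::field, (jgen list \<Rightarrow>\<^sub>0 'k) set) module" where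
  "jordan_plane = alg_quot free_alg jordan_ideal"

definition jordan_act :: "int \<Rightarrow> (jgen list \<Rightarrow>\<^sub>0 'k::field) set \<Rightarrow> (jgen list \<Rightarrow>\<^sub>0 'k) set" where
  "jordan_act x X = (\<Union>p\<in>X. jordan_class (sign_act x p))"

definition jordan_grade :: "nat \<Rightarrow> (jgen list \<Rightarrow>\<^sub>0 'k::field) set set" where
  "jordan_grade n = jordan_class ` words_of_degree n"

type_synonym 'k env_elem = "((jgen list \<Rightarrow>\<^sub>0 'k) set \<times> (jgen list \<Rightarrow>\<^sub>0 'k) set \<Rightarrow>\<^sub>0 'k) set"

definition jordan_env :: "('k::field, 'k env_elem) module" where
  "jordan_env = tensor_alg jordan_plane (opp_alg jordan_plane)"

abbreviation env_tensor ::
    "(jgen list \<Rightarrow>\<^sub>0 'k::field) set \<Rightarrow> (jgen list \<Rightarrow>\<^sub>0 'k) set \<Rightarrow> 'k env_elem" where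
  "env_tensor \<equiv> pure_tensor jordan_plane (opp_alg jordan_plane)"

text \<open>The diagonal action: \<open>g\<close> negates \<open>u, v\<close> as well as their copies in the opposite algebra.\<close>

definition env_act :: "int \<Rightarrow> 'k::field env_elem \<Rightarrow> 'k env_elem" where
  "env_act x = tensor_map jordan_plane (opp_alg jordan_plane) (jordan_act x) (jordan_act x)"

definition env_grade :: "nat \<Rightarrow> 'k::field env_elem set" where
  "env_grade = tensor_grade jordan_plane (opp_alg jordan_plane) jordan_grade jordan_grade"

datatype egen = Eu | Ev | Eu' | Ev'

definition env_rel :: "nat \<Rightarrow> (egen list \<Rightarrow>\<^sub>0 'k::field)" where
  "env_rel i =
    (if i = 1 then word [Ev, Eu] - word [Eu, Ev] + word [Ev, Ev]
     else if i = 2 then word [Ev', Eu'] - word [Eu', Ev'] - word [Ev', Ev']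
     else if i = 3 then word [Eu, Eu'] - word [Eu', Eu]
     else if i = 4 then word [Ev, Eu'] - word [Eu', Ev]
     else if i = 5 then word [Eu, Ev'] - word [Ev', Eu]
     else word [Ev, Ev'] - word [Ev', Ev])"

definition env_rel_ideal :: "(egen list \<Rightarrow>\<^sub>0 'k::field) set" where
  "env_rel_ideal = genideal free_alg (env_rel ` {1..6})"

definition env_rel_space :: "(egen list \<Rightarrow>\<^sub>0 'k::field) set" where
  "env_rel_space = {\<Sum>i=1..6. c i \<odot>\<^bsub>free_alg\<^esub> env_rel i | c :: nat \<Rightarrow> 'k. True}"

type_synonym 'k kappa = "(egen list \<Rightarrow>\<^sub>0 'k) \<Rightarrow> (int \<Rightarrow>\<^sub>0 'k)"

abbreviation kC2 :: "('k::field, int \<Rightarrow>\<^sub>0 'k) module" where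
  "kC2 \<equiv> monoid_alg C2"

abbreviation free_smash :: "('k::field, int \<Rightarrow> (egen list \<Rightarrow>\<^sub>0 'k)) module" where
  "free_smash \<equiv> smash free_alg C2 sign_act"

definition deform_ideal :: "'k::field kappa \<Rightarrow> (int \<Rightarrow> (egen list \<Rightarrow>\<^sub>0 'k)) set" where
  "deform_ideal \<kappa> = genideal free_smash
     ((\<lambda>i. smash_left free_alg C2 (env_rel i) \<ominus>\<^bsub>free_smash\<^esub> smash_right free_alg C2 (\<kappa> (env_rel i))) ` {1..6})"

definition deform_alg :: "'k::field kappa \<Rightarrow> ('k, (int \<Rightarrow> (egen list \<Rightarrow>\<^sub>0 'k)) set) module" where
  "deform_alg \<kappa> = alg_quot free_smash (deform_ideal \<kappa>)"

definition deform_filt :: "'k::field kappa \<Rightarrow> nat \<Rightarrow> (int \<Rightarrow> (egen list \<Rightarrow>\<^sub>0 'k)) set set" where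
  "deform_filt \<kappa> n =
     (\<lambda>f. deform_ideal \<kappa> +>\<^bsub>free_smash\<^esub> f) ` smash_part C2 (words_upto_degree n)"

definition is_PBW :: "'k::field kappa \<Rightarrow> bool" where
  "is_PBW \<kappa> \<longleftrightarrow>
     PBW_deformation (deform_alg \<kappa>) (deform_filt \<kappa>)
       (smash jordan_env C2 env_act) (\<lambda>n. smash_part C2 (env_grade n))"


section \<open>The constructions yield algebras\<close>

lemma monoid_alg_simps [simp]:
  "carrier (monoid_alg M) = {p. Poly_Mapping.keys p \<subseteq> carrier M}"
  "\<one>\<^bsub>monoid_alg M\<^esub> = Poly_Mapping.single \<one>\<^bsub>M\<^esub> 1"
  "\<zero>\<^bsub>monoid_alg M\<^esub> = 0"
  "p \<oplus>\<^bsub>monoid_alg M\<^esub> q = p + q"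
  "c \<odot>\<^bsub>monoid_alg M\<^esub> p = Poly_Mapping.map ((*) c) p"
  by (simp_all add: monoid_alg_def)

lemma monoid_alg_mult:
  assumes "finite S" "finite T" "Poly_Mapping.keys p \<subseteq> S" "Poly_Mapping.keys q \<subseteq> T"
  shows "p \<otimes>\<^bsub>monoid_alg M\<^esub> q =
    (\<Sum>a\<in>S. \<Sum>b\<in>T. Poly_Mapping.single (a \<otimes>\<^bsub>M\<^esub> b) (Poly_Mapping.lookup p a * Poly_Mapping.lookup q b))"
proof -
  have "(\<Sum>b\<in>Poly_Mapping.keys q. Poly_Mapping.single (a \<otimes>\<^bsub>M\<^esub> b) (Poly_Mapping.lookup p a * Poly_Mapping.lookup q b))
     = (\<Sum>b\<in>T. Poly_Mapping.single (a \<otimes>\<^bsub>M\<^esub> b) (Poly_Mapping.lookup p a * Poly_Mapping.lookup q b))" for a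
    by (rule sum.mono_neutral_left) (use assms in \<open>auto simp: in_keys_iff\<close>)
  then show ?thesis
    unfolding monoid_alg_def monoid.simps
    by simp (rule sum.mono_neutral_left, use assms in \<open>auto simp: in_keys_iff\<close>)
qed

lemma monoid_alg_mult_single [simp]:
  "Poly_Mapping.single a c \<otimes>\<^bsub>monoid_alg M\<^esub> Poly_Mapping.single b d = Poly_Mapping.single (a \<otimes>\<^bsub>M\<^esub> b) (c * d)"
  by (subst monoid_alg_mult[where S = "{a}" and T = "{b}"]) auto

lemma monoid_alg_add_left:
  "(p + p') \<otimes>\<^bsub>monoid_alg M\<^esub> q = p \<otimes>\<^bsub>monoid_alg M\<^esub> q + p' \<otimes>\<^bsub>monoid_alg M\<^esub> q"
proof -
  let ?S = "Poly_Mapping.keys p \<union> Poly_Mapping.keys p'"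
  show ?thesis
    using Poly_Mapping.keys_add[of p p']
    by (simp add: monoid_alg_mult[where S = ?S and T = "Poly_Mapping.keys q"]
        lookup_add ring_distribs single_add sum.distrib)
qed

lemma monoid_alg_add_right:
  "q \<otimes>\<^bsub>monoid_alg M\<^esub> (p + p') = q \<otimes>\<^bsub>monoid_alg M\<^esub> p + q \<otimes>\<^bsub>monoid_alg M\<^esub> p'"
proof -
  let ?S = "Poly_Mapping.keys p \<union> Poly_Mapping.keys p'"
  show ?thesis
    using Poly_Mapping.keys_add[of p p']
    by (simp add: monoid_alg_mult[where T = ?S and S = "Poly_Mapping.keys q"]
        lookup_add ring_distribs single_add sum.distrib)
qed

lemma monoid_alg_zero [simp]: "0 \<otimes>\<^bsub>monoid_alg M\<^esub> q = 0" "q \<otimes>\<^bsub>monoid_alg M\<^esub> 0 = 0"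
  by (simp_all add: monoid_alg_def)

lemma monoid_alg_sum_left:
  "(\<Sum>i\<in>S. f i) \<otimes>\<^bsub>monoid_alg M\<^esub> q = (\<Sum>i\<in>S. f i \<otimes>\<^bsub>monoid_alg M\<^esub> q)"
  by (induction S rule: infinite_finite_induct) (simp_all add: monoid_alg_add_left)

lemma monoid_alg_sum_right:
  "q \<otimes>\<^bsub>monoid_alg M\<^esub> (\<Sum>i\<in>S. f i) = (\<Sum>i\<in>S. q \<otimes>\<^bsub>monoid_alg M\<^esub> f i)"
  by (induction S rule: infinite_finite_induct) (simp_all add: monoid_alg_add_right)

lemma sum_single: "p = (\<Sum>a\<in>Poly_Mapping.keys p. Poly_Mapping.single a (Poly_Mapping.lookup p a))"
  by (rule poly_mapping_eqI) (auto simp: lookup_sum lookup_single when_def in_keys_iff sum.delta)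

lemma smult_eq_sum:
  "Poly_Mapping.map ((*) c) p =
    (\<Sum>a\<in>Poly_Mapping.keys p. Poly_Mapping.single a (c * Poly_Mapping.lookup p a))" for c :: "'k::field"
  by (rule poly_mapping_eqI)
    (auto simp: lookup_sum lookup_single when_def in_keys_iff sum.delta Poly_Mapping.map.rep_eq)

lemma lookup_smult [simp]:
  "Poly_Mapping.lookup (Poly_Mapping.map ((*) c) p) a = c * Poly_Mapping.lookup p a" for c :: "'k::field"
  by (simp add: Poly_Mapping.map.rep_eq when_def)

lemma keys_mult_monoid_alg:
  assumes "monoid M" "Poly_Mapping.keys p \<subseteq> carrier M" "Poly_Mapping.keys q \<subseteq> carrier M"
  shows "Poly_Mapping.keys (p \<otimes>\<^bsub>monoid_alg M\<^esub> q) \<subseteq> carrier M"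
proof -
  have "Poly_Mapping.keys (p \<otimes>\<^bsub>monoid_alg M\<^esub> q) \<subseteq>
     (\<Union>a\<in>Poly_Mapping.keys p. \<Union>b\<in>Poly_Mapping.keys q. {a \<otimes>\<^bsub>M\<^esub> b})"
    unfolding monoid_alg_def monoid.simps
    by (rule order_trans[OF keys_sum] UN_mono order_refl | simp split: if_splits)+
  then show ?thesis using assms by (blast intro: monoid.m_closed)
qed

lemma sum_rotate:
  "(\<Sum>c\<in>C. \<Sum>b\<in>B. \<Sum>a\<in>A. f a b c) = (\<Sum>a\<in>A. \<Sum>b\<in>B. \<Sum>c\<in>C. f a b c :: 'a::comm_monoid_add)"
proof -
  have "(\<Sum>c\<in>C. \<Sum>b\<in>B. \<Sum>a\<in>A. f a b c) = (\<Sum>c\<in>C. \<Sum>a\<in>A. \<Sum>b\<in>B. f a b c)"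
    by (intro sum.cong refl sum.swap)
  also have "\<dots> = (\<Sum>a\<in>A. \<Sum>c\<in>C. \<Sum>b\<in>B. f a b c)" by (rule sum.swap)
  also have "\<dots> = (\<Sum>a\<in>A. \<Sum>b\<in>B. \<Sum>c\<in>C. f a b c)"
    by (intro sum.cong refl sum.swap)
  finally show ?thesis .
qed

lemma monoid_alg_assoc:
  assumes "monoid M" "Poly_Mapping.keys p \<subseteq> carrier M" "Poly_Mapping.keys q \<subseteq> carrier M"
    "Poly_Mapping.keys r \<subseteq> carrier M"
  shows "(p \<otimes>\<^bsub>monoid_alg M\<^esub> q) \<otimes>\<^bsub>monoid_alg M\<^esub> r = p \<otimes>\<^bsub>monoid_alg M\<^esub> (q \<otimes>\<^bsub>monoid_alg M\<^esub> r)"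
proof -
  have "(p \<otimes>\<^bsub>monoid_alg M\<^esub> q) \<otimes>\<^bsub>monoid_alg M\<^esub> r =
    (\<Sum>c\<in>Poly_Mapping.keys r. \<Sum>b\<in>Poly_Mapping.keys q. \<Sum>a\<in>Poly_Mapping.keys p.
      Poly_Mapping.single ((a \<otimes>\<^bsub>M\<^esub> b) \<otimes>\<^bsub>M\<^esub> c) (Poly_Mapping.lookup p a * Poly_Mapping.lookup q b * Poly_Mapping.lookup r c))"
    by (subst (1) sum_single[of p], subst (1) sum_single[of q], subst (1) sum_single[of r])
      (simp only: monoid_alg_sum_left monoid_alg_sum_right monoid_alg_mult_single)
  also have "\<dots> = (\<Sum>a\<in>Poly_Mapping.keys p. \<Sum>b\<in>Poly_Mapping.keys q. \<Sum>c\<in>Poly_Mapping.keys r.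
      Poly_Mapping.single ((a \<otimes>\<^bsub>M\<^esub> b) \<otimes>\<^bsub>M\<^esub> c) (Poly_Mapping.lookup p a * Poly_Mapping.lookup q b * Poly_Mapping.lookup r c))"
    by (rule sum_rotate)
  also have "\<dots> = (\<Sum>a\<in>Poly_Mapping.keys p. \<Sum>b\<in>Poly_Mapping.keys q. \<Sum>c\<in>Poly_Mapping.keys r.
      Poly_Mapping.single (a \<otimes>\<^bsub>M\<^esub> (b \<otimes>\<^bsub>M\<^esub> c)) (Poly_Mapping.lookup p a * (Poly_Mapping.lookup q b * Poly_Mapping.lookup r c)))"
    using assms by (intro sum.cong refl) (auto simp: monoid.m_assoc subset_iff mult.assoc)
  also have "\<dots> = (\<Sum>c\<in>Poly_Mapping.keys r. \<Sum>b\<in>Poly_Mapping.keys q. \<Sum>a\<in>Poly_Mapping.keys p.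
      Poly_Mapping.single (a \<otimes>\<^bsub>M\<^esub> (b \<otimes>\<^bsub>M\<^esub> c)) (Poly_Mapping.lookup p a * (Poly_Mapping.lookup q b * Poly_Mapping.lookup r c)))"
    by (rule sum_rotate[symmetric])
  also have "\<dots> = p \<otimes>\<^bsub>monoid_alg M\<^esub> (q \<otimes>\<^bsub>monoid_alg M\<^esub> r)"
    by (subst (3) sum_single[of p], subst (3) sum_single[of q], subst (3) sum_single[of r])
      (simp only: monoid_alg_sum_left monoid_alg_sum_right monoid_alg_mult_single)
  finally show ?thesis .
qed

lemma monoid_alg_k_algebra:
  assumes "monoid M"
  shows "k_algebra (monoid_alg M :: ('k::field, 'm \<Rightarrow>\<^sub>0 'k) module)"
proof -
  interpret M: monoid M by fact
  let ?A = "monoid_alg M :: ('k::field, 'm \<Rightarrow>\<^sub>0 'k) module"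
  have un: "Poly_Mapping.single \<one>\<^bsub>M\<^esub> 1 \<otimes>\<^bsub>?A\<^esub> p = p" "p \<otimes>\<^bsub>?A\<^esub> Poly_Mapping.single \<one>\<^bsub>M\<^esub> 1 = p"
    if "Poly_Mapping.keys p \<subseteq> carrier M" for p
  proof -
    have *: "\<one>\<^bsub>M\<^esub> \<otimes>\<^bsub>M\<^esub> a = a" "a \<otimes>\<^bsub>M\<^esub> \<one>\<^bsub>M\<^esub> = a" if "a \<in> Poly_Mapping.keys p" for a
      using that \<open>Poly_Mapping.keys p \<subseteq> carrier M\<close> by auto
    have "Poly_Mapping.single \<one>\<^bsub>M\<^esub> 1 \<otimes>\<^bsub>?A\<^esub> p =
        (\<Sum>a\<in>Poly_Mapping.keys p. Poly_Mapping.single a (Poly_Mapping.lookup p a))"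
      by (subst (1) sum_single[of p]) (simp add: monoid_alg_sum_right * cong: sum.cong)
    then show "Poly_Mapping.single \<one>\<^bsub>M\<^esub> 1 \<otimes>\<^bsub>?A\<^esub> p = p"
      by (simp add: sum_single[symmetric])
    have "p \<otimes>\<^bsub>?A\<^esub> Poly_Mapping.single \<one>\<^bsub>M\<^esub> 1 =
        (\<Sum>a\<in>Poly_Mapping.keys p. Poly_Mapping.single a (Poly_Mapping.lookup p a))"
      by (subst (1) sum_single[of p]) (simp add: monoid_alg_sum_left * cong: sum.cong)
    then show "p \<otimes>\<^bsub>?A\<^esub> Poly_Mapping.single \<one>\<^bsub>M\<^esub> 1 = p"
      by (simp add: sum_single[symmetric])
  qed
  have r: "ring ?A"
  proof (rule ringI)
    show "abelian_group ?A"
    proof (rule abelian_groupI; (simp add: add.assoc add.commute)?)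
      show "Poly_Mapping.keys (x + y) \<subseteq> carrier M"
        if "Poly_Mapping.keys x \<subseteq> carrier M" "Poly_Mapping.keys y \<subseteq> carrier M" for x y :: "'m \<Rightarrow>\<^sub>0 'k"
        using that Poly_Mapping.keys_add[of x y] by blast
      show "\<exists>y. Poly_Mapping.keys y \<subseteq> carrier M \<and> x + y = 0"
        if "Poly_Mapping.keys x \<subseteq> carrier M" for x :: "'m \<Rightarrow>\<^sub>0 'k"
        by (rule exI[of _ "- x"]) (use that in simp)
    qed
    show "monoid ?A"
      by (rule monoidI)
        (use assms in \<open>auto simp: keys_mult_monoid_alg un monoid_alg_assoc dest: keys_mult_monoid_alg[THEN subsetD, rotated 3]\<close>)
  qed (simp_all add: monoid_alg_add_left monoid_alg_add_right)
  have sm: "Poly_Mapping.map ((*) c) p = Poly_Mapping.single \<one>\<^bsub>M\<^esub> c \<otimes>\<^bsub>?A\<^esub> p"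
       "Poly_Mapping.map ((*) c) p = p \<otimes>\<^bsub>?A\<^esub> Poly_Mapping.single \<one>\<^bsub>M\<^esub> c"
    if "Poly_Mapping.keys p \<subseteq> carrier M" for p c
  proof -
    have *: "\<one>\<^bsub>M\<^esub> \<otimes>\<^bsub>M\<^esub> a = a" "a \<otimes>\<^bsub>M\<^esub> \<one>\<^bsub>M\<^esub> = a" if "a \<in> Poly_Mapping.keys p" for a
      using that \<open>Poly_Mapping.keys p \<subseteq> carrier M\<close> by auto
    show "Poly_Mapping.map ((*) c) p = Poly_Mapping.single \<one>\<^bsub>M\<^esub> c \<otimes>\<^bsub>?A\<^esub> p"
      by (subst (2) sum_single[of p]) (simp add: monoid_alg_sum_right * smult_eq_sum cong: sum.cong)
    show "Poly_Mapping.map ((*) c) p = p \<otimes>\<^bsub>?A\<^esub> Poly_Mapping.single \<one>\<^bsub>M\<^esub> c"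
      by (subst (2) sum_single[of p]) (simp add: monoid_alg_sum_left * smult_eq_sum mult.commute cong: sum.cong)
  qed
  have s1: "Poly_Mapping.keys (Poly_Mapping.single \<one>\<^bsub>M\<^esub> c) \<subseteq> carrier M" for c :: 'k by simp
  have kc: "Poly_Mapping.keys (Poly_Mapping.map ((*) c) p) \<subseteq> Poly_Mapping.keys p" for c :: 'k and p :: "'m \<Rightarrow>\<^sub>0 'k"
    by (auto simp: in_keys_iff)
  interpret A: ring ?A by (rule r)
  show ?thesis
  proof (intro k_algebra.intro r k_algebra_axioms.intro)
    fix x y c d assume xy: "x \<in> carrier ?A" "y \<in> carrier ?A"
    show "(c \<odot>\<^bsub>?A\<^esub> x) \<otimes>\<^bsub>?A\<^esub> y = c \<odot>\<^bsub>?A\<^esub> (x \<otimes>\<^bsub>?A\<^esub> y)"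
      using xy A.m_closed[OF xy] s1[of c] assms by (simp add: sm(1) monoid_alg_assoc)
    show "x \<otimes>\<^bsub>?A\<^esub> (c \<odot>\<^bsub>?A\<^esub> y) = c \<odot>\<^bsub>?A\<^esub> (x \<otimes>\<^bsub>?A\<^esub> y)"
      using xy A.m_closed[OF xy] s1[of c] assms by (simp add: sm(2) monoid_alg_assoc)
    show "c \<odot>\<^bsub>?A\<^esub> x \<in> carrier ?A" using xy kc[of c x] by auto
    show "(c + d) \<odot>\<^bsub>?A\<^esub> x = c \<odot>\<^bsub>?A\<^esub> x \<oplus>\<^bsub>?A\<^esub> d \<odot>\<^bsub>?A\<^esub> x"
      by (simp, rule poly_mapping_eqI, simp add: lookup_add ring_distribs)
    show "c \<odot>\<^bsub>?A\<^esub> (x \<oplus>\<^bsub>?A\<^esub> y) = c \<odot>\<^bsub>?A\<^esub> x \<oplus>\<^bsub>?A\<^esub> c \<odot>\<^bsub>?A\<^esub> y"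
      by (simp, rule poly_mapping_eqI, simp add: lookup_add ring_distribs)
    show "(c * d) \<odot>\<^bsub>?A\<^esub> x = c \<odot>\<^bsub>?A\<^esub> (d \<odot>\<^bsub>?A\<^esub> x)"
      by (simp, rule poly_mapping_eqI, simp add: mult.assoc)
    show "1 \<odot>\<^bsub>?A\<^esub> x = x"
      by (simp, rule poly_mapping_eqI, simp)
  qed
qed

lemma alg_quot_k_algebra:
  fixes A :: "('k::field, 'a) module"
  assumes "k_algebra A" "ideal I A"
  shows "k_algebra (alg_quot A I)"
proof -
  interpret A: k_algebra A by fact
  interpret I: ideal I A by fact
  interpret Q: ring "A Quot I" by (rule I.quotient_is_ring)
  have simps: "carrier (alg_quot A I) = carrier (A Quot I)"
    "x \<otimes>\<^bsub>alg_quot A I\<^esub> y = x \<otimes>\<^bsub>A Quot I\<^esub> y" "x \<oplus>\<^bsub>alg_quot A I\<^esub> y = x \<oplus>\<^bsub>A Quot I\<^esub> y"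
    "\<one>\<^bsub>alg_quot A I\<^esub> = \<one>\<^bsub>A Quot I\<^esub>" "\<zero>\<^bsub>alg_quot A I\<^esub> = \<zero>\<^bsub>A Quot I\<^esub>" for x y
    by (simp_all add: alg_quot_def)
  have r: "ring (alg_quot A I)"
    by (intro ringI abelian_groupI monoidI)
      (auto simp: simps Q.a_ac Q.m_assoc Q.l_distr Q.r_distr intro: Q.add.l_inv_ex)
  have Iin: "c \<odot>\<^bsub>A\<^esub> i \<in> I" if "i \<in> I" for c i
  proof -
    have "c \<odot>\<^bsub>A\<^esub> i = (c \<odot>\<^bsub>A\<^esub> \<one>\<^bsub>A\<^esub>) \<otimes>\<^bsub>A\<^esub> i"
      using that I.a_Hcarr A.smult_mult_left by simp
    then show ?thesis using that I.I_l_closed A.smult_closed by simp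
  qed
  have sm: "c \<odot>\<^bsub>alg_quot A I\<^esub> (I +>\<^bsub>A\<^esub> a) = I +>\<^bsub>A\<^esub> (c \<odot>\<^bsub>A\<^esub> a)" if a: "a \<in> carrier A" for c a
  proof -
    have *: "I +>\<^bsub>A\<^esub> (c \<odot>\<^bsub>A\<^esub> x) = I +>\<^bsub>A\<^esub> (c \<odot>\<^bsub>A\<^esub> a)" if x: "x \<in> I +>\<^bsub>A\<^esub> a" for x
    proof -
      obtain i where i: "i \<in> I" "x = i \<oplus>\<^bsub>A\<^esub> a" using x by (auto simp: a_r_coset_def')
      have "c \<odot>\<^bsub>A\<^esub> x = c \<odot>\<^bsub>A\<^esub> i \<oplus>\<^bsub>A\<^esub> c \<odot>\<^bsub>A\<^esub> a" using i a I.a_Hcarr A.smult_add_right by simp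
      then have "c \<odot>\<^bsub>A\<^esub> x \<in> I +>\<^bsub>A\<^esub> (c \<odot>\<^bsub>A\<^esub> a)" using Iin[OF i(1)] by (auto simp: a_r_coset_def')
      then show ?thesis
        using A.a_repr_independence[OF _ A.smult_closed[OF a] I.a_subgroup] by simp
    qed
    have "a \<in> I +>\<^bsub>A\<^esub> a" using a I.a_rcos_self by simp
    then have "(\<Union>x\<in>I +>\<^bsub>A\<^esub> a. I +>\<^bsub>A\<^esub> (c \<odot>\<^bsub>A\<^esub> x)) = I +>\<^bsub>A\<^esub> (c \<odot>\<^bsub>A\<^esub> a)"
      by (rule UN_constant_eq) (intro ballI *)
    then show ?thesis unfolding alg_quot_def by simp
  qed
  have rep: "\<exists>a\<in>carrier A. X = I +>\<^bsub>A\<^esub> a" if "X \<in> carrier (alg_quot A I)" for X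
    using that by (auto simp: simps FactRing_def A_RCOSETS_def')
  have mem: "I +>\<^bsub>A\<^esub> a \<in> carrier (alg_quot A I)" if "a \<in> carrier A" for a
    using that by (auto simp: simps FactRing_def A_RCOSETS_def')
  have ops: "(I +>\<^bsub>A\<^esub> a) \<otimes>\<^bsub>alg_quot A I\<^esub> (I +>\<^bsub>A\<^esub> b) = I +>\<^bsub>A\<^esub> (a \<otimes>\<^bsub>A\<^esub> b)"
    "(I +>\<^bsub>A\<^esub> a) \<oplus>\<^bsub>alg_quot A I\<^esub> (I +>\<^bsub>A\<^esub> b) = I +>\<^bsub>A\<^esub> (a \<oplus>\<^bsub>A\<^esub> b)"
    if "a \<in> carrier A" "b \<in> carrier A" for a b
    using that by (simp_all add: simps FactRing_def I.rcoset_mult_add I.a_rcos_sum)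
  show ?thesis
  proof (intro k_algebra.intro r k_algebra_axioms.intro)
    fix X c d assume "X \<in> carrier (alg_quot A I)"
    then obtain a where a: "a \<in> carrier A" "X = I +>\<^bsub>A\<^esub> a" using rep by blast
    note [simp] = a sm ops mem A.smult_closed
    show "c \<odot>\<^bsub>alg_quot A I\<^esub> X \<in> carrier (alg_quot A I)" by simp
    show "(c + d) \<odot>\<^bsub>alg_quot A I\<^esub> X = c \<odot>\<^bsub>alg_quot A I\<^esub> X \<oplus>\<^bsub>alg_quot A I\<^esub> d \<odot>\<^bsub>alg_quot A I\<^esub> X"
      by (simp add: A.smult_add_left)
    show "(c * d) \<odot>\<^bsub>alg_quot A I\<^esub> X = c \<odot>\<^bsub>alg_quot A I\<^esub> (d \<odot>\<^bsub>alg_quot A I\<^esub> X)"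
      by (simp add: A.smult_smult)
    show "1 \<odot>\<^bsub>alg_quot A I\<^esub> X = X" by (simp add: A.smult_unit)
    fix Y assume "Y \<in> carrier (alg_quot A I)"
    then obtain b where b: "b \<in> carrier A" "Y = I +>\<^bsub>A\<^esub> b" using rep by blast
    note [simp] = b
    show "c \<odot>\<^bsub>alg_quot A I\<^esub> (X \<oplus>\<^bsub>alg_quot A I\<^esub> Y) = c \<odot>\<^bsub>alg_quot A I\<^esub> X \<oplus>\<^bsub>alg_quot A I\<^esub> c \<odot>\<^bsub>alg_quot A I\<^esub> Y"
      by (simp add: A.smult_add_right)
    show "(c \<odot>\<^bsub>alg_quot A I\<^esub> X) \<otimes>\<^bsub>alg_quot A I\<^esub> Y = c \<odot>\<^bsub>alg_quot A I\<^esub> (X \<otimes>\<^bsub>alg_quot A I\<^esub> Y)"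
      by (simp add: A.smult_mult_left)
    show "X \<otimes>\<^bsub>alg_quot A I\<^esub> (c \<odot>\<^bsub>alg_quot A I\<^esub> Y) = c \<odot>\<^bsub>alg_quot A I\<^esub> (X \<otimes>\<^bsub>alg_quot A I\<^esub> Y)"
      by (simp add: A.smult_mult_right)
  qed
qed

lemma opp_k_algebra:
  fixes A :: "('k::field, 'a) module"
  assumes "k_algebra A" 
  shows "k_algebra (opp_alg A)"
proof -
  interpret A: k_algebra A by fact
  have simps: "carrier (opp_alg A) = carrier A"
    "x \<otimes>\<^bsub>opp_alg A\<^esub> y = y \<otimes>\<^bsub>A\<^esub> x" "x \<oplus>\<^bsub>opp_alg A\<^esub> y = x \<oplus>\<^bsub>A\<^esub> y"
    "\<one>\<^bsub>opp_alg A\<^esub> = \<one>\<^bsub>A\<^esub>" "\<zero>\<^bsub>opp_alg A\<^esub> = \<zero>\<^bsub>A\<^esub>"  "c \<odot>\<^bsub>opp_alg A\<^esub> y = c \<odot>\<^bsub>A\<^esub> y" for x y c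
    by (simp_all add: opp_alg_def)
  have r: "ring (opp_alg A)"
    by (intro ringI abelian_groupI monoidI)
      (auto simp: simps A.a_ac A.m_assoc A.l_distr A.r_distr intro: A.add.l_inv_ex)
  show ?thesis
    by (intro k_algebra.intro r k_algebra_axioms.intro)
      (auto simp: simps A.smult_closed A.smult_add_left A.smult_add_right
        A.smult_smult A.smult_unit A.smult_mult_left A.smult_mult_right)
qed


lemma smash_k_algebra:
  fixes R :: "('k::field, 'r) module"
  assumes "k_algebra R" "group G" and fin: "finite (carrier G)"
    and hom: "\<And>g. g \<in> carrier G \<Longrightarrow> act g \<in> ring_hom R R"
    and act_smult: "\<And>g c a. g \<in> carrier G \<Longrightarrow> a \<in> carrier R \<Longrightarrow> act g (c \<odot>\<^bsub>R\<^esub> a) = c \<odot>\<^bsub>R\<^esub> act g a"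
    and act_one: "\<And>a. a \<in> carrier R \<Longrightarrow> act \<one>\<^bsub>G\<^esub> a = a"
    and act_mult: "\<And>g h a. g \<in> carrier G \<Longrightarrow> h \<in> carrier G \<Longrightarrow> a \<in> carrier R \<Longrightarrow>
          act (g \<otimes>\<^bsub>G\<^esub> h) a = act g (act h a)"
  shows "k_algebra (smash R G act)"
proof -
  interpret R: k_algebra R by fact
  interpret G: group G by fact
  let ?S = "smash R G act"
  have act_in [simp]: "act g a \<in> carrier R" if "g \<in> carrier G" "a \<in> carrier R" for g a
    using ring_hom_closed[OF hom[OF that(1)] that(2)] .
  have act_add: "act g (a \<oplus>\<^bsub>R\<^esub> b) = act g a \<oplus>\<^bsub>R\<^esub> act g b"
    if "g \<in> carrier G" "a \<in> carrier R" "b \<in> carrier R" for g a b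
    using ring_hom_add[OF hom[OF that(1)] that(2,3)] .
  have act_times: "act g (a \<otimes>\<^bsub>R\<^esub> b) = act g a \<otimes>\<^bsub>R\<^esub> act g b"
    if "g \<in> carrier G" "a \<in> carrier R" "b \<in> carrier R" for g a b
    using ring_hom_mult[OF hom[OF that(1)] that(2,3)] .
  have act_1: "act g \<one>\<^bsub>R\<^esub> = \<one>\<^bsub>R\<^esub>" if "g \<in> carrier G" for g
    using ring_hom_one[OF hom[OF that]] .
  have act_0: "act g \<zero>\<^bsub>R\<^esub> = \<zero>\<^bsub>R\<^esub>" if "g \<in> carrier G" for g
    using ring_hom_zero[OF hom[OF that] R.ring_axioms R.ring_axioms] .
  have act_finsum: "act g (finsum R f X) = (\<Oplus>\<^bsub>R\<^esub>i\<in>X. act g (f i))"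
    if "g \<in> carrier G" "f \<in> X \<rightarrow> carrier R" "finite X" for g X and f :: "'g \<Rightarrow> 'r"
    using that(3,2)
    by (induction X) (simp_all add: act_0 act_add that(1) Pi_iff R.finsum_closed)
  have sm0: "c \<odot>\<^bsub>R\<^esub> \<zero>\<^bsub>R\<^esub> = \<zero>\<^bsub>R\<^esub>" for c
    using R.smult_add_right[of "\<zero>\<^bsub>R\<^esub>" "\<zero>\<^bsub>R\<^esub>" c] R.smult_closed[of "\<zero>\<^bsub>R\<^esub>" c]
    by (metis R.add.l_cancel_one' R.zero_closed R.r_zero)
  have sm_finsum: "c \<odot>\<^bsub>R\<^esub> (finsum R f X) = (\<Oplus>\<^bsub>R\<^esub>i\<in>X. c \<odot>\<^bsub>R\<^esub> (f i))"
    if "f \<in> X \<rightarrow> carrier R" "finite X" for c X and f :: "'g \<Rightarrow> 'r"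
    using that(2,1)
    by (induction X) (simp_all add: sm0 R.smult_add_right R.smult_closed Pi_iff R.finsum_closed)
  have swap: "(\<Oplus>\<^bsub>R\<^esub>i\<in>X. \<Oplus>\<^bsub>R\<^esub>j\<in>Y. f i j) = (\<Oplus>\<^bsub>R\<^esub>j\<in>Y. \<Oplus>\<^bsub>R\<^esub>i\<in>X. f i j)"
    if "finite X" "finite Y" "\<And>i j. i \<in> X \<Longrightarrow> j \<in> Y \<Longrightarrow> f i j \<in> carrier R"
    for X Y and f :: "'g \<Rightarrow> 'g \<Rightarrow> 'r"
    using that(1,3)
  proof (induction X)
    case (insert x X)
    then show ?case
      using that(2)
      by (simp add: Pi_iff R.finsum_closed R.finsum_addf[symmetric] del: R.finsum_addf)
        (rule R.finsum_cong', auto simp: Pi_iff R.finsum_closed)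
  qed simp
  have simps: "carrier ?S = carrier G \<rightarrow>\<^sub>E carrier R"
    "f \<otimes>\<^bsub>?S\<^esub> f' = (\<lambda>x\<in>carrier G. \<Oplus>\<^bsub>R\<^esub>g\<in>carrier G. f g \<otimes>\<^bsub>R\<^esub> act g (f' (inv\<^bsub>G\<^esub> g \<otimes>\<^bsub>G\<^esub> x)))"
    "\<one>\<^bsub>?S\<^esub> = (\<lambda>x\<in>carrier G. if x = \<one>\<^bsub>G\<^esub> then \<one>\<^bsub>R\<^esub> else \<zero>\<^bsub>R\<^esub>)"
    "\<zero>\<^bsub>?S\<^esub> = (\<lambda>x\<in>carrier G. \<zero>\<^bsub>R\<^esub>)"
    "f \<oplus>\<^bsub>?S\<^esub> f' = (\<lambda>x\<in>carrier G. f x \<oplus>\<^bsub>R\<^esub> f' x)"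
    "c \<odot>\<^bsub>?S\<^esub> f = (\<lambda>x\<in>carrier G. c \<odot>\<^bsub>R\<^esub> f x)" for f f' c
    by (simp_all add: smash_def)
  have inR [simp]: "f x \<in> carrier R" if "f \<in> carrier G \<rightarrow>\<^sub>E carrier R" "x \<in> carrier G" for f x
    using that by (auto simp: PiE_iff)
  have mcl: "f \<otimes>\<^bsub>?S\<^esub> f' \<in> carrier ?S" if "f \<in> carrier ?S" "f' \<in> carrier ?S" for f f'
    using that unfolding simps by (auto intro!: R.finsum_closed)
  have ext: "f = f'" if "f \<in> carrier ?S" "f' \<in> carrier ?S" "\<And>x. x \<in> carrier G \<Longrightarrow> f x = f' x" for f f'
    using that unfolding simps by (blast intro: PiE_ext)
  have ab: "abelian_group ?S"
  proof (rule abelian_groupI)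
    fix f assume f: "f \<in> carrier ?S"
    show "\<exists>f'\<in>carrier ?S. f' \<oplus>\<^bsub>?S\<^esub> f = \<zero>\<^bsub>?S\<^esub>"
      using f by (intro bexI[of _ "\<lambda>x\<in>carrier G. \<ominus>\<^bsub>R\<^esub> f x"]) (auto simp: simps R.l_neg)
    show "\<zero>\<^bsub>?S\<^esub> \<oplus>\<^bsub>?S\<^esub> f = f" using f by (intro ext) (auto simp: simps)
  qed (auto simp: simps R.a_ac)
  have mon: "monoid ?S"
  proof (rule monoidI)
    show one: "\<one>\<^bsub>?S\<^esub> \<in> carrier ?S" by (auto simp: simps)
    fix f f' f'' assume f: "f \<in> carrier ?S" and f': "f' \<in> carrier ?S" and f'': "f'' \<in> carrier ?S"
    show "f \<otimes>\<^bsub>?S\<^esub> f' \<in> carrier ?S" using mcl f f' by blast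
    note fs [simp] = f[unfolded simps] f'[unfolded simps] f''[unfolded simps]
    show "\<one>\<^bsub>?S\<^esub> \<otimes>\<^bsub>?S\<^esub> f = f"
    proof (rule ext[OF mcl[OF one f] f])
      fix x assume x: "x \<in> carrier G"
      have "(\<one>\<^bsub>?S\<^esub> \<otimes>\<^bsub>?S\<^esub> f) x = (\<Oplus>\<^bsub>R\<^esub>g\<in>carrier G. if \<one>\<^bsub>G\<^esub> = g then f x else \<zero>\<^bsub>R\<^esub>)"
        using x unfolding simps by (auto intro!: R.finsum_cong' simp: act_one)
      then show "(\<one>\<^bsub>?S\<^esub> \<otimes>\<^bsub>?S\<^esub> f) x = f x"
        using R.finsum_singleton[of "\<one>\<^bsub>G\<^esub>" "carrier G" "\<lambda>_. f x"] fin x by simp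
    qed
    show "f \<otimes>\<^bsub>?S\<^esub> \<one>\<^bsub>?S\<^esub> = f"
    proof (rule ext[OF mcl[OF f one] f])
      fix x assume x: "x \<in> carrier G"
      have "(f \<otimes>\<^bsub>?S\<^esub> \<one>\<^bsub>?S\<^esub>) x = (\<Oplus>\<^bsub>R\<^esub>g\<in>carrier G. if x = g then f g else \<zero>\<^bsub>R\<^esub>)"
        using x G.inv_solve_left'[of x _ "\<one>\<^bsub>G\<^esub>"] unfolding simps
        by (auto intro!: R.finsum_cong' simp: act_1 act_0 G.inv_solve_left')
      then show "(f \<otimes>\<^bsub>?S\<^esub> \<one>\<^bsub>?S\<^esub>) x = f x"
        using R.finsum_singleton[of x "carrier G" f] fin x by simp
    qed
    show "f \<otimes>\<^bsub>?S\<^esub> f' \<otimes>\<^bsub>?S\<^esub> f'' = f \<otimes>\<^bsub>?S\<^esub> (f' \<otimes>\<^bsub>?S\<^esub> f'')"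
    proof (rule ext[OF mcl[OF mcl[OF f f'] f''] mcl[OF f mcl[OF f' f'']]])
      fix x assume x: "x \<in> carrier G"
      let ?t = "\<lambda>h g. f h \<otimes>\<^bsub>R\<^esub> act h (f' (inv\<^bsub>G\<^esub> h \<otimes>\<^bsub>G\<^esub> g)) \<otimes>\<^bsub>R\<^esub> act g (f'' (inv\<^bsub>G\<^esub> g \<otimes>\<^bsub>G\<^esub> x))"
      have "(f \<otimes>\<^bsub>?S\<^esub> f' \<otimes>\<^bsub>?S\<^esub> f'') x = (\<Oplus>\<^bsub>R\<^esub>g\<in>carrier G. \<Oplus>\<^bsub>R\<^esub>h\<in>carrier G. ?t h g)"
        using x fin unfolding simps by (auto intro!: R.finsum_cong' simp: R.finsum_ldistr Pi_iff R.finsum_closed)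
      also have "\<dots> = (\<Oplus>\<^bsub>R\<^esub>h\<in>carrier G. \<Oplus>\<^bsub>R\<^esub>g\<in>carrier G. ?t h g)"
        by (rule swap) (use fin x in auto)
      also have "\<dots> = (\<Oplus>\<^bsub>R\<^esub>h\<in>carrier G. \<Oplus>\<^bsub>R\<^esub>k\<in>carrier G. ?t h (h \<otimes>\<^bsub>G\<^esub> k))"
      proof (rule R.finsum_cong'[OF refl])
        fix h assume h: "h \<in> carrier G"
        have im: "(\<lambda>k. h \<otimes>\<^bsub>G\<^esub> k) ` carrier G = carrier G"
          using h G.surj_const_mult by blast
        have "finsum R (?t h) ((\<lambda>k. h \<otimes>\<^bsub>G\<^esub> k) ` carrier G) = (\<Oplus>\<^bsub>R\<^esub>k\<in>carrier G. ?t h (h \<otimes>\<^bsub>G\<^esub> k))"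
          by (rule R.finsum_reindex) (use h x in \<open>auto simp: G.inj_on_cmult\<close>)
        then show "finsum R (?t h) (carrier G) = (\<Oplus>\<^bsub>R\<^esub>k\<in>carrier G. ?t h (h \<otimes>\<^bsub>G\<^esub> k))"
          by (simp only: im)
      qed (use x in \<open>auto intro!: R.finsum_closed\<close>)
      also have "\<dots> = (f \<otimes>\<^bsub>?S\<^esub> (f' \<otimes>\<^bsub>?S\<^esub> f'')) x"
      proof -
        have *: "f h \<otimes>\<^bsub>R\<^esub> act h (\<Oplus>\<^bsub>R\<^esub>k\<in>carrier G. f' k \<otimes>\<^bsub>R\<^esub> act k (f'' (inv\<^bsub>G\<^esub> k \<otimes>\<^bsub>G\<^esub> (inv\<^bsub>G\<^esub> h \<otimes>\<^bsub>G\<^esub> x))))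
           = (\<Oplus>\<^bsub>R\<^esub>k\<in>carrier G. ?t h (h \<otimes>\<^bsub>G\<^esub> k))" if h: "h \<in> carrier G" for h
        proof -
          have e: "inv\<^bsub>G\<^esub> h \<otimes>\<^bsub>G\<^esub> (h \<otimes>\<^bsub>G\<^esub> k) = k" if "k \<in> carrier G" for k
            using h that by (simp add: G.m_assoc[symmetric])
          show ?thesis
            using h x fin
            by (simp add: act_finsum Pi_iff R.finsum_rdistr e)
              (auto intro!: R.finsum_cong' simp: e act_times act_mult G.inv_mult_group G.m_assoc R.m_assoc)
        qed
        show ?thesis using x unfolding simps
          by (auto intro!: R.finsum_cong' R.finsum_closed simp: * [symmetric])
      qed
      finally show "(f \<otimes>\<^bsub>?S\<^esub> f' \<otimes>\<^bsub>?S\<^esub> f'') x = (f \<otimes>\<^bsub>?S\<^esub> (f' \<otimes>\<^bsub>?S\<^esub> f'')) x" .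
    qed
  qed
  have r: "ring ?S"
  proof (rule ringI[OF ab mon])
    fix f f' f'' assume f: "f \<in> carrier ?S" and f': "f' \<in> carrier ?S" and f'': "f'' \<in> carrier ?S"
    note fs [simp] = f[unfolded simps] f'[unfolded simps] f''[unfolded simps]
    show "(f \<oplus>\<^bsub>?S\<^esub> f') \<otimes>\<^bsub>?S\<^esub> f'' = f \<otimes>\<^bsub>?S\<^esub> f'' \<oplus>\<^bsub>?S\<^esub> f' \<otimes>\<^bsub>?S\<^esub> f''"
      using fin by (auto simp: simps fun_eq_iff R.l_distr R.finsum_addf Pi_iff cong: R.finsum_cong)
    show "f'' \<otimes>\<^bsub>?S\<^esub> (f \<oplus>\<^bsub>?S\<^esub> f') = f'' \<otimes>\<^bsub>?S\<^esub> f \<oplus>\<^bsub>?S\<^esub> f'' \<otimes>\<^bsub>?S\<^esub> f'"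
      using fin by (auto simp: simps fun_eq_iff R.r_distr act_add R.finsum_addf Pi_iff cong: R.finsum_cong)
  qed
  show ?thesis
  proof (intro k_algebra.intro r k_algebra_axioms.intro)
    fix f f' c d assume f: "f \<in> carrier ?S"
    note fs [simp] = f[unfolded simps]
    show "c \<odot>\<^bsub>?S\<^esub> f \<in> carrier ?S" by (auto simp: simps R.smult_closed)
    show "(c + d) \<odot>\<^bsub>?S\<^esub> f = c \<odot>\<^bsub>?S\<^esub> f \<oplus>\<^bsub>?S\<^esub> d \<odot>\<^bsub>?S\<^esub> f"
      by (auto simp: simps R.smult_add_left)
    show "(c * d) \<odot>\<^bsub>?S\<^esub> f = c \<odot>\<^bsub>?S\<^esub> (d \<odot>\<^bsub>?S\<^esub> f)"
      by (auto simp: simps R.smult_smult)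
    show "1 \<odot>\<^bsub>?S\<^esub> f = f"
      by (rule ext) (auto simp: simps R.smult_unit)
    assume f': "f' \<in> carrier ?S"
    note fs' [simp] = f'[unfolded simps]
    show "c \<odot>\<^bsub>?S\<^esub> (f \<oplus>\<^bsub>?S\<^esub> f') = c \<odot>\<^bsub>?S\<^esub> f \<oplus>\<^bsub>?S\<^esub> c \<odot>\<^bsub>?S\<^esub> f'"
      by (auto simp: simps R.smult_add_right)
    show "(c \<odot>\<^bsub>?S\<^esub> f) \<otimes>\<^bsub>?S\<^esub> f' = c \<odot>\<^bsub>?S\<^esub> (f \<otimes>\<^bsub>?S\<^esub> f')"
      using fin by (auto simp: simps fun_eq_iff sm_finsum Pi_iff R.smult_mult_left R.smult_closed intro!: R.finsum_cong')
    show "f \<otimes>\<^bsub>?S\<^esub> (c \<odot>\<^bsub>?S\<^esub> f') = c \<odot>\<^bsub>?S\<^esub> (f \<otimes>\<^bsub>?S\<^esub> f')"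
      using fin by (auto simp: simps fun_eq_iff sm_finsum Pi_iff R.smult_mult_right act_smult R.smult_closed intro!: R.finsum_cong')
  qed
qed

lemma monoid_free_monoid: "monoid free_monoid"
  by (rule monoidI) (auto simp: free_monoid_def)

lemma lookup_sign_act:
  "Poly_Mapping.lookup (sign_act x p) w = (if x = 0 then 1 else (- 1) ^ length w) * Poly_Mapping.lookup p w"
  by (simp add: sign_act_def lookup_mapp when_def in_keys_iff)

lemma sign_act_single:
  "sign_act x (Poly_Mapping.single w c) = Poly_Mapping.single w ((if x = 0 then 1 else (- 1) ^ length w) * c)"
  by (rule poly_mapping_eqI) (auto simp: lookup_sign_act lookup_single when_def)

lemma sign_act_add: "sign_act x (p + q) = sign_act x p + sign_act x q"
  by (rule poly_mapping_eqI) (auto simp: lookup_sign_act lookup_add algebra_simps)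

lemma sign_act_sum: "sign_act x (\<Sum>i\<in>I. f i) = (\<Sum>i\<in>I. sign_act x (f i))"
  by (rule poly_mapping_eqI) (auto simp: lookup_sign_act lookup_sum sum_distrib_left)

lemma sign_act_hom: "sign_act x \<in> ring_hom free_alg (free_alg :: ('k::field, 'x list \<Rightarrow>\<^sub>0 'k) module)"
proof (rule ring_hom_memI)
  fix p q :: "'x list \<Rightarrow>\<^sub>0 'k"
  have *: "sign_act x (Poly_Mapping.single a c \<otimes>\<^bsub>free_alg\<^esub> Poly_Mapping.single b d) =
     sign_act x (Poly_Mapping.single a c) \<otimes>\<^bsub>free_alg\<^esub> sign_act x (Poly_Mapping.single b d)"
    for a b :: "'x list" and c d :: 'k
    by (simp add: sign_act_single free_monoid_def power_add mult_ac)
  show "sign_act x (p \<otimes>\<^bsub>free_alg\<^esub> q) = sign_act x p \<otimes>\<^bsub>free_alg\<^esub> sign_act x q"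
    by (subst sum_single[of p], subst sum_single[of q], subst (2) sum_single[of p], subst (2) sum_single[of q])
      (simp only: monoid_alg_sum_left monoid_alg_sum_right sign_act_sum *)
qed (simp_all add: sign_act_add sign_act_single, simp_all add: free_monoid_def)

lemma free_smash_k_algebra: "k_algebra (free_smash :: ('k::field, int \<Rightarrow> (egen list \<Rightarrow>\<^sub>0 'k)) module)"
proof (rule smash_k_algebra)
  show "k_algebra (free_alg :: ('k, egen list \<Rightarrow>\<^sub>0 'k) module)"
    by (rule monoid_alg_k_algebra[OF monoid_free_monoid])
  show "sign_act (g \<otimes>\<^bsub>C2\<^esub> h) a = sign_act g (sign_act h a)"
    if "g \<in> carrier C2" "h \<in> carrier C2" for g h and a :: "egen list \<Rightarrow>\<^sub>0 'k"
  proof -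
    have "g = 0 \<or> g = 1" "h = 0 \<or> h = 1"
      using that by (auto simp: integer_mod_group_def)
    then show ?thesis
      by (intro poly_mapping_eqI)
        (auto simp: lookup_sign_act integer_mod_group_def simp flip: power_add mult.assoc)
  qed
  show "sign_act g (c \<odot>\<^bsub>free_alg\<^esub> a) = c \<odot>\<^bsub>free_alg\<^esub> sign_act g a" for g c and a :: "egen list \<Rightarrow>\<^sub>0 'k"
    by (rule poly_mapping_eqI) (simp add: lookup_sign_act mult_ac)
  show "group C2" by simp
  show "finite (carrier C2)" by (simp add: carrier_integer_mod_group)
  show "sign_act g \<in> ring_hom free_alg (free_alg :: ('k, egen list \<Rightarrow>\<^sub>0 'k) module)" for g
    by (rule sign_act_hom)
  show "sign_act \<one>\<^bsub>C2\<^esub> a = a" for a :: "egen list \<Rightarrow>\<^sub>0 'k"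
    by (simp add: integer_mod_group_def sign_act_def)
qed

lemma k_algebra_presented:
  assumes "k_algebra A" "S \<subseteq> carrier A"
  shows "k_algebra (alg_quot A (genideal A S))"
proof -
  interpret k_algebra A by fact
  show ?thesis by (rule alg_quot_k_algebra[OF assms(1) genideal_ideal[OF assms(2)]])
qed

lemma jordan_plane_k_algebra: "k_algebra (jordan_plane :: ('k::field, (jgen list \<Rightarrow>\<^sub>0 'k) set) module)"
  unfolding jordan_plane_def jordan_ideal_def
  by (rule k_algebra_presented[OF monoid_alg_k_algebra[OF monoid_free_monoid]])
    (simp add: free_monoid_def)

lemma tensor_k_algebra:
  fixes A :: "('k::field, 'a) module" and B :: "('k, 'b) module"
  assumes "k_algebra A" "k_algebra B"
  shows "k_algebra (tensor_alg A B)"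
proof -
  interpret A: k_algebra A by fact
  interpret B: k_algebra B by fact
  have AB: "monoid (A \<times>\<times> B)"
    by (rule DirProd_monoid) (rule A.monoid_axioms, rule B.monoid_axioms)
  have sub: "p - q \<in> carrier (monoid_alg (A \<times>\<times> B))"
    if "p \<in> carrier (monoid_alg (A \<times>\<times> B))" "q \<in> carrier (monoid_alg (A \<times>\<times> B))"
    for p q :: "'a \<times> 'b \<Rightarrow>\<^sub>0 'k"
  proof -
    have "Poly_Mapping.keys (p - q) \<subseteq> Poly_Mapping.keys p \<union> Poly_Mapping.keys q"
      by (auto simp: in_keys_iff lookup_minus)
    then show ?thesis using that by auto
  qed
  have sing: "Poly_Mapping.single (a, b) c \<in> carrier (monoid_alg (A \<times>\<times> B))"
    if "a \<in> carrier A" "b \<in> carrier B" for a b and c :: 'k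
    using that by (simp add: DirProd_def)
  show ?thesis unfolding tensor_alg_def tensor_ideal_def
    by (rule k_algebra_presented[OF monoid_alg_k_algebra[OF AB]])
      (unfold bilinear_rels_def, safe; intro sub sing; simp add: A.smult_closed B.smult_closed)
qed

lemma jordan_env_k_algebra: "k_algebra (jordan_env :: ('k::field, 'k env_elem) module)"
  unfolding jordan_env_def
  by (intro tensor_k_algebra opp_k_algebra jordan_plane_k_algebra)

lemma deform_alg_k_algebra:
  fixes \<kappa> :: "'k::field kappa"
  shows "k_algebra (deform_alg \<kappa>)"
proof -
  interpret k_algebra "free_smash :: ('k, int \<Rightarrow> (egen list \<Rightarrow>\<^sub>0 'k)) module"
    by (rule free_smash_k_algebra)
  interpret F: k_algebra "free_alg :: ('k, egen list \<Rightarrow>\<^sub>0 'k) module"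
    by (rule monoid_alg_k_algebra[OF monoid_free_monoid])
  have c: "carrier free_smash = carrier C2 \<rightarrow>\<^sub>E carrier (free_alg :: ('k, egen list \<Rightarrow>\<^sub>0 'k) module)"
    by (simp add: smash_def)
  show ?thesis unfolding deform_alg_def deform_ideal_def
  proof (rule k_algebra_presented[OF free_smash_k_algebra], safe, rule minus_closed)
    fix i
    show "smash_left free_alg C2 (env_rel i) \<in> carrier (free_smash :: ('k, _) module)"
      unfolding c by (auto simp: smash_left_def free_monoid_def)
    show "smash_right free_alg C2 (\<kappa> (env_rel i)) \<in> carrier (free_smash :: ('k, _) module)"
      unfolding c by (auto simp: smash_right_def free_monoid_def)
  qed
qed

end

theory Submission
  imports Defs "HOL-Analysis.Cartesian_Space"
begin

text \<open>
  The algebra presented by \<open>r\<^sub>1 - \<alpha>\<^sub>1, r\<^sub>2 - \<alpha>\<^sub>2, r\<^sub>3 - \<alpha>\<^sub>3, r\<^sub>4, r\<^sub>5, r\<^sub>6\<close> acts on a polynomial ring in four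
  variables by first order differential operators, and suitable normal words send \<open>1\<close> to the monomials.
  For \<open>\<alpha> = 0\<close> this shows that the normal words form a basis and identifies the algebra with
  \<open>A \<otimes> A\<^sup>o\<^sup>p\<close>. For general \<open>\<alpha>\<close> the operators have the same leading terms as for \<open>\<alpha> = 0\<close>, so that the
  leading part of every element of the deformed ideal lies in the undeformed one: this is the PBW property.
  Conversely, three overlaps of the relations produce elements of degree one in the deformed ideal. A PBW
  deformation contains no such elements except \<open>0\<close>, which, as \<open>2 \<noteq> 0\<close>, kills all the other coefficients of
  \<open>\<kappa>\<close>.
\<close>

\<comment> \<open>The operators reflect an Ore extension: [u, v] = v^2 in the Jordan plane, so u
  acts on k[v] through the derivation v^2 d/dv. The constant in \<open>r\<^sub>1\<close> only
  changes this derivation, the one in \<open>r\<^sub>2\<close> changes its primed counterpart, and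
  the one in \<open>r\<^sub>3\<close> adds a derivative in u'; the other commutators stay zero. For
  scalar \<kappa> the group is a bystander: the relations have even degree, so g fixes them, and the
  deformed ideal of the smash product is I + I g for an ideal I of the free algebra. The converse
  has to cope with a definition that asks for some graded isomorphism, not for the canonical map to
  be one. A nonzero element of degree one in the deformed ideal is therefore excluded by counting:
  degree one of the associated graded algebra is spanned by the images of the eight elements x and x
  g, with x a generator, while the smash product has dimension 8 in degree one.\<close>
alias single = Poly_Mapping.single
alias keys = Poly_Mapping.keys
alias lookup = Poly_Mapping.lookup

type_synonym 'k jfree = "jgen list \<Rightarrow>\<^sub>0 'k"
type_synonym 'k efree = "egen list \<Rightarrow>\<^sub>0 'k"
type_synonym 'k jordan_elem = "(jgen list \<Rightarrow>\<^sub>0 'k) set"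

section \<open>Algebra homomorphisms and quotients\<close>

definition alg_hom :: "('k, 'a) module \<Rightarrow> ('k, 'b) module \<Rightarrow> ('a \<Rightarrow> 'b) set" where
  "alg_hom A B = {f \<in> ring_hom A B. \<forall>c. \<forall>x\<in>carrier A. f (c \<odot>\<^bsub>A\<^esub> x) = c \<odot>\<^bsub>B\<^esub> f x}"

lemma alg_homI:
  assumes "\<And>x. x \<in> carrier A \<Longrightarrow> f x \<in> carrier B"
    "\<And>x y. x \<in> carrier A \<Longrightarrow> y \<in> carrier A \<Longrightarrow> f (x \<otimes>\<^bsub>A\<^esub> y) = f x \<otimes>\<^bsub>B\<^esub> f y"
    "\<And>x y. x \<in> carrier A \<Longrightarrow> y \<in> carrier A \<Longrightarrow> f (x \<oplus>\<^bsub>A\<^esub> y) = f x \<oplus>\<^bsub>B\<^esub> f y"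
    "f \<one>\<^bsub>A\<^esub> = \<one>\<^bsub>B\<^esub>"
    "\<And>c x. x \<in> carrier A \<Longrightarrow> f (c \<odot>\<^bsub>A\<^esub> x) = c \<odot>\<^bsub>B\<^esub> f x"
  shows "f \<in> alg_hom A B"
  using assms by (auto simp: alg_hom_def intro: ring_hom_memI)

lemma alg_homD:
  assumes "f \<in> alg_hom A B"
  shows "\<And>x. x \<in> carrier A \<Longrightarrow> f x \<in> carrier B"
    "\<And>x y. x \<in> carrier A \<Longrightarrow> y \<in> carrier A \<Longrightarrow> f (x \<otimes>\<^bsub>A\<^esub> y) = f x \<otimes>\<^bsub>B\<^esub> f y"
    "\<And>x y. x \<in> carrier A \<Longrightarrow> y \<in> carrier A \<Longrightarrow> f (x \<oplus>\<^bsub>A\<^esub> y) = f x \<oplus>\<^bsub>B\<^esub> f y"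
    "f \<one>\<^bsub>A\<^esub> = \<one>\<^bsub>B\<^esub>"
    "\<And>c x. x \<in> carrier A \<Longrightarrow> f (c \<odot>\<^bsub>A\<^esub> x) = c \<odot>\<^bsub>B\<^esub> f x"
  using assms unfolding alg_hom_def ring_hom_def by auto

text \<open>The first isomorphism theorem for two surjections from one algebra. Phrased by kernels,
  it compares \<open>assoc_gr\<close> with the smash product through maps from the free smash
  product, without verifying the algebra laws of \<open>assoc_gr\<close>.\<close>

lemma alg_iso_of_same_kernel:
  assumes A: "k_algebra A"
    and f: "f \<in> alg_hom A B" "f ` carrier A = carrier B"
    and g: "g \<in> alg_hom A C" "g ` carrier A = carrier C"
    and ker: "\<And>x y. x \<in> carrier A \<Longrightarrow> y \<in> carrier A \<Longrightarrow> f x = f y \<longleftrightarrow> g x = g y"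
  obtains h where "h \<in> alg_iso B C" "\<And>x. x \<in> carrier A \<Longrightarrow> h (f x) = g x"
proof -
  interpret A: k_algebra A by fact
  define h where "h = (\<lambda>b. g (SOME x. x \<in> carrier A \<and> f x = b))"
  have h: "h (f x) = g x" if "x \<in> carrier A" for x
  proof -
    have "(SOME y. y \<in> carrier A \<and> f y = f x) \<in> carrier A \<and> f (SOME y. y \<in> carrier A \<and> f y = f x) = f x"
      by (rule someI[of _ x]) (use that in simp)
    then show ?thesis using ker that unfolding h_def by blast
  qed
  have rep: "\<exists>x\<in>carrier A. b = f x" if "b \<in> carrier B" for b using that f(2) by auto
  have "h \<in> alg_iso B C"
    unfolding alg_iso_def ring_iso_def
  proof (intro CollectI conjI allI ballI ring_hom_memI)
    fix b assume "b \<in> carrier B"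
    then obtain x where x: "x \<in> carrier A" "b = f x" using rep by blast
    show "h b \<in> carrier C" using x h alg_homD(1)[OF g(1)] by simp
    show "h (c \<odot>\<^bsub>B\<^esub> b) = c \<odot>\<^bsub>C\<^esub> h b" for c
      using x h[OF A.smult_closed[OF x(1)]] alg_homD(5)[OF f(1)] alg_homD(5)[OF g(1)] h by simp
    fix b' assume "b' \<in> carrier B"
    then obtain y where y: "y \<in> carrier A" "b' = f y" using rep by blast
    show "h (b \<otimes>\<^bsub>B\<^esub> b') = h b \<otimes>\<^bsub>C\<^esub> h b'"
      using x y h[OF A.m_closed[OF x(1) y(1)]] alg_homD(2)[OF f(1)] alg_homD(2)[OF g(1)] h by simp
    show "h (b \<oplus>\<^bsub>B\<^esub> b') = h b \<oplus>\<^bsub>C\<^esub> h b'"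
      using x y h[OF A.a_closed[OF x(1) y(1)]] alg_homD(3)[OF f(1)] alg_homD(3)[OF g(1)] h by simp
  next
    show "h \<one>\<^bsub>B\<^esub> = \<one>\<^bsub>C\<^esub>"
      using h[OF A.one_closed] alg_homD(4)[OF f(1)] alg_homD(4)[OF g(1)] by simp
    show "bij_betw h (carrier B) (carrier C)"
      unfolding bij_betw_def inj_on_def f(2)[symmetric] g(2)[symmetric]
      using ker h by (auto simp: image_image)
  qed
  then show thesis using h that by blast
qed

locale alg_ideal = k_algebra A + ideal I A for A :: "('k::field, 'a) module" (structure) and I
begin

lemma alg_quot_simps:
  "\<one>\<^bsub>alg_quot A I\<^esub> = I +> \<one>" "\<zero>\<^bsub>alg_quot A I\<^esub> = I" "carrier (alg_quot A I) = (\<lambda>x. I +> x) ` carrier A"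
  by (auto simp: alg_quot_def FactRing_def A_RCOSETS_def')

lemma alg_quot_mult:
  "x \<in> carrier A \<Longrightarrow> y \<in> carrier A \<Longrightarrow> (I +> x) \<otimes>\<^bsub>alg_quot A I\<^esub> (I +> y) = I +> (x \<otimes> y)"
  by (simp add: alg_quot_def FactRing_def rcoset_mult_add)

lemma alg_quot_add:
  "x \<in> carrier A \<Longrightarrow> y \<in> carrier A \<Longrightarrow> (I +> x) \<oplus>\<^bsub>alg_quot A I\<^esub> (I +> y) = I +> (x \<oplus> y)"
  by (simp add: alg_quot_def FactRing_def a_rcos_sum)

lemma coset_eq_iff:
  assumes "x \<in> carrier A" "y \<in> carrier A"
  shows "I +> x = I +> y \<longleftrightarrow> x \<ominus> y \<in> I"
  by (rule quotient_eq_iff_same_a_r_cos[OF is_ideal assms, symmetric])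

lemma I_smult: "i \<in> I \<Longrightarrow> c \<odot> i \<in> I"
proof -
  assume i: "i \<in> I"
  then have "c \<odot> i = (c \<odot> \<one>) \<otimes> i" using a_Hcarr smult_mult_left by simp
  then show ?thesis using i I_l_closed smult_closed by simp
qed

lemma alg_quot_smult:
  assumes a: "a \<in> carrier A"
  shows "c \<odot>\<^bsub>alg_quot A I\<^esub> (I +> a) = I +> (c \<odot> a)"
proof -
  have *: "I +> (c \<odot> x) = I +> (c \<odot> a)" if x: "x \<in> I +> a" for x
  proof -
    obtain i where i: "i \<in> I" "x = i \<oplus> a" using x by (auto simp: a_r_coset_def')
    have "c \<odot> x = c \<odot> i \<oplus> c \<odot> a" using i a a_Hcarr smult_add_right by simp
    then have "c \<odot> x \<in> I +> (c \<odot> a)" using I_smult[OF i(1)] by (auto simp: a_r_coset_def')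
    then show ?thesis
      using a_repr_independence[OF _ smult_closed[OF a] a_subgroup] by simp
  qed
  have "a \<in> I +> a" using a a_rcos_self by simp
  then have "(\<Union>x\<in>I +> a. I +> (c \<odot> x)) = I +> (c \<odot> a)"
    by (rule UN_constant_eq) (intro ballI *)
  then show ?thesis unfolding alg_quot_def by simp
qed

lemma quot_map_alg_hom: "(\<lambda>x. I +> x) \<in> alg_hom A (alg_quot A I)"
  by (rule alg_homI) (auto simp: alg_quot_simps alg_quot_mult alg_quot_add alg_quot_smult)

lemma quot_k_algebra: "k_algebra (alg_quot A I)"
  by (rule alg_quot_k_algebra) (rule k_algebra_axioms, rule is_ideal)

lemma quot_finsum:
  assumes "finite S" "\<And>i. i \<in> S \<Longrightarrow> f i \<in> carrier A"
  shows "(\<Oplus>\<^bsub>alg_quot A I\<^esub>i\<in>S. I +> f i) = I +> (\<Oplus>i\<in>S. f i)"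
proof -
  interpret Q: k_algebra "alg_quot A I" by (rule quot_k_algebra)
  show ?thesis using assms
  proof (induction S)
    case empty
    have "I +> \<zero> = I" by (rule a_coset_add_zero) (use a_subset in auto)
    then show ?case by (simp add: alg_quot_simps)
  next
    case (insert x S)
    then show ?case
      by (subst Q.finsum_insert) (auto simp: alg_quot_simps alg_quot_add finsum_closed Pi_iff)
  qed
qed

end

section \<open>Associated graded algebras of quotients of graded algebras\<close>

text \<open>The grading is given by its projections rather than by its components, so that leading
  parts and truncations are terms to calculate with.\<close>

locale graded_k_algebra = k_algebra A for A :: "('k::field, 'a) module" (structure) +
  fixes pr :: "nat \<Rightarrow> 'a \<Rightarrow> 'a"
  assumes pr_closed [simp]: "x \<in> carrier A \<Longrightarrow> pr n x \<in> carrier A"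
    and pr_add: "x \<in> carrier A \<Longrightarrow> y \<in> carrier A \<Longrightarrow> pr n (x \<oplus> y) = pr n x \<oplus> pr n y"
    and pr_smult: "x \<in> carrier A \<Longrightarrow> pr n (c \<odot> x) = c \<odot> pr n x"
    and pr_pr: "x \<in> carrier A \<Longrightarrow> pr m (pr n x) = (if m = n then pr n x else \<zero>)"
    and pr_sum: "x \<in> carrier A \<Longrightarrow> \<exists>N. (\<forall>m>N. pr m x = \<zero>) \<and> x = (\<Oplus>i\<in>{..N}. pr i x)"
    and pr_mult: "x \<in> carrier A \<Longrightarrow> y \<in> carrier A \<Longrightarrow>
      pr n (x \<otimes> y) = (\<Oplus>i\<in>{..n}. pr i x \<otimes> pr (n - i) y)"
    and pr_one: "pr n \<one> = (if n = 0 then \<one> else \<zero>)"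
begin

text \<open>The bound on the degree is strict, so that \<open>below 0\<close> is zero and
  \<open>below n\<close> matches the convention F_{-1} = 0 behind \<open>filt_below\<close>.\<close>

definition below :: "nat \<Rightarrow> 'a set" where
  "below n = {x \<in> carrier A. \<forall>m\<ge>n. pr m x = \<zero>}"

lemma smult_zero [simp]: "c \<odot> \<zero> = \<zero>"
  using smult_mult_left[of "\<one>" "\<zero>" c] smult_closed[of "\<one>" c] by simp

lemma pr_zero [simp]: "pr n \<zero> = \<zero>"
  using pr_add[of \<zero> \<zero> n] pr_closed[of \<zero> n] by (metis add.l_cancel_one' r_zero zero_closed)

lemma pr_neg: "x \<in> carrier A \<Longrightarrow> pr n (\<ominus> x) = \<ominus> pr n x"
  using pr_add[of x "\<ominus> x" n] pr_closed[of x n] pr_closed[of "\<ominus> x" n]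
  by (simp add: r_neg) (metis a_comm minus_equality pr_closed a_inv_closed)

lemma pr_minus: "x \<in> carrier A \<Longrightarrow> y \<in> carrier A \<Longrightarrow> pr n (x \<ominus> y) = pr n x \<ominus> pr n y"
  by (simp add: a_minus_def pr_add pr_neg)

lemma pr_finsum:
  assumes "finite S" "\<And>i. i \<in> S \<Longrightarrow> f i \<in> carrier A"
  shows "pr n (\<Oplus>i\<in>S. f i) = (\<Oplus>i\<in>S. pr n (f i))"
  using assms by (induction S) (auto simp: pr_add finsum_closed Pi_iff)

lemma below_closed: "x \<in> below n \<Longrightarrow> x \<in> carrier A"
  by (simp add: below_def)

lemma below_0: "below 0 = {\<zero>}"
proof
  show "below 0 \<subseteq> {\<zero>}"
  proof
    fix x assume x: "x \<in> below 0"
    then obtain N where "x = (\<Oplus>i\<in>{..N}. pr i x)" using pr_sum below_closed by blast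
    also have "\<dots> = \<zero>" using x by (intro add.finprod_one_eqI) (auto simp: below_def)
    finally show "x \<in> {\<zero>}" by simp
  qed
qed (simp add: below_def)

lemma below_zero: "\<zero> \<in> below n"
  by (simp add: below_def)

lemma below_add: "x \<in> below n \<Longrightarrow> y \<in> below n \<Longrightarrow> x \<oplus> y \<in> below n"
  by (simp add: below_def pr_add)

lemma below_neg: "x \<in> below n \<Longrightarrow> \<ominus> x \<in> below n"
  by (simp add: below_def pr_neg)

lemma below_minus: "x \<in> below n \<Longrightarrow> y \<in> below n \<Longrightarrow> x \<ominus> y \<in> below n"
  by (simp add: a_minus_def below_add below_neg)

lemma below_smult: "x \<in> below n \<Longrightarrow> c \<odot> x \<in> below n"
  by (simp add: below_def pr_smult smult_closed)

lemma below_mono: "m \<le> n \<Longrightarrow> below m \<subseteq> below n"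
  by (auto simp: below_def)

lemma below_finsum:
  assumes "finite S" "\<And>i. i \<in> S \<Longrightarrow> f i \<in> below n"
  shows "(\<Oplus>i\<in>S. f i) \<in> below n"
  using assms
proof (induction S)
  case (insert x S)
  then show ?case by (subst finsum_insert) (auto intro: below_add below_closed)
qed (simp add: below_zero)

lemma pr_below: "x \<in> carrier A \<Longrightarrow> pr n x \<in> below (Suc n)"
  by (simp add: below_def pr_pr)

lemma below_minus_pr: "x \<in> below (Suc n) \<Longrightarrow> x \<ominus> pr n x \<in> below n"
  by (auto simp: below_def pr_minus pr_pr) (simp_all add: a_minus_def r_neg)

text \<open>For positive m and n the factors have degrees at most m - 1 and n - 1, so the product
  has degree at most m + n - 2; this is the slack of one in the bound. It lets a factor of lower
  order times one of complementary degree drop below n.\<close>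

lemma below_mult:
  assumes "x \<in> below m" "y \<in> below n" "m + n \<le> Suc k"
  shows "x \<otimes> y \<in> below k"
  unfolding below_def
proof (intro CollectI conjI allI impI)
  show "x \<otimes> y \<in> carrier A" using assms below_closed by simp
  fix l assume l: "k \<le> l"
  have "pr i x \<otimes> pr (l - i) y = \<zero>" if "i \<le> l" for i
  proof (cases "m \<le> i")
    case True
    then show ?thesis using assms by (simp add: below_def)
  next
    case False
    then have "n \<le> l - i" using l assms(3) by simp
    then show ?thesis using assms by (simp add: below_def)
  qed
  then show "pr l (x \<otimes> y) = \<zero>"
    using assms by (simp add: pr_mult below_closed) (rule add.finprod_one_eqI, simp)
qed

end

locale filtered_quotient = graded_k_algebra A pr + alg_ideal A I
  for A :: "('k::field, 'a) module" (structure) and pr I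
begin

abbreviation "D \<equiv> alg_quot A I"

definition filt :: "nat \<Rightarrow> 'a set set" where
  "filt n = (\<lambda>x. I +> x) ` below (Suc n)"

text \<open>The class of the coset of x in \<open>D\<close> modulo F_{n-1}, written with
  representatives in A because \<open>assoc_gr\<close> computes by unions over
  representatives.\<close>

definition gcoset :: "nat \<Rightarrow> 'a \<Rightarrow> 'a set set" where
  "gcoset n x = {I +> (z \<oplus> x) |z. z \<in> below n}"

text \<open>The canonical map from a graded algebra to the associated graded algebra of its
  quotient. Every homogeneous component contributes in its own degree, not only the top one, which
  makes the map linear and multiplicative.\<close>

definition symbol :: "'a \<Rightarrow> nat \<Rightarrow> 'a set set" where
  "symbol x n = gcoset n (pr n x)"

lemma filt_below_eq: "filt_below D filt n = (\<lambda>x. I +> x) ` below n"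
proof (cases n)
  case 0
  have "I +> \<zero> = I" by (rule a_coset_add_zero) (use a_subset in auto)
  then show ?thesis using 0 by (simp add: filt_below_def below_0 alg_quot_simps)
qed (simp add: filt_below_def filt_def)

lemma filt_below_coset: "x \<in> carrier A \<Longrightarrow> filt_below D filt n +>\<^bsub>D\<^esub> (I +> x) = gcoset n x"
  unfolding filt_below_eq a_r_coset_def'[of D] gcoset_def
  by (auto simp: alg_quot_add below_closed) 

lemma gcoset_zero: "gcoset n \<zero> = filt_below D filt n"
  unfolding filt_below_eq gcoset_def by (auto simp: below_closed) (metis below_closed r_zero)

lemma gcoset_eq_iff:
  assumes x: "x \<in> carrier A" and y: "y \<in> carrier A"
  shows "gcoset n x = gcoset n y \<longleftrightarrow> (\<exists>z\<in>below n. x \<ominus> y \<ominus> z \<in> I)"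
proof
  assume "gcoset n x = gcoset n y"
  moreover have "I +> (\<zero> \<oplus> x) \<in> gcoset n x" using below_zero unfolding gcoset_def by blast
  ultimately have "I +> (\<zero> \<oplus> x) \<in> gcoset n y" by simp
  then obtain z where z: "z \<in> below n" "I +> (\<zero> \<oplus> x) = I +> (z \<oplus> y)"
    unfolding gcoset_def by blast
  then have "x \<ominus> (z \<oplus> y) \<in> I" using coset_eq_iff x y below_closed by simp
  also have "x \<ominus> (z \<oplus> y) = x \<ominus> y \<ominus> z"
    using x y z below_closed by (simp add: a_minus_def minus_add a_ac)
  finally show "\<exists>z\<in>below n. x \<ominus> y \<ominus> z \<in> I" using z by blast
next
  assume "\<exists>z\<in>below n. x \<ominus> y \<ominus> z \<in> I"
  then obtain z where z: "z \<in> below n" "x \<ominus> y \<ominus> z \<in> I" by blast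
  note [simp] = x y below_closed[OF z(1)]
  have 1: "I +> (w \<oplus> x) = I +> ((w \<oplus> z) \<oplus> y)" "I +> ((w \<ominus> z) \<oplus> x) = I +> (w \<oplus> y)" if "w \<in> below n" for w
  proof -
    note [simp] = below_closed[OF that]
    have e: "(w \<oplus> x) \<ominus> ((w \<oplus> z) \<oplus> y) = x \<ominus> y \<ominus> z"
    proof -
      have "(w \<oplus> x) \<ominus> ((w \<oplus> z) \<oplus> y) = (w \<oplus> \<ominus> w) \<oplus> (x \<ominus> y \<ominus> z)"
        by (simp add: a_minus_def minus_add a_ac del: r_neg)
      then show ?thesis by (simp add: r_neg)
    qed
    have e': "(w \<ominus> z \<oplus> x) \<ominus> (w \<oplus> y) = x \<ominus> y \<ominus> z"
    proof -
      have "(w \<ominus> z \<oplus> x) \<ominus> (w \<oplus> y) = (w \<oplus> \<ominus> w) \<oplus> (x \<ominus> y \<ominus> z)"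
        by (simp add: a_minus_def minus_add a_ac del: r_neg)
      then show ?thesis by (simp add: r_neg)
    qed
    show "I +> (w \<oplus> x) = I +> ((w \<oplus> z) \<oplus> y)" using z(2) by (subst coset_eq_iff) (simp_all add: e)
    show "I +> ((w \<ominus> z) \<oplus> x) = I +> (w \<oplus> y)" using z(2) by (subst coset_eq_iff) (simp_all add: e')
  qed
  show "gcoset n x = gcoset n y"
  proof
    show "gcoset n x \<subseteq> gcoset n y" unfolding gcoset_def using 1(1) below_add z(1) by blast
    show "gcoset n y \<subseteq> gcoset n x" unfolding gcoset_def using 1(2)[symmetric] below_minus z(1) by blast
  qed
qed

lemma gcoset_eqI: "x \<in> carrier A \<Longrightarrow> y \<in> carrier A \<Longrightarrow> x \<ominus> y \<in> below n \<Longrightarrow> gcoset n x = gcoset n y"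
  by (subst gcoset_eq_iff) (auto intro!: bexI[of _ "x \<ominus> y"] simp: r_neg a_minus_def)

lemma gcoset_add:
  assumes "x \<in> carrier A" "y \<in> carrier A"
  shows "gcoset n x <+>\<^bsub>D\<^esub> gcoset n y = gcoset n (x \<oplus> y)"
proof -
  have *: "(I +> (z \<oplus> x)) \<oplus>\<^bsub>D\<^esub> (I +> (w \<oplus> y)) = I +> ((z \<oplus> w) \<oplus> (x \<oplus> y))"
    if "z \<in> below n" "w \<in> below n" for z w
    using that assms by (simp add: alg_quot_add below_closed a_ac)
  have **: "I +> (z \<oplus> (x \<oplus> y)) = (I +> (z \<oplus> x)) \<oplus>\<^bsub>D\<^esub> (I +> (\<zero> \<oplus> y))" if "z \<in> below n" for z
    using that assms by (simp add: alg_quot_add below_closed a_ac)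
  show ?thesis
  proof
    show "gcoset n x <+>\<^bsub>D\<^esub> gcoset n y \<subseteq> gcoset n (x \<oplus> y)"
    proof
      fix X assume "X \<in> gcoset n x <+>\<^bsub>D\<^esub> gcoset n y"
      then obtain z w where "z \<in> below n" "w \<in> below n" "X = (I +> (z \<oplus> x)) \<oplus>\<^bsub>D\<^esub> (I +> (w \<oplus> y))"
        unfolding set_add_def' gcoset_def by blast
      then show "X \<in> gcoset n (x \<oplus> y)" unfolding gcoset_def using * below_add by blast
    qed
    show "gcoset n (x \<oplus> y) \<subseteq> gcoset n x <+>\<^bsub>D\<^esub> gcoset n y"
    proof
      fix X assume "X \<in> gcoset n (x \<oplus> y)"
      then obtain z where "z \<in> below n" "X = (I +> (z \<oplus> x)) \<oplus>\<^bsub>D\<^esub> (I +> (\<zero> \<oplus> y))"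
        unfolding gcoset_def using ** by blast
      then show "X \<in> gcoset n x <+>\<^bsub>D\<^esub> gcoset n y"
        unfolding set_add_def' gcoset_def using below_zero by blast
    qed
  qed
qed

lemma gcoset_smult:
  assumes "x \<in> carrier A"
  shows "(\<Union>X\<in>gcoset n x. filt_below D filt n +>\<^bsub>D\<^esub> (c \<odot>\<^bsub>D\<^esub> X)) = gcoset n (c \<odot> x)"
proof (rule UN_constant_eq)
  show "I +> (\<zero> \<oplus> x) \<in> gcoset n x" unfolding gcoset_def using below_zero by blast
  show "\<forall>X\<in>gcoset n x. filt_below D filt n +>\<^bsub>D\<^esub> (c \<odot>\<^bsub>D\<^esub> X) = gcoset n (c \<odot> x)"
  proof
    fix X assume "X \<in> gcoset n x"
    then obtain z where z: "z \<in> below n" "X = I +> (z \<oplus> x)" unfolding gcoset_def by blast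
    note [simp] = assms below_closed[OF z(1)] smult_closed
    have "filt_below D filt n +>\<^bsub>D\<^esub> (c \<odot>\<^bsub>D\<^esub> X) = gcoset n (c \<odot> (z \<oplus> x))"
      using z by (simp add: alg_quot_smult filt_below_coset)
    also have "\<dots> = gcoset n (c \<odot> x)"
    proof (rule gcoset_eqI)
      have "c \<odot> (z \<oplus> x) \<ominus> c \<odot> x = c \<odot> z"
        by (simp add: smult_add_right a_minus_def a_assoc r_neg)
      then show "c \<odot> (z \<oplus> x) \<ominus> c \<odot> x \<in> below n" using below_smult z by simp
    qed simp_all
    finally show "filt_below D filt n +>\<^bsub>D\<^esub> (c \<odot>\<^bsub>D\<^esub> X) = gcoset n (c \<odot> x)" .
  qed
qed

text \<open>Independence of representatives for the product of \<open>assoc_gr\<close>: changing one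
  factor by lower order terms changes the product of degree n only below n, so the unions run over
  equal cosets.\<close>

lemma gcoset_mult:
  assumes x: "\<And>i. x i \<in> carrier A" and y: "\<And>i. y i \<in> carrier A"
    and xb: "\<And>i. x i \<in> below (Suc i)" and yb: "\<And>i. y i \<in> below (Suc i)"
  shows "(\<Union>X\<in>Pi {..n} (\<lambda>i. gcoset i (x i)). \<Union>Y\<in>Pi {..n} (\<lambda>i. gcoset i (y i)).
     filt_below D filt n +>\<^bsub>D\<^esub> (\<Oplus>\<^bsub>D\<^esub>i\<in>{..n}. X i \<otimes>\<^bsub>D\<^esub> Y (n - i))) = gcoset n (\<Oplus>i\<in>{..n}. x i \<otimes> y (n - i))"
proof -
  have ne: "(\<lambda>i. I +> (\<zero> \<oplus> f i)) \<in> Pi {..n} (\<lambda>i. gcoset i (f i))" for f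
    unfolding gcoset_def using below_zero by blast
  have main: "filt_below D filt n +>\<^bsub>D\<^esub> (\<Oplus>\<^bsub>D\<^esub>i\<in>{..n}. X i \<otimes>\<^bsub>D\<^esub> Y (n - i)) = gcoset n (\<Oplus>i\<in>{..n}. x i \<otimes> y (n - i))"
    if X: "X \<in> Pi {..n} (\<lambda>i. gcoset i (x i))" and Y: "Y \<in> Pi {..n} (\<lambda>i. gcoset i (y i))" for X Y
  proof -
    have "\<forall>i\<in>{..n}. \<exists>z. z \<in> below i \<and> X i = I +> (z \<oplus> x i)" using X unfolding gcoset_def by blast
    then obtain z where z: "\<And>i. i \<le> n \<Longrightarrow> z i \<in> below i" "\<And>i. i \<le> n \<Longrightarrow> X i = I +> (z i \<oplus> x i)"
      unfolding bchoice_iff by auto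
    have "\<forall>i\<in>{..n}. \<exists>w. w \<in> below i \<and> Y i = I +> (w \<oplus> y i)" using Y unfolding gcoset_def by blast
    then obtain w where w: "\<And>i. i \<le> n \<Longrightarrow> w i \<in> below i" "\<And>i. i \<le> n \<Longrightarrow> Y i = I +> (w i \<oplus> y i)"
      unfolding bchoice_iff by auto
    interpret Q: k_algebra D by (rule quot_k_algebra)
    have zc: "z i \<in> carrier A" "w i \<in> carrier A" if "i \<le> n" for i
      using z(1) w(1) that below_closed by blast+
    note [simp] = x y zc
    let ?f = "\<lambda>i. (z i \<oplus> x i) \<otimes> (w (n - i) \<oplus> y (n - i))"
    let ?g = "\<lambda>i. x i \<otimes> y (n - i)"
    \<comment> \<open>The cross terms of the product: each contains a perturbation z or w, hence
      lies below n.\<close>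
    let ?d = "\<lambda>i. z i \<otimes> (w (n - i) \<oplus> y (n - i)) \<oplus> x i \<otimes> w (n - i)"
    have "(\<Oplus>\<^bsub>D\<^esub>i\<in>{..n}. X i \<otimes>\<^bsub>D\<^esub> Y (n - i)) = (\<Oplus>\<^bsub>D\<^esub>i\<in>{..n}. I +> ?f i)"
      by (rule Q.finsum_cong') (auto simp: z(2) w(2) alg_quot_mult alg_quot_simps)
    also have "\<dots> = I +> (\<Oplus>i\<in>{..n}. ?f i)" by (rule quot_finsum) auto
    finally have 1: "filt_below D filt n +>\<^bsub>D\<^esub> (\<Oplus>\<^bsub>D\<^esub>i\<in>{..n}. X i \<otimes>\<^bsub>D\<^esub> Y (n - i)) = gcoset n (\<Oplus>i\<in>{..n}. ?f i)"
      by (simp add: filt_below_coset finsum_closed Pi_iff)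
    have "(\<Oplus>i\<in>{..n}. ?f i) = (\<Oplus>i\<in>{..n}. ?d i \<oplus> ?g i)"
      by (rule finsum_cong') (auto simp: l_distr r_distr a_ac)
    also have "\<dots> = (\<Oplus>i\<in>{..n}. ?d i) \<oplus> (\<Oplus>i\<in>{..n}. ?g i)"
      by (rule finsum_addf) auto
    finally have 2: "(\<Oplus>i\<in>{..n}. ?f i) = (\<Oplus>i\<in>{..n}. ?d i) \<oplus> (\<Oplus>i\<in>{..n}. ?g i)" .
    have "?d i \<in> below n" if "i \<le> n" for i
    proof (rule below_add)
      have "w (n - i) \<in> below (Suc (n - i))" using w(1)[of "n - i"] below_mono[of "n - i" "Suc (n - i)"] by auto
      then have "w (n - i) \<oplus> y (n - i) \<in> below (Suc (n - i))" using yb below_add by blast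
      then show "z i \<otimes> (w (n - i) \<oplus> y (n - i)) \<in> below n"
        by (rule below_mult[OF z(1)[OF that]]) (use that in simp)
      have "w (n - i) \<in> below (n - i)" using w(1) by simp
      then show "x i \<otimes> w (n - i) \<in> below n"
        by (rule below_mult[OF xb]) (use that in simp)
    qed
    then have d: "(\<Oplus>i\<in>{..n}. ?d i) \<in> below n" by (intro below_finsum) simp_all
    have "gcoset n (\<Oplus>i\<in>{..n}. ?f i) = gcoset n (\<Oplus>i\<in>{..n}. ?g i)"
    proof (rule gcoset_eqI)
      have g: "(\<Oplus>i\<in>{..n}. ?g i) \<in> carrier A" by (auto intro: finsum_closed)
      have "(\<Oplus>i\<in>{..n}. ?f i) \<ominus> (\<Oplus>i\<in>{..n}. ?g i) = (\<Oplus>i\<in>{..n}. ?d i)"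
        unfolding 2 using g below_closed[OF d] by (simp add: a_minus_def a_assoc r_neg)
      then show "(\<Oplus>i\<in>{..n}. ?f i) \<ominus> (\<Oplus>i\<in>{..n}. ?g i) \<in> below n" using d by simp
    qed (auto intro!: finsum_closed)
    then show ?thesis using 1 by simp
  qed
  have inner: "(\<Union>Y\<in>Pi {..n} (\<lambda>i. gcoset i (y i)).
     filt_below D filt n +>\<^bsub>D\<^esub> (\<Oplus>\<^bsub>D\<^esub>i\<in>{..n}. X i \<otimes>\<^bsub>D\<^esub> Y (n - i))) = gcoset n (\<Oplus>i\<in>{..n}. x i \<otimes> y (n - i))"
    if "X \<in> Pi {..n} (\<lambda>i. gcoset i (x i))" for X
    by (rule UN_constant_eq[OF ne[of y]]) (use main that in blast)
  show ?thesis
    by (rule UN_constant_eq[OF ne[of x]]) (use inner in blast)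
qed

lemma symbol_alg_hom: "symbol \<in> alg_hom A (assoc_gr D filt)"
proof (rule alg_homI)
  fix x assume x: "x \<in> carrier A"
  have 1: "\<exists>a\<in>filt n. symbol x n = filt_below D filt n +>\<^bsub>D\<^esub> a" for n
    using x pr_below[OF x, of n] by (intro bexI[of _ "I +> pr n x"]) (auto simp: filt_below_coset symbol_def filt_def)
  obtain N where N: "\<forall>m>N. pr m x = \<zero>" using pr_sum[OF x] by blast
  have "{n. symbol x n \<noteq> filt_below D filt n} \<subseteq> {..N}"
    using N by (auto simp: symbol_def gcoset_zero not_less[symmetric])
  then have "finite {n. symbol x n \<noteq> filt_below D filt n}" using finite_subset by blast
  then show "symbol x \<in> carrier (assoc_gr D filt)" using 1 by (simp add: assoc_gr_def)
  show "symbol (c \<odot> x) = c \<odot>\<^bsub>assoc_gr D filt\<^esub> symbol x" for c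
    using x by (simp add: fun_eq_iff symbol_def assoc_gr_def gcoset_smult pr_smult)
  fix y assume y: "y \<in> carrier A"
  show "symbol (x \<oplus> y) = symbol x \<oplus>\<^bsub>assoc_gr D filt\<^esub> symbol y"
    using x y by (simp add: fun_eq_iff symbol_def assoc_gr_def gcoset_add pr_add)
  show "symbol (x \<otimes> y) = symbol x \<otimes>\<^bsub>assoc_gr D filt\<^esub> symbol y"
  proof (rule ext)
    fix n
    have e: "symbol z = (\<lambda>i. gcoset i (pr i z))" for z by (rule ext) (simp add: symbol_def)
    show "symbol (x \<otimes> y) n = (symbol x \<otimes>\<^bsub>assoc_gr D filt\<^esub> symbol y) n"
      using x y gcoset_mult[of "\<lambda>i. pr i x" "\<lambda>i. pr i y" n]
      by (simp add: e assoc_gr_def pr_mult pr_below)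
  qed
next
  show "symbol \<one> = \<one>\<^bsub>assoc_gr D filt\<^esub>"
    by (auto simp: fun_eq_iff symbol_def assoc_gr_def pr_one gcoset_zero filt_below_coset alg_quot_simps)
qed

lemma symbol_pr:
  assumes "x \<in> carrier A"
  shows "symbol (pr n x) m = (if m = n then gcoset n (pr n x) else filt_below D filt m)"
  using assms by (simp add: symbol_def pr_pr gcoset_zero)

lemma gr_rep:
  assumes "f \<in> carrier (assoc_gr D filt)"
  shows "\<exists>x\<in>carrier A. f n = gcoset n (pr n x)"
proof -
  obtain a where "a \<in> filt n" "f n = filt_below D filt n +>\<^bsub>D\<^esub> a"
    using assms unfolding assoc_gr_def by auto
  then obtain x where x: "x \<in> below (Suc n)" "f n = filt_below D filt n +>\<^bsub>D\<^esub> (I +> x)"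
    unfolding filt_def by blast
  then have "f n = gcoset n x" using filt_below_coset below_closed by simp
  also have "\<dots> = gcoset n (pr n x)"
    using x below_closed by (intro gcoset_eqI below_minus_pr) auto
  finally show ?thesis using x below_closed by blast
qed

lemma symbol_surj: "symbol ` carrier A = carrier (assoc_gr D filt)"
proof
  show "symbol ` carrier A \<subseteq> carrier (assoc_gr D filt)" using alg_homD(1)[OF symbol_alg_hom] by blast
  show "carrier (assoc_gr D filt) \<subseteq> symbol ` carrier A"
  proof
    fix f assume f: "f \<in> carrier (assoc_gr D filt)"
    have "\<forall>n. \<exists>x. x \<in> carrier A \<and> f n = gcoset n (pr n x)" using gr_rep[OF f] by blast
    from choice[OF this] obtain x
      where x: "\<And>n. x n \<in> carrier A" "\<And>n. f n = gcoset n (pr n (x n))" by blast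
    define S where "S = {n. f n \<noteq> filt_below D filt n}"
    have fin: "finite S" using f by (simp add: S_def assoc_gr_def)
    \<comment> \<open>One preimage is assembled from representatives in the finitely many degrees
      where f is nonzero; in all other degrees the zero component already represents f.\<close>
    define y where "y = (\<Oplus>n\<in>S. pr n (x n))"
    have y: "y \<in> carrier A" unfolding y_def using x(1) by (auto intro: finsum_closed)
    have "f n = symbol y n" for n
    proof -
      have "pr n y = (\<Oplus>m\<in>S. pr n (pr m (x m)))"
        unfolding y_def using fin x(1) by (intro pr_finsum) auto
      also have "\<dots> = (\<Oplus>m\<in>S. if n = m then pr m (x m) else \<zero>)"
        using x(1) by (intro finsum_cong') (auto simp: pr_pr)
      also have "\<dots> = (if n \<in> S then pr n (x n) else \<zero>)"
      proof (cases "n \<in> S")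
        case True
        then show ?thesis using finsum_singleton[of n S "\<lambda>m. pr m (x m)"] fin x(1) by auto
      next
        case False
        then show ?thesis by simp (rule add.finprod_one_eqI, auto)
      qed
      finally show ?thesis using x(2)[of n] by (auto simp: symbol_def gcoset_zero S_def)
    qed
    then have "f = symbol y" by (rule ext)
    then show "f \<in> symbol ` carrier A" using y by blast
  qed
qed

lemma symbol_part: "symbol ` (pr n ` carrier A) = assoc_gr_part D filt n"
proof
  show "symbol ` (pr n ` carrier A) \<subseteq> assoc_gr_part D filt n"
  proof
    fix f assume "f \<in> symbol ` (pr n ` carrier A)"
    then obtain x where x: "x \<in> carrier A" "f = symbol (pr n x)" by blast
    have "f \<in> carrier (assoc_gr D filt)"
      unfolding x(2) by (rule alg_homD(1)[OF symbol_alg_hom]) (simp add: x(1))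
    then show "f \<in> assoc_gr_part D filt n"
      unfolding assoc_gr_part_def using symbol_pr[OF x(1)] x(2) by simp
  qed
  show "assoc_gr_part D filt n \<subseteq> symbol ` (pr n ` carrier A)"
  proof
    fix f assume f: "f \<in> assoc_gr_part D filt n"
    then have fc: "f \<in> carrier (assoc_gr D filt)" by (simp add: assoc_gr_part_def)
    obtain x where x: "x \<in> carrier A" "f n = gcoset n (pr n x)"
      using gr_rep[OF fc] by blast
    then have "f = symbol (pr n x)"
      using f by (auto simp: fun_eq_iff symbol_pr assoc_gr_part_def)
    then show "f \<in> symbol ` (pr n ` carrier A)" using x by blast
  qed
qed

text \<open>The kernel of \<open>symbol\<close> consists of the elements whose components are
  leading forms of I: pr n (x - y) is the part of degree n of an element of I of degree at most n.
  The PBW property is a statement about this kernel.\<close>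

lemma symbol_eq_iff:
  assumes "x \<in> carrier A" "y \<in> carrier A"
  shows "symbol x = symbol y \<longleftrightarrow> (\<forall>n. \<exists>z\<in>below n. pr n (x \<ominus> y) \<ominus> z \<in> I)"
  using assms by (simp add: fun_eq_iff symbol_def gcoset_eq_iff pr_minus)

end

section \<open>Ideals of free algebras and the relations\<close>

lemma free_monoid_simps [simp]:
  "carrier free_monoid = UNIV" "a \<otimes>\<^bsub>free_monoid\<^esub> b = a @ b" "\<one>\<^bsub>free_monoid\<^esub> = []"
  by (simp_all add: free_monoid_def)

abbreviation fmul :: "('x list \<Rightarrow>\<^sub>0 'k::field) \<Rightarrow> ('x list \<Rightarrow>\<^sub>0 'k) \<Rightarrow> ('x list \<Rightarrow>\<^sub>0 'k)" (infixl "\<star>" 70) where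
  "p \<star> q \<equiv> p \<otimes>\<^bsub>free_alg\<^esub> q"

abbreviation smul :: "'k::field \<Rightarrow> ('x \<Rightarrow>\<^sub>0 'k) \<Rightarrow> ('x \<Rightarrow>\<^sub>0 'k)" where
  "smul c \<equiv> Poly_Mapping.map ((*) c)"

lemma monoid_alg_minus_left:
  "(p - p') \<otimes>\<^bsub>monoid_alg M\<^esub> q = p \<otimes>\<^bsub>monoid_alg M\<^esub> q - p' \<otimes>\<^bsub>monoid_alg M\<^esub> (q :: 'm \<Rightarrow>\<^sub>0 'k::field)"
  using monoid_alg_add_left[of M "p - p'" p' q] by (simp add: algebra_simps)

lemma monoid_alg_minus_right:
  "q \<otimes>\<^bsub>monoid_alg M\<^esub> (p - p') = q \<otimes>\<^bsub>monoid_alg M\<^esub> p - q \<otimes>\<^bsub>monoid_alg M\<^esub> (p' :: 'm \<Rightarrow>\<^sub>0 'k::field)"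
  using monoid_alg_add_right[of M q "p - p'" p'] by (simp add: algebra_simps)

lemma monoid_alg_uminus_left:
  "(- p) \<otimes>\<^bsub>monoid_alg M\<^esub> q = - (p \<otimes>\<^bsub>monoid_alg M\<^esub> (q :: 'm \<Rightarrow>\<^sub>0 'k::field))"
  using monoid_alg_minus_left[of M 0 p q] by simp

lemma monoid_alg_uminus_right:
  "q \<otimes>\<^bsub>monoid_alg M\<^esub> (- p) = - (q \<otimes>\<^bsub>monoid_alg M\<^esub> (p :: 'm \<Rightarrow>\<^sub>0 'k::field))"
  using monoid_alg_minus_right[of M q 0 p] by simp

lemmas fmul_distrib = monoid_alg_add_left monoid_alg_add_right monoid_alg_minus_left
  monoid_alg_minus_right monoid_alg_uminus_left monoid_alg_uminus_right

lemma fmul_assoc: "(p \<star> q) \<star> r = p \<star> (q \<star> r)"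
  by (rule monoid_alg_assoc[OF monoid_free_monoid]) auto

lemma fmul_Nil:
  fixes p :: "'x list \<Rightarrow>\<^sub>0 'k::field"
  shows "single [] c \<star> p = smul c p" "p \<star> single [] c = smul c p"
  by (subst (1) sum_single[of p], simp add: monoid_alg_sum_right monoid_alg_sum_left smult_eq_sum mult.commute)+

lemma smul_one [simp]: "smul 1 p = (p :: 'x \<Rightarrow>\<^sub>0 'k::field)"
  by (rule poly_mapping_eqI) simp

lemma monoid_alg_a_inv:
  assumes "monoid M" "keys p \<subseteq> carrier M"
  shows "\<ominus>\<^bsub>monoid_alg M\<^esub> p = - (p :: 'm \<Rightarrow>\<^sub>0 'k::field)"
proof -
  interpret k_algebra "monoid_alg M :: ('k, 'm \<Rightarrow>\<^sub>0 'k) module" by (rule monoid_alg_k_algebra) fact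
  show ?thesis by (rule minus_equality) (use assms in simp_all)
qed

lemma monoid_alg_idealI:
  assumes "monoid M" and sub: "N \<subseteq> carrier (monoid_alg M :: ('k::field, 'm \<Rightarrow>\<^sub>0 'k) module)"
    and "0 \<in> N" and add: "\<And>p q. p \<in> N \<Longrightarrow> q \<in> N \<Longrightarrow> p + q \<in> N"
    and l: "\<And>p q. p \<in> N \<Longrightarrow> keys q \<subseteq> carrier M \<Longrightarrow> q \<otimes>\<^bsub>monoid_alg M\<^esub> p \<in> N"
    and r: "\<And>p q. p \<in> N \<Longrightarrow> keys q \<subseteq> carrier M \<Longrightarrow> p \<otimes>\<^bsub>monoid_alg M\<^esub> q \<in> N"
  shows "ideal N (monoid_alg M)"
proof -
  interpret M: monoid M by fact
  interpret k_algebra "monoid_alg M :: ('k, 'm \<Rightarrow>\<^sub>0 'k) module" by (rule monoid_alg_k_algebra) fact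
  have neg: "- p \<in> N" if p: "p \<in> N" for p
  proof -
    have "single \<one>\<^bsub>M\<^esub> (-1) \<otimes>\<^bsub>monoid_alg M\<^esub> p \<in> N" by (rule l[OF p]) simp
    also have "single \<one>\<^bsub>M\<^esub> (-1::'k) = - single \<one>\<^bsub>M\<^esub> 1" by (simp add: single_uminus)
    also have "\<dots> \<otimes>\<^bsub>monoid_alg M\<^esub> p = - p"
      using l_one[of p] p sub by (auto simp: monoid_alg_uminus_left)
    finally show ?thesis .
  qed
  show ?thesis
  proof (rule idealI)
    show "subgroup N (add_monoid (monoid_alg M))"
    proof (rule add.subgroupI)
      show "N \<noteq> {}" using \<open>0 \<in> N\<close> by blast
      fix p assume p: "p \<in> N"
      then have "\<ominus>\<^bsub>monoid_alg M\<^esub> p = - p" using sub assms(1) by (intro monoid_alg_a_inv) auto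
      then show "\<ominus>\<^bsub>monoid_alg M\<^esub> p \<in> N" using neg p by simp
    qed (use sub add in auto)
  qed (use l r ring_axioms in auto)
qed

lemma free_idealI:
  assumes "0 \<in> N" "\<And>p q. p \<in> N \<Longrightarrow> q \<in> N \<Longrightarrow> p + q \<in> N"
    "\<And>p q. p \<in> N \<Longrightarrow> q \<star> p \<in> N" "\<And>p q. p \<in> N \<Longrightarrow> p \<star> q \<in> N"
  shows "ideal N (free_alg :: ('k::field, 'x list \<Rightarrow>\<^sub>0 'k) module)"
  by (rule monoid_alg_idealI[OF monoid_free_monoid]) (use assms in auto)

lemma monoid_alg_genideal:
  assumes "monoid M" "S \<subseteq> carrier (monoid_alg M :: ('k::field, 'm \<Rightarrow>\<^sub>0 'k) module)"
  shows "ideal (genideal (monoid_alg M) S) (monoid_alg M)" "S \<subseteq> genideal (monoid_alg M) S"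
proof -
  interpret k_algebra "monoid_alg M :: ('k, 'm \<Rightarrow>\<^sub>0 'k) module" by (rule monoid_alg_k_algebra) fact
  show "ideal (genideal (monoid_alg M) S) (monoid_alg M)" "S \<subseteq> genideal (monoid_alg M) S"
    using assms genideal_ideal genideal_self by auto
qed

lemma genideal_subset: "ideal J A \<Longrightarrow> S \<subseteq> J \<Longrightarrow> genideal A S \<subseteq> J"
  unfolding genideal_def by blast

lemma monoid_alg_quot_ideal:
  assumes "monoid M" "ideal I (monoid_alg M :: ('k::field, 'm \<Rightarrow>\<^sub>0 'k) module)"
  shows "alg_ideal (monoid_alg M) I"
  by (intro alg_ideal.intro monoid_alg_k_algebra assms)

lemma monoid_alg_ideal_closed:
  assumes M: "monoid M" and I: "ideal I (monoid_alg M :: ('k::field, 'm \<Rightarrow>\<^sub>0 'k) module)"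
  shows "0 \<in> I" "\<And>p q. p \<in> I \<Longrightarrow> q \<in> I \<Longrightarrow> p + q \<in> I" "\<And>c p. p \<in> I \<Longrightarrow> smul c p \<in> I"
    "\<And>p q. p \<in> I \<Longrightarrow> q \<in> I \<Longrightarrow> p - q \<in> I" "\<And>p. p \<in> I \<Longrightarrow> keys p \<subseteq> carrier M"
proof -
  interpret I: ideal I "monoid_alg M :: ('k::field, 'm \<Rightarrow>\<^sub>0 'k) module" by fact
  show "0 \<in> I" using additive_subgroup.zero_closed[OF I.additive_subgroup_axioms] by simp
  show a: "\<And>p q. p \<in> I \<Longrightarrow> q \<in> I \<Longrightarrow> p + q \<in> I"
    using additive_subgroup.a_closed[OF I.additive_subgroup_axioms] by simp
  show s: "\<And>c p. p \<in> I \<Longrightarrow> smul c p \<in> I"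
    using alg_ideal.I_smult[OF monoid_alg_quot_ideal[OF M I]] by simp
  have n: "smul (-1) p = - p" for p :: "'m \<Rightarrow>\<^sub>0 'k" by (rule poly_mapping_eqI) simp
  show "\<And>p q. p \<in> I \<Longrightarrow> q \<in> I \<Longrightarrow> p - q \<in> I" using a s[of _ "-1"] unfolding n by (metis add_uminus_conv_diff)
  show "\<And>p. p \<in> I \<Longrightarrow> keys p \<subseteq> carrier M" using I.a_subset by auto
qed

lemma free_ideal_closed:
  assumes "ideal I (free_alg :: ('k::field, 'x list \<Rightarrow>\<^sub>0 'k) module)"
  shows "0 \<in> I" "\<And>p q. p \<in> I \<Longrightarrow> q \<in> I \<Longrightarrow> p + q \<in> I" "\<And>p. p \<in> I \<Longrightarrow> - p \<in> I"
    "\<And>p q. p \<in> I \<Longrightarrow> q \<in> I \<Longrightarrow> p - q \<in> I"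
    "\<And>p q. p \<in> I \<Longrightarrow> q \<star> p \<in> I" "\<And>p q. p \<in> I \<Longrightarrow> p \<star> q \<in> I"
proof -
  interpret ideal I "free_alg :: ('k, 'x list \<Rightarrow>\<^sub>0 'k) module" by fact
  note cl = monoid_alg_ideal_closed[OF monoid_free_monoid assms]
  show "0 \<in> I" "\<And>p q. p \<in> I \<Longrightarrow> q \<in> I \<Longrightarrow> p + q \<in> I" "\<And>p q. p \<in> I \<Longrightarrow> q \<in> I \<Longrightarrow> p - q \<in> I"
    by (rule cl | assumption)+
  show "\<And>p. p \<in> I \<Longrightarrow> - p \<in> I" using cl(4)[OF cl(1)] by fastforce
  show "\<And>p q. p \<in> I \<Longrightarrow> q \<star> p \<in> I" "\<And>p q. p \<in> I \<Longrightarrow> p \<star> q \<in> I"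
    using I_l_closed I_r_closed by simp_all
qed

lemma free_ideal_sum:
  assumes "ideal I (free_alg :: ('k::field, 'x list \<Rightarrow>\<^sub>0 'k) module)" "\<And>i. i \<in> S \<Longrightarrow> f i \<in> I"
  shows "(\<Sum>i\<in>S. f i) \<in> I"
  using assms(2)
  by (induction S rule: infinite_finite_induct) (auto intro: free_ideal_closed[OF assms(1)])

section \<open>The deformed relations in the free algebra\<close>

definition def_rel :: "(nat \<Rightarrow> 'k) \<Rightarrow> nat \<Rightarrow> 'k::field efree" where
  "def_rel \<alpha> i = env_rel i - single [] (if i \<in> {1,2,3} then \<alpha> i else 0)"

definition def_ideal :: "(nat \<Rightarrow> 'k) \<Rightarrow> 'k::field efree set" where
  "def_ideal \<alpha> = genideal free_alg (def_rel \<alpha> ` {1..6})"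

lemma def_ideal_zero: "def_ideal (\<lambda>_. 0) = env_rel_ideal"
  by (simp add: def_ideal_def env_rel_ideal_def def_rel_def cong: image_cong)

lemma def_ideal_ideal: "ideal (def_ideal \<alpha>) free_alg"
  unfolding def_ideal_def by (rule monoid_alg_genideal[OF monoid_free_monoid]) simp

lemma def_rel_in: "i \<in> {1..6} \<Longrightarrow> def_rel \<alpha> i \<in> def_ideal \<alpha>"
  unfolding def_ideal_def using monoid_alg_genideal(2)[OF monoid_free_monoid] by fastforce

lemmas def_ideal_closed = free_ideal_closed[OF def_ideal_ideal]

lemma env_rel_ideal_ideal: "ideal env_rel_ideal free_alg"
  using def_ideal_ideal def_ideal_zero by metis

lemma env_rel_in: "i \<in> {1..6} \<Longrightarrow> env_rel i \<in> env_rel_ideal"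
  unfolding env_rel_ideal_def using monoid_alg_genideal(2)[OF monoid_free_monoid] by fastforce

lemmas env_rel_ideal_closed = free_ideal_closed[OF env_rel_ideal_ideal]

section \<open>Differential operators representing the deformation\<close>

text \<open>Coefficient functions with arbitrary support, that is, formal power series: each
  coefficient of the result of an operator depends on finitely many given ones, so no finiteness has
  to be carried along. The operators are written from the viewpoint of the resulting coefficient,
  e.g. v^2 d/dv contributes j - 1 times the coefficient of v^(j-1) to that of v^j.\<close>

type_synonym 'k pol = "nat \<times> nat \<times> nat \<times> nat \<Rightarrow> 'k"

text \<open>
  On \<open>k[u, v, u', v']\<close>, with \<open>(i, j, k, l)\<close> the exponent of \<open>u\<^sup>i v\<^sup>j u'\<^sup>k v'\<^sup>l\<close>, the generators \<open>v\<close> and \<open>v'\<close> act by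
  multiplication, \<open>u\<close> acts as \<open>u + (v\<^sup>2 - \<alpha>\<^sub>1) \<partial>\<^sub>v + \<alpha>\<^sub>3 \<partial>\<^sub>u\<^sub>'\<close> and \<open>u'\<close> acts as
  \<open>u' - (v'\<^sup>2 + \<alpha>\<^sub>2) \<partial>\<^sub>v\<^sub>'\<close>. The commutators of these operators are the relations of the deformation.
\<close>

fun gen_op :: "(nat \<Rightarrow> 'k) \<Rightarrow> egen \<Rightarrow> 'k::field pol \<Rightarrow> 'k pol" where
  "gen_op \<alpha> Ev f = (\<lambda>(i, j, k, l). if j = 0 then 0 else f (i, j - 1, k, l))"
| "gen_op \<alpha> Ev' f = (\<lambda>(i, j, k, l). if l = 0 then 0 else f (i, j, k, l - 1))"
| "gen_op \<alpha> Eu f = (\<lambda>(i, j, k, l).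
     (if i = 0 then 0 else f (i - 1, j, k, l)) + (if j = 0 then 0 else of_nat (j - 1) * f (i, j - 1, k, l))
     - \<alpha> 1 * of_nat (j + 1) * f (i, j + 1, k, l) + \<alpha> 3 * of_nat (k + 1) * f (i, j, k + 1, l))"
| "gen_op \<alpha> Eu' f = (\<lambda>(i, j, k, l).
     (if k = 0 then 0 else f (i, j, k - 1, l)) - (if l = 0 then 0 else of_nat (l - 1) * f (i, j, k, l - 1))
     - \<alpha> 2 * of_nat (l + 1) * f (i, j, k, l + 1))"

abbreviation word_op :: "(nat \<Rightarrow> 'k) \<Rightarrow> egen list \<Rightarrow> 'k::field pol \<Rightarrow> 'k pol" where
  "word_op \<alpha> w f \<equiv> foldr (gen_op \<alpha>) w f"

definition pol_op :: "(nat \<Rightarrow> 'k) \<Rightarrow> 'k efree \<Rightarrow> 'k::field pol \<Rightarrow> 'k pol" where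
  "pol_op \<alpha> p f = (\<lambda>m. \<Sum>w\<in>keys p. lookup p w * word_op \<alpha> w f m)"

lemma pol_op_superset:
  assumes "finite S" "keys p \<subseteq> S"
  shows "pol_op \<alpha> p f m = (\<Sum>w\<in>S. lookup p w * word_op \<alpha> w f m)"
  unfolding pol_op_def by (rule sum.mono_neutral_left) (use assms in \<open>auto simp: in_keys_iff\<close>)

lemma pol_op_add: "pol_op \<alpha> (p + q) f m = pol_op \<alpha> p f m + pol_op \<alpha> q f m"
  using Poly_Mapping.keys_add[of p q]
  by (simp add: pol_op_superset[of "keys p \<union> keys q"] lookup_add
      distrib_right sum.distrib)

lemma pol_op_single: "pol_op \<alpha> (single w c) f m = c * word_op \<alpha> w f m"
  by (subst pol_op_superset[of "{w}"]) auto

lemma pol_op_0 [simp]: "pol_op \<alpha> 0 f m = 0"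
  by (simp add: pol_op_def)

lemma pol_op_uminus: "pol_op \<alpha> (- p) f m = - pol_op \<alpha> p f m"
  using pol_op_add[of \<alpha> p "- p" f m] by (simp add: eq_neg_iff_add_eq_0 add.commute)

lemma pol_op_minus: "pol_op \<alpha> (p - q) f m = pol_op \<alpha> p f m - pol_op \<alpha> q f m"
  using pol_op_add[of \<alpha> p "- q" f m] by (simp add: pol_op_uminus)

lemma pol_op_sum: "pol_op \<alpha> (\<Sum>i\<in>S. p i) f m = (\<Sum>i\<in>S. pol_op \<alpha> (p i) f m)"
  by (induction S rule: infinite_finite_induct) (simp_all add: pol_op_add)

lemma gen_op_linear:
  "gen_op \<alpha> x (\<lambda>m. f m + g m) = (\<lambda>m. gen_op \<alpha> x f m + gen_op \<alpha> x g m)"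
  "gen_op \<alpha> x (\<lambda>m. c * f m) = (\<lambda>m. c * gen_op \<alpha> x f m)"
  by (cases x; simp add: fun_eq_iff algebra_simps)+

lemma word_op_linear:
  "word_op \<alpha> w (\<lambda>m. f m + g m) = (\<lambda>m. word_op \<alpha> w f m + word_op \<alpha> w g m)"
  "word_op \<alpha> w (\<lambda>m. c * f m) = (\<lambda>m. c * word_op \<alpha> w f m)"
  by (induction w) (simp_all add: gen_op_linear)

lemma word_op_zero: "word_op \<alpha> w (\<lambda>m. 0) = (\<lambda>m. 0)"
  using word_op_linear(2)[of \<alpha> w 0 "\<lambda>_. 0"] by simp

lemma word_op_sum:
  "word_op \<alpha> w (\<lambda>m. \<Sum>i\<in>S. c i * f i m) = (\<lambda>m. \<Sum>i\<in>S. c i * word_op \<alpha> w (f i) m)"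
  by (induction S rule: infinite_finite_induct) (simp_all add: word_op_zero word_op_linear)

lemma pol_op_fmul: "pol_op \<alpha> (p \<star> q) f = pol_op \<alpha> p (pol_op \<alpha> q f)"
proof (rule ext)
  fix m
  have "pol_op \<alpha> (p \<star> q) f m =
    (\<Sum>v\<in>keys p. \<Sum>w\<in>keys q.
       lookup p v * lookup q w * word_op \<alpha> v (word_op \<alpha> w f) m)"
    by (subst sum_single[of p], subst sum_single[of q])
      (simp add: monoid_alg_sum_left monoid_alg_sum_right pol_op_sum pol_op_single, rule sum.swap)
  also have "\<dots> = pol_op \<alpha> p (pol_op \<alpha> q f) m"
    unfolding pol_op_def by (simp add: word_op_sum sum_distrib_left mult.assoc)
  finally show "pol_op \<alpha> (p \<star> q) f m = pol_op \<alpha> p (pol_op \<alpha> q f) m" .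
qed

lemma pol_op_zero: "pol_op \<alpha> p (\<lambda>_. 0) = (\<lambda>_. 0)"
  by (simp add: pol_op_def word_op_zero)

text \<open>Each deformed relation is a commutation rule of the operators, checked coefficient by
  coefficient; splitting exponents into zero and successor settles the boundary tests of
  \<open>gen_op\<close>.\<close>

lemma pol_op_def_rel:
  assumes "i \<in> {1..6}"
  shows "pol_op \<alpha> (def_rel \<alpha> i) f m = 0"
proof -
  obtain a b c d where m: "m = (a, b, c, d)" by (cases m)
  note simps = m def_rel_def env_rel_def pol_op_add pol_op_minus pol_op_single algebra_simps
  consider "i = 1" | "i = 2" | "i = 3" | "i = 4" | "i = 5" | "i = 6" using assms by fastforce
  then show ?thesis
  proof cases
    case 1 then show ?thesis by (cases a; cases b) (simp_all add: simps)
  next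
    case 2 then show ?thesis by (cases c; cases d) (simp_all add: simps)
  next
    case 3 then show ?thesis by (cases a; cases b; cases c; cases d) (simp_all add: simps)
  next
    case 4 then show ?thesis by (cases b; cases c; cases d) (simp_all add: simps)
  next
    case 5 then show ?thesis by (cases a; cases b; cases d) (simp_all add: simps)
  next
    case 6 then show ?thesis by (cases b; cases d) (simp_all add: simps)
  qed
qed

lemma pol_op_def_ideal:
  assumes "p \<in> def_ideal \<alpha>"
  shows "pol_op \<alpha> p f = (\<lambda>_. 0)"
proof -
  \<comment> \<open>Quantifying over all f makes the annihilator closed under multiplication from
    the right as well: p \<star> q acts as p on the image of q.\<close>
  have "ideal {p. \<forall>f. pol_op \<alpha> p f = (\<lambda>_. 0)} free_alg"
  proof (rule free_idealI)
    fix p q assume "p \<in> {p. \<forall>f. pol_op \<alpha> p f = (\<lambda>_. 0)}"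
    then have p: "\<And>f. pol_op \<alpha> p f = (\<lambda>_. 0)" by blast
    show "q \<star> p \<in> {p. \<forall>f. pol_op \<alpha> p f = (\<lambda>_. 0)}" "p \<star> q \<in> {p. \<forall>f. pol_op \<alpha> p f = (\<lambda>_. 0)}"
      by (simp_all add: pol_op_fmul p pol_op_zero)
    assume "q \<in> {p. \<forall>f. pol_op \<alpha> p f = (\<lambda>_. 0)}"
    then have q: "\<And>f. pol_op \<alpha> q f = (\<lambda>_. 0)" by blast
    show "p + q \<in> {p. \<forall>f. pol_op \<alpha> p f = (\<lambda>_. 0)}" using pol_op_add[of \<alpha> p q] p q by auto
  qed (auto simp: fun_eq_iff)
  then have "def_ideal \<alpha> \<subseteq> {p. \<forall>f. pol_op \<alpha> p f = (\<lambda>_. 0)}"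
    unfolding def_ideal_def by (rule genideal_subset) (auto simp: pol_op_def_rel fun_eq_iff)
  then show ?thesis using assms by blast
qed

section \<open>Normal words\<close>

definition delta :: "nat \<times> nat \<times> nat \<times> nat \<Rightarrow> 'k::field pol" where
  "delta m = (\<lambda>m'. if m' = m then 1 else 0)"

definition pol_value :: "(nat \<Rightarrow> 'k) \<Rightarrow> 'k efree \<Rightarrow> 'k::field pol" where
  "pol_value \<alpha> p = pol_op \<alpha> p (delta (0, 0, 0, 0))"

text \<open>The order of the letters is chosen so that applying the word to \<open>1\<close> gives the monomial itself.\<close>

fun normal_word :: "nat \<times> nat \<times> nat \<times> nat \<Rightarrow> egen list" where
  "normal_word (i, j, k, l) = replicate l Ev' @ replicate j Ev @ replicate k Eu' @ replicate i Eu"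

abbreviation "no_def \<equiv> (\<lambda>_ :: nat. 0)"

text \<open>A monomial without v is killed by v^2 d/dv, and one without v' by v'^2 d/dv'. Hence
  \<open>Eu\<close> and \<open>Eu'\<close> act as plain multiplications as long as they act before
  \<open>Ev\<close> and \<open>Ev'\<close>, which dictates the order in
  \<open>normal_word\<close>.\<close>

lemma gen_op_delta:
  "gen_op no_def Eu (delta (i, 0, k, l)) = (delta (Suc i, 0, k, l) :: 'k::field pol)"
  "gen_op no_def Eu' (delta (i, j, k, 0)) = (delta (i, j, Suc k, 0) :: 'k pol)"
  "gen_op \<alpha> Ev (delta (i, j, k, l)) = (delta (i, Suc j, k, l) :: 'k pol)"
  "gen_op \<alpha> Ev' (delta (i, j, k, l)) = (delta (i, j, k, Suc l) :: 'k pol)"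
  by (auto simp: fun_eq_iff delta_def le_Suc_eq)

lemma word_op_normal_word: "word_op no_def (normal_word m) (delta (0, 0, 0, 0)) = (delta m :: 'k::field pol)"
proof -
  obtain i j k l where m: "m = (i, j, k, l)" by (cases m)
  have "word_op no_def (replicate i Eu) (delta (0, 0, 0, 0)) = (delta (i, 0, 0, 0) :: 'k pol)"
    by (induction i) (simp_all add: gen_op_delta del: gen_op.simps)
  moreover have "word_op no_def (replicate k Eu') (delta (i, 0, 0, 0)) = (delta (i, 0, k, 0) :: 'k pol)"
    by (induction k) (simp_all add: gen_op_delta del: gen_op.simps)
  moreover have "word_op no_def (replicate j Ev) (delta (i, 0, k, 0)) = (delta (i, j, k, 0) :: 'k pol)"
    by (induction j) (simp_all add: gen_op_delta del: gen_op.simps)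
  moreover have "word_op no_def (replicate l Ev') (delta (i, j, k, 0)) = (delta (i, j, k, l) :: 'k pol)"
    by (induction l) (simp_all add: gen_op_delta del: gen_op.simps)
  ultimately show ?thesis by (simp add: m del: gen_op.simps)
qed

text \<open>Different normal words produce different monomials from 1. The claim mentions no field,
  so the rationals serve as one on which to let the words act.\<close>

lemma inj_normal_word: "inj normal_word"
proof (rule injI)
  fix m m' assume "normal_word m = normal_word m'"
  then have "word_op no_def (normal_word m) (delta (0, 0, 0, 0)) m =
      (word_op no_def (normal_word m') (delta (0, 0, 0, 0)) m :: rat)" by simp
  then have "(delta m :: rat pol) m = delta m' m" unfolding word_op_normal_word .
  then show "m = m'" by (auto simp: delta_def split: if_splits)
qed

text \<open>Linear independence of the normal words modulo the relations: the value at 1 reads off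
  the coefficients, and it vanishes on the ideal.\<close>

lemma pol_value_normal:
  fixes p :: "'k::field efree"
  assumes "keys p \<subseteq> range normal_word"
  shows "pol_value no_def p m = lookup p (normal_word m)"
proof -
  have "pol_value no_def p m = (\<Sum>w\<in>keys p. if w = normal_word m then lookup p w else 0)"
    unfolding pol_value_def pol_op_def
  proof (rule sum.cong[OF refl])
    fix w assume "w \<in> keys p"
    then obtain m' where w: "w = normal_word m'" using assms by blast
    show "lookup p w * word_op no_def w (delta (0, 0, 0, 0)) m =
      (if w = normal_word m then lookup p w else 0)"
      unfolding w word_op_normal_word using injD[OF inj_normal_word, of m m'] by (auto simp: delta_def)
  qed
  also have "\<dots> = lookup p (normal_word m)"
    by (auto simp: in_keys_iff)
  finally show ?thesis .
qed

section \<open>Reduction to normal words modulo the relations\<close>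

definition env_eqv :: "'k::field efree \<Rightarrow> 'k efree \<Rightarrow> bool" (infix "\<approx>" 50) where
  "p \<approx> q \<longleftrightarrow> p - q \<in> env_rel_ideal"

lemma env_eqv_refl [simp]: "p \<approx> p"
  by (simp add: env_eqv_def env_rel_ideal_closed)

lemma env_eqv_trans [trans]: "p \<approx> q \<Longrightarrow> q \<approx> r \<Longrightarrow> p \<approx> r"
  unfolding env_eqv_def using env_rel_ideal_closed(2)[of "p - q" "q - r"] by simp

lemma env_eqv_sym: "p \<approx> q \<Longrightarrow> q \<approx> p"
  unfolding env_eqv_def using env_rel_ideal_closed(3)[of "p - q"] by simp

lemma env_eqv_add: "p \<approx> q \<Longrightarrow> p' \<approx> q' \<Longrightarrow> p + p' \<approx> q + q'"
  unfolding env_eqv_def using env_rel_ideal_closed(2)[of "p - q" "p' - q'"] by (simp add: algebra_simps)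

lemma env_eqv_mult: "p \<approx> q \<Longrightarrow> a \<star> p \<star> b \<approx> a \<star> q \<star> b"
  unfolding env_eqv_def monoid_alg_minus_left[symmetric] monoid_alg_minus_right[symmetric]
  by (intro env_rel_ideal_closed(5,6))

lemma env_eqv_rel:
  "word (a @ [Eu, Ev] @ b) \<approx> (word (a @ [Ev, Eu] @ b) + word (a @ [Ev, Ev] @ b) :: 'k::field efree)"
  "word (a @ [Eu', Ev'] @ b) \<approx> (word (a @ [Ev', Eu'] @ b) - word (a @ [Ev', Ev'] @ b) :: 'k efree)"
  "word (a @ [Eu, Eu'] @ b) \<approx> (word (a @ [Eu', Eu] @ b) :: 'k efree)"
  "word (a @ [Ev, Eu'] @ b) \<approx> (word (a @ [Eu', Ev] @ b) :: 'k efree)"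
  "word (a @ [Eu, Ev'] @ b) \<approx> (word (a @ [Ev', Eu] @ b) :: 'k efree)"
  "word (a @ [Ev, Ev'] @ b) \<approx> (word (a @ [Ev', Ev] @ b) :: 'k efree)"
proof -
  have m: "word a \<star> env_rel i \<star> word b \<in> (env_rel_ideal :: 'k efree set)" if "i \<in> {1..6}" for i
    by (intro env_rel_ideal_closed(5,6) env_rel_in that)
  show "word (a @ [Eu, Ev] @ b) \<approx> (word (a @ [Ev, Eu] @ b) + word (a @ [Ev, Ev] @ b) :: 'k efree)"
    using env_rel_ideal_closed(3)[OF m[of 1]] by (simp add: env_rel_def env_eqv_def fmul_distrib algebra_simps)
  show "word (a @ [Eu', Ev'] @ b) \<approx> (word (a @ [Ev', Eu'] @ b) - word (a @ [Ev', Ev'] @ b) :: 'k efree)"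
    using env_rel_ideal_closed(3)[OF m[of 2]] by (simp add: env_rel_def env_eqv_def fmul_distrib algebra_simps)
  show "word (a @ [Eu, Eu'] @ b) \<approx> (word (a @ [Eu', Eu] @ b) :: 'k efree)"
    using m[of 3] by (simp add: env_rel_def env_eqv_def fmul_distrib algebra_simps)
  show "word (a @ [Ev, Eu'] @ b) \<approx> (word (a @ [Eu', Ev] @ b) :: 'k efree)"
    using m[of 4] by (simp add: env_rel_def env_eqv_def fmul_distrib algebra_simps)
  show "word (a @ [Eu, Ev'] @ b) \<approx> (word (a @ [Ev', Eu] @ b) :: 'k efree)"
    using m[of 5] by (simp add: env_rel_def env_eqv_def fmul_distrib algebra_simps)
  show "word (a @ [Ev, Ev'] @ b) \<approx> (word (a @ [Ev', Ev] @ b) :: 'k efree)"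
    using m[of 6] by (simp add: env_rel_def env_eqv_def fmul_distrib algebra_simps)
qed

lemma env_eqv_commute:
  assumes "\<And>a b. word (a @ [x, y] @ b) \<approx> (word (a @ [y, x] @ b) :: 'k::field efree)"
  shows "word (a @ x # replicate n y @ b) \<approx> (word (a @ replicate n y @ x # b) :: 'k efree)"
proof (induction n arbitrary: a)
  case (Suc n)
  have "word (a @ x # replicate (Suc n) y @ b) \<approx> (word (a @ y # x # replicate n y @ b) :: 'k efree)"
    using assms[of a "replicate n y @ b"] by simp
  also have "\<dots> \<approx> word (a @ replicate (Suc n) y @ x # b)"
    using Suc[of "a @ [y]"] by simp
  finally show ?case .
qed simp

text \<open>The commutator with x is a derivation; it sends y to c y^2, hence y^n to n c
  y^(n+1).\<close>

lemma env_eqv_weyl: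
  assumes "\<And>a b. word (a @ [x, y] @ b) \<approx>
    (word (a @ [y, x] @ b) + single (a @ [y, y] @ b) c :: 'k::field efree)"
  shows "word (a @ x # replicate n y @ b) \<approx>
    word (a @ replicate n y @ x # b) + single (a @ replicate (Suc n) y @ b) (of_nat n * c)"
proof (induction n arbitrary: a)
  case (Suc n)
  have "word (a @ x # replicate (Suc n) y @ b) \<approx>
     word (a @ y # x # replicate n y @ b) + single (a @ replicate (Suc (Suc n)) y @ b) c"
    using assms[of a "replicate n y @ b"] by simp
  also have "\<dots> \<approx> (word (a @ replicate (Suc n) y @ x # b) +
      single (a @ replicate (Suc (Suc n)) y @ b) (of_nat n * c)) +
      single (a @ replicate (Suc (Suc n)) y @ b) c"
    using Suc[of "a @ [y]"] by (intro env_eqv_add) simp_all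
  also have "\<dots> = word (a @ replicate (Suc n) y @ x # b) +
      single (a @ replicate (Suc (Suc n)) y @ b) (of_nat (Suc n) * c)"
    by (simp add: add.assoc flip: single_add) (simp add: algebra_simps)
  finally show ?case .
qed simp

definition normalizable :: "'k::field efree set" where
  "normalizable = {p. \<exists>q. keys q \<subseteq> range normal_word \<and> p \<approx> q}"

lemma normalizable_add: "p \<in> normalizable \<Longrightarrow> q \<in> normalizable \<Longrightarrow> p + q \<in> normalizable"
proof -
  assume "p \<in> normalizable" "q \<in> normalizable"
  then obtain p' q' where "keys p' \<subseteq> range normal_word" "p \<approx> p'"
      "keys q' \<subseteq> range normal_word" "q \<approx> q'" unfolding normalizable_def by blast
  then show ?thesis unfolding normalizable_def
    using env_eqv_add Poly_Mapping.keys_add[of p' q'] by blast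
qed

lemma normalizable_sum: "(\<And>i. i \<in> S \<Longrightarrow> f i \<in> normalizable) \<Longrightarrow> (\<Sum>i\<in>S. f i) \<in> normalizable"
proof (induction S rule: infinite_finite_induct)
  case (insert x S)
  then show ?case by (simp add: normalizable_add)
qed (auto simp: normalizable_def intro!: exI[of _ 0])

lemma normalizable_eqv: "p \<approx> q \<Longrightarrow> q \<in> normalizable \<Longrightarrow> p \<in> normalizable"
  unfolding normalizable_def using env_eqv_trans by blast

lemma normalizable_normal: "single (normal_word m) c \<in> normalizable"
  unfolding normalizable_def by (auto intro!: exI[of _ "single (normal_word m) c"] split: if_splits)

lemma normalizable_smul:
  assumes "p \<in> normalizable"
  shows "smul c p \<in> normalizable"
proof -
  obtain q where q: "keys q \<subseteq> range normal_word" "p \<approx> q"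
    using assms unfolding normalizable_def by blast
  have "keys (smul c q) \<subseteq> range normal_word" using q(1) by (auto simp: in_keys_iff)
  moreover have "smul c p \<approx> smul c q"
    using env_eqv_mult[OF q(2), of "single [] c" "word []"] by (simp add: fmul_Nil) 
  ultimately show ?thesis unfolding normalizable_def by blast
qed

text \<open>The new letter moves right to its own block. Only \<open>Eu\<close> passing the power of
  \<open>Ev\<close>, and \<open>Eu'\<close> passing the power of \<open>Ev'\<close>, leave a
  correction, and this is again a multiple of a normal word.\<close>

lemma normalizable_step: "word (x # normal_word m) \<in> (normalizable :: 'k::field efree set)"
proof -
  obtain i j k l where m: "m = (i, j, k, l)" by (cases m)
  let ?U = "replicate i Eu" and ?V = "replicate j Ev" and ?U' = "replicate k Eu'" and ?V' = "replicate l Ev'"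
  have c: "replicate n y @ y # w = y # replicate n y @ w" for n and y :: egen and w
    by (simp add: replicate_app_Cons_same)
  note W = normalizable_normal[where 'a = 'k]
  show ?thesis
  proof (cases x)
    case Eu
    have "word (x # normal_word m) \<approx> (word (?V' @ Eu # ?V @ ?U' @ ?U) :: 'k efree)"
      using env_eqv_commute[OF env_eqv_rel(5), where a = "[]"] by (simp add: Eu m)
    also have "\<dots> \<approx> word (?V' @ ?V @ Eu # ?U' @ ?U) +
        single (?V' @ replicate (Suc j) Ev @ ?U' @ ?U) (of_nat j * 1)"
      by (rule env_eqv_weyl) (rule env_eqv_rel(1))
    also have "\<dots> \<approx> word (?V' @ ?V @ ?U' @ Eu # ?U) +
        single (?V' @ replicate (Suc j) Ev @ ?U' @ ?U) (of_nat j * 1)"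
      using env_eqv_commute[OF env_eqv_rel(3), where a = "?V' @ ?V"] by (intro env_eqv_add) simp_all
    finally show ?thesis
      by (rule normalizable_eqv)
        (use W[of "(Suc i, j, k, l)" 1] W[of "(i, Suc j, k, l)" "of_nat j"] in \<open>simp add: normalizable_add\<close>)
  next
    case Ev
    have "word (x # normal_word m) \<approx> (word (?V' @ Ev # ?V @ ?U' @ ?U) :: 'k efree)"
      using env_eqv_commute[OF env_eqv_rel(6), where a = "[]"] by (simp add: Ev m)
    then show ?thesis by (rule normalizable_eqv) (use W[of "(i, Suc j, k, l)" 1] in simp)
  next
    case Eu'
    have r: "word (a @ [Eu', Ev'] @ b) \<approx> word (a @ [Ev', Eu'] @ b) + single (a @ [Ev', Ev'] @ b) (- 1 :: 'k)" for a b
      using env_eqv_rel(2)[of a b] by (simp add: single_uminus)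
    have "word (x # normal_word m) \<approx> word (?V' @ Eu' # ?V @ ?U' @ ?U) +
        single (replicate (Suc l) Ev' @ ?V @ ?U' @ ?U) (of_nat l * (- 1 :: 'k))"
      using env_eqv_weyl[OF r, of "[]" l "?V @ ?U' @ ?U"] by (simp add: Eu' m)
    also have "\<dots> \<approx> word (?V' @ ?V @ Eu' # ?U' @ ?U) +
        single (replicate (Suc l) Ev' @ ?V @ ?U' @ ?U) (of_nat l * (- 1 :: 'k))"
      using env_eqv_commute[OF env_eqv_sym[OF env_eqv_rel(4)], where a = "?V'"]
      by (intro env_eqv_add) simp_all
    finally show ?thesis
      by (rule normalizable_eqv)
        (use W[of "(i, j, Suc k, l)" 1] W[of "(i, j, k, Suc l)" "of_nat l * (-1)"] in \<open>simp add: normalizable_add\<close>)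
  next
    case Ev'
    then show ?thesis using W[of "(i, j, k, Suc l)" 1] by (simp add: m)
  qed
qed

lemma word_normalizable: "word w \<in> (normalizable :: 'k::field efree set)"
proof (induction w)
  case Nil
  show ?case using normalizable_normal[of "(0,0,0,0)" 1] by simp
next
  case (Cons x w)
  then obtain q :: "'k efree" where q: "keys q \<subseteq> range normal_word" "word w \<approx> q"
    unfolding normalizable_def by blast
  have "word (x # w) \<approx> word [x] \<star> q"
    using env_eqv_mult[OF q(2), of "word [x]" "word []"] by (simp add: fmul_Nil fmul_assoc)
  also have "word [x] \<star> q = (\<Sum>v\<in>keys q. smul (lookup q v) (word (x # v)))"
    by (subst (1) sum_single[of q])
      (auto simp: monoid_alg_sum_right smult_eq_sum intro!: sum.cong)
  finally show ?case
  proof (rule normalizable_eqv)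
    show "(\<Sum>v\<in>keys q. smul (lookup q v) (word (x # v))) \<in> normalizable"
      using q(1) normalizable_step by (intro normalizable_sum normalizable_smul) fastforce
  qed
qed

lemma all_normalizable: "p \<in> (normalizable :: 'k::field efree set)"
proof -
  have "(\<Sum>w\<in>keys p. smul (lookup p w) (word w)) \<in> normalizable"
    by (intro normalizable_sum normalizable_smul word_normalizable)
  also have "(\<Sum>w\<in>keys p. smul (lookup p w) (word w)) = p"
    by (subst (3) sum_single[of p]) (auto simp: smult_eq_sum intro!: sum.cong)
  finally show ?thesis .
qed

text \<open>Applying p to 1 is a complete test: p reduces to a combination of normal words, whose
  coefficients are the values of p. Normal words thus form a basis modulo the relations.\<close>

lemma env_rel_ideal_iff_pol_value: "p \<in> env_rel_ideal \<longleftrightarrow> pol_value no_def p = (\<lambda>_. 0)"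
proof
  assume "p \<in> env_rel_ideal"
  then show "pol_value no_def p = (\<lambda>_. 0)" unfolding pol_value_def using pol_op_def_ideal[where \<alpha> = no_def] def_ideal_zero by blast
next
  assume v: "pol_value no_def p = (\<lambda>_. 0)"
  obtain q where q: "keys q \<subseteq> range normal_word" "p - q \<in> env_rel_ideal"
    using all_normalizable[of p] unfolding normalizable_def env_eqv_def by blast
  have "pol_value no_def (p - q) = (\<lambda>_. 0)" unfolding pol_value_def using q(2) pol_op_def_ideal[where \<alpha> = no_def] def_ideal_zero by blast
  then have "pol_value no_def q m = 0" for m
    using fun_cong[OF v, of m] pol_op_minus[of no_def p q "delta (0, 0, 0, 0)" m] by (simp add: pol_value_def)
  then have "lookup q (normal_word m) = 0" for m using pol_value_normal[OF q(1)] by simp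
  then have "keys q = {}" using q(1) by (auto simp: in_keys_iff simp del: normal_word.simps keys_eq_empty)
  then show "p \<in> env_rel_ideal" using q(2) by simp
qed

section \<open>Leading homogeneous parts\<close>

definition hpart :: "nat \<Rightarrow> ('x list \<Rightarrow>\<^sub>0 'k::field) \<Rightarrow> ('x list \<Rightarrow>\<^sub>0 'k)" where
  "hpart n p = Poly_Mapping.mapp (\<lambda>w c. if length w = n then c else 0) p"

lemma lookup_hpart: "lookup (hpart n p) w = (if length w = n then lookup p w else 0)"
  by (simp add: hpart_def lookup_mapp when_def in_keys_iff)

lemma hpart_add: "hpart n (p + q) = hpart n p + hpart n q"
  by (rule poly_mapping_eqI) (simp add: lookup_hpart lookup_add)

lemma hpart_minus: "hpart n (p - q) = hpart n p - hpart n q"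
  by (rule poly_mapping_eqI) (simp add: lookup_hpart lookup_minus)

lemma hpart_0 [simp]: "hpart n 0 = 0"
  by (rule poly_mapping_eqI) (simp add: lookup_hpart)

lemma hpart_smul: "hpart n (smul c p) = smul c (hpart n p)"
  by (rule poly_mapping_eqI) (simp add: lookup_hpart)

lemma hpart_hpart: "hpart m (hpart n p) = (if m = n then hpart n p else 0)"
  by (rule poly_mapping_eqI) (simp add: lookup_hpart)

lemma hpart_sum: "hpart n (\<Sum>i\<in>S. f i) = (\<Sum>i\<in>S. hpart n (f i))"
  by (induction S rule: infinite_finite_induct) (simp_all add: hpart_add)

lemma hpart_single: "hpart n (single w c) = (if length w = n then single w c else 0)"
  by (rule poly_mapping_eqI) (auto simp: lookup_hpart lookup_single when_def)

lemma hpart_sign_act: "hpart n (sign_act x p) = sign_act x (hpart n p)"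
  by (rule poly_mapping_eqI) (simp add: lookup_hpart lookup_sign_act)

lemma hpart_fmul:
  fixes p q :: "'x list \<Rightarrow>\<^sub>0 'k::field"
  shows "hpart n (p \<star> q) = (\<Sum>i\<le>n. hpart i p \<star> hpart (n - i) q)"
proof -
  have s: "(\<Sum>i\<le>n. hpart i (single a c) \<star> hpart (n - i) (single b d)) =
      hpart n (single (a @ b) (c * d))" for a b :: "'x list" and c d :: 'k
  proof -
    have "(\<Sum>i\<le>n. hpart i (single a c) \<star> hpart (n - i) (single b d)) =
      (\<Sum>i\<le>n. if i = length a then hpart n (single (a @ b) (c * d)) else 0)"
      by (intro sum.cong refl) (auto simp: hpart_single)
    also have "\<dots> = hpart n (single (a @ b) (c * d))"
      by (simp add: sum.delta hpart_single)
    finally show ?thesis .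
  qed
  let ?a = "\<lambda>a. single a (lookup p a)"
  let ?b = "\<lambda>b. single b (lookup q b)"
  have "(\<Sum>i\<le>n. hpart i p \<star> hpart (n - i) q) =
     (\<Sum>i\<le>n. \<Sum>b\<in>keys q. \<Sum>a\<in>keys p. hpart i (?a a) \<star> hpart (n - i) (?b b))"
    by (subst sum_single[of p], subst sum_single[of q])
      (simp only: hpart_sum monoid_alg_sum_left monoid_alg_sum_right)
  also have "\<dots> = (\<Sum>b\<in>keys q. \<Sum>i\<le>n. \<Sum>a\<in>keys p. hpart i (?a a) \<star> hpart (n - i) (?b b))"
    by (rule sum.swap)
  also have "\<dots> = (\<Sum>b\<in>keys q. \<Sum>a\<in>keys p. \<Sum>i\<le>n. hpart i (?a a) \<star> hpart (n - i) (?b b))"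
    by (intro sum.cong refl sum.swap)
  also have "\<dots> = hpart n (p \<star> q)"
  proof -
    have "p \<star> q = (\<Sum>b\<in>keys q. \<Sum>a\<in>keys p. ?a a \<star> ?b b)"
      by (subst (1) sum_single[of p], subst (1) sum_single[of q])
        (simp only: monoid_alg_sum_left monoid_alg_sum_right)
    then show ?thesis by (simp add: s hpart_sum)
  qed
  finally show ?thesis by simp
qed

lemma hpart_eq_0: "(\<And>w. w \<in> keys p \<Longrightarrow> length w \<noteq> n) \<Longrightarrow> hpart n p = 0"
  by (rule poly_mapping_eqI) (auto simp: lookup_hpart in_keys_iff)

lemma sum_hpart:
  assumes "\<And>w. w \<in> keys p \<Longrightarrow> length w \<le> N"
  shows "(\<Sum>i\<le>N. hpart i p) = p"
proof (rule poly_mapping_eqI)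
  fix w
  have "lookup (\<Sum>i\<le>N. hpart i p) w = (if length w \<le> N then lookup p w else 0)"
    by (simp add: lookup_sum lookup_hpart sum.delta)
  then show "lookup (\<Sum>i\<le>N. hpart i p) w = lookup p w"
    using assms[of w] by (auto simp: in_keys_iff)
qed

fun weight :: "nat \<times> nat \<times> nat \<times> nat \<Rightarrow> nat" where
  "weight (i, j, k, l) = i + j + k + l"

text \<open>The hypotheses say that f has degree at most n and g is its part of degree n. Undeformed
  operators raise the degree by exactly one, whereas the \<alpha> terms are pure derivatives and
  lower it by one, so they never reach the leading part.\<close>

lemma gen_op_leading:
  assumes "\<And>m. n \<le> weight m \<Longrightarrow> f m = g m" "\<And>m. n < weight m \<Longrightarrow> f m = 0" "\<And>m. weight m < n \<Longrightarrow> g m = 0"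
  shows "Suc n \<le> weight m \<Longrightarrow> gen_op \<alpha> x f m = gen_op no_def x g m"
    "Suc n < weight m \<Longrightarrow> gen_op \<alpha> x f m = 0" "weight m < Suc n \<Longrightarrow> gen_op no_def x g m = 0"
proof -
  obtain i j k l where m: "m = (i, j, k, l)" by (cases m)
  {
    assume w: "Suc n \<le> weight m"
    have e: "f m' = g m'" if "Suc (weight m') = weight m" for m'
      by (rule assms(1)) (use w that in simp)
    have z: "f m' = 0" if "weight m' = Suc (weight m)" for m'
      by (rule assms(2)) (use w that in simp)
    show "gen_op \<alpha> x f m = gen_op no_def x g m"
      by (cases x) (simp_all add: m e z)
  }
  {
    assume w: "Suc n < weight m"
    have z: "f m' = 0" if "weight m \<le> Suc (weight m')" for m'
      by (rule assms(2)) (use w that in simp)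
    show "gen_op \<alpha> x f m = 0"
      by (cases x) (simp_all add: m z)
  }
  {
    assume w: "weight m < Suc n"
    have z: "g m' = 0" if "Suc (weight m') = weight m" for m'
      by (rule assms(3)) (use w that in simp)
    show "gen_op no_def x g m = 0"
      by (cases x) (simp_all add: m z)
  }
qed

lemma word_op_leading:
  fixes \<alpha> :: "nat \<Rightarrow> 'k::field"
  defines "f w \<equiv> word_op \<alpha> w (delta (0, 0, 0, 0))" and "g w \<equiv> word_op no_def w (delta (0, 0, 0, 0))"
  shows "(\<forall>m. length w \<le> weight m \<longrightarrow> f w m = g w m) \<and> (\<forall>m. length w < weight m \<longrightarrow> f w m = 0) \<and>
    (\<forall>m. weight m < length w \<longrightarrow> g w m = 0)"
proof (induction w)
  case Nil
  show ?case by (auto simp: f_def g_def delta_def)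
next
  case (Cons x w)
  have s: "f (x # w) = gen_op \<alpha> x (f w)" "g (x # w) = gen_op no_def x (g w)"
    by (simp_all add: f_def g_def del: gen_op.simps)
  show ?case
    unfolding s length_Cons using gen_op_leading[of "length w" "f w" "g w"] Cons by blast
qed

text \<open>The operators of the deformation differ from those of the undeformed algebra by operators of
  lower degree only.\<close>

lemma leading_part_in_env_rel_ideal:
  assumes p: "p \<in> def_ideal \<alpha>" and deg: "\<And>w. w \<in> keys p \<Longrightarrow> length w \<le> n"
  shows "hpart n p \<in> env_rel_ideal"
  unfolding env_rel_ideal_iff_pol_value
proof (rule ext)
  fix m
  let ?f = "\<lambda>w. word_op \<alpha> w (delta (0, 0, 0, 0)) m" and ?g = "\<lambda>w. word_op no_def w (delta (0, 0, 0, 0)) m"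
  have keys: "keys (hpart n p) \<subseteq> keys p"
    by (auto simp: in_keys_iff lookup_hpart split: if_splits)
  have v: "pol_value no_def (hpart n p) m =
      (\<Sum>w\<in>keys p. (if length w = n then lookup p w else 0) * ?g w)"
    unfolding pol_value_def
    by (subst pol_op_superset[OF _ keys]) (simp_all add: lookup_hpart)
  show "pol_value no_def (hpart n p) m = 0"
  \<comment> \<open>In degree n, words shorter than n do not contribute to the deformed value and
    words of length n contribute as without deformation, so the coefficient is that of p acting on
    1. In other degrees the undeformed values of words of length n vanish.\<close>
  proof (cases "weight m = n")
    case True
    have "pol_value no_def (hpart n p) m = (\<Sum>w\<in>keys p. lookup p w * ?f w)"
      unfolding v
    proof (rule sum.cong[OF refl])
      fix w assume "w \<in> keys p"
      then have "length w \<le> n" by (rule deg)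
      moreover have "?f w = ?g w" if "length w = n"
        using conjunct1[OF word_op_leading[of w \<alpha>], rule_format, of m] that True by simp
      moreover have "?f w = 0" if "length w < n"
        using word_op_leading[of w \<alpha>] that True by blast
      ultimately show "(if length w = n then lookup p w else 0) * ?g w = lookup p w * ?f w"
        by (cases "length w = n") simp_all
    qed
    also have "\<dots> = 0" using fun_cong[OF pol_op_def_ideal[OF p], of _ m] unfolding pol_op_def by simp
    finally show ?thesis .
  next
    case False
    have "?g w = 0" if w: "length w = n" for w
    proof (cases "weight m < n")
      case True
      then show ?thesis using word_op_leading[of w no_def] w by blast
    next
      case *: False
      then have "length w < weight m" using w False by linarith
      then show ?thesis using word_op_leading[of w no_def] by blast
    qed
    then show ?thesis unfolding v by (intro sum.neutral) auto
  qed
qed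

lemma keys_fmul_length:
  assumes "w \<in> keys (p \<star> q)"
  obtains a b where "a \<in> keys p" "b \<in> keys q" "w = a @ b"
proof -
  have "keys (p \<star> q) \<subseteq> (\<Union>a\<in>keys p. \<Union>b\<in>keys q. {a @ b})"
    unfolding monoid_alg_def monoid.simps
    by (rule order_trans[OF keys_sum] UN_mono order_refl | simp split: if_splits)+
  then show thesis using that assms by blast
qed

section \<open>Leading forms of the deformed ideal\<close>

definition lower :: "nat \<Rightarrow> ('x list \<Rightarrow>\<^sub>0 'k::field) set" where
  "lower n = {p. \<forall>w\<in>keys p. length w < n}"

lemma lower_iff: "p \<in> lower n \<longleftrightarrow> (\<forall>m\<ge>n. hpart m p = 0)"
proof
  assume "p \<in> lower n"
  then show "\<forall>m\<ge>n. hpart m p = 0" by (fastforce intro!: hpart_eq_0 simp: lower_def)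
next
  assume h: "\<forall>m\<ge>n. hpart m p = 0"
  show "p \<in> lower n" unfolding lower_def
  proof (intro CollectI ballI, rule ccontr)
    fix w assume "w \<in> keys p" "\<not> length w < n"
    then have "lookup (hpart (length w) p) w = 0" "lookup p w \<noteq> 0"
      using h by (auto simp: in_keys_iff)
    then show False by (simp add: lookup_hpart)
  qed
qed

lemma lower_0: "0 \<in> lower n"
  by (simp add: lower_iff)

lemma lower_add: "p \<in> lower n \<Longrightarrow> q \<in> lower n \<Longrightarrow> p + q \<in> lower n"
  by (simp add: lower_iff hpart_add)

text \<open>For p homogeneous of degree n this says that p is the leading form of an element of the
  deformed ideal, or zero.\<close>

definition leads :: "(nat \<Rightarrow> 'k) \<Rightarrow> nat \<Rightarrow> 'k::field efree \<Rightarrow> bool" where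
  "leads \<alpha> n p \<longleftrightarrow> (\<exists>z\<in>lower n. p - z \<in> def_ideal \<alpha>)"

lemma leads_0: "leads \<alpha> n 0"
  unfolding leads_def by (auto intro!: bexI[of _ 0] simp: lower_0 def_ideal_closed)

lemma leads_add: "leads \<alpha> n p \<Longrightarrow> leads \<alpha> n q \<Longrightarrow> leads \<alpha> n (p + q)"
proof -
  assume "leads \<alpha> n p" "leads \<alpha> n q"
  then obtain z y where zy: "z \<in> lower n" "p - z \<in> def_ideal \<alpha>" "y \<in> lower n" "q - y \<in> def_ideal \<alpha>"
    unfolding leads_def by blast
  have "p + q - (z + y) \<in> def_ideal \<alpha>"
    using def_ideal_closed(2)[OF zy(2,4)] by (simp add: algebra_simps)
  then show ?thesis unfolding leads_def using lower_add zy by blast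
qed

lemma leads_sum: "(\<And>i. i \<in> S \<Longrightarrow> leads \<alpha> n (f i)) \<Longrightarrow> leads \<alpha> n (\<Sum>i\<in>S. f i)"
  by (induction S rule: infinite_finite_induct) (simp_all add: leads_0 leads_add)

lemma leads_mult_left:
  assumes "leads \<alpha> n p" "\<And>w. w \<in> keys q \<Longrightarrow> length w = i"
  shows "leads \<alpha> (i + n) (q \<star> p)"
proof -
  obtain z where z: "z \<in> lower n" "p - z \<in> def_ideal \<alpha>" using assms(1) unfolding leads_def by blast
  have "q \<star> z \<in> lower (i + n)"
    using z(1) assms(2) unfolding lower_def by (auto elim!: keys_fmul_length)
  moreover have "q \<star> p - q \<star> z \<in> def_ideal \<alpha>"
    using def_ideal_closed(5)[OF z(2)] by (simp add: fmul_distrib)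
  ultimately show ?thesis unfolding leads_def by blast
qed

lemma leads_mult_right:
  assumes "leads \<alpha> n p" "\<And>w. w \<in> keys q \<Longrightarrow> length w = i"
  shows "leads \<alpha> (n + i) (p \<star> q)"
proof -
  obtain z where z: "z \<in> lower n" "p - z \<in> def_ideal \<alpha>" using assms(1) unfolding leads_def by blast
  have "z \<star> q \<in> lower (n + i)"
    using z(1) assms(2) unfolding lower_def by (auto elim!: keys_fmul_length)
  moreover have "p \<star> q - z \<star> q \<in> def_ideal \<alpha>"
    using def_ideal_closed(6)[OF z(2)] by (simp add: fmul_distrib)
  ultimately show ?thesis unfolding leads_def by blast
qed

lemma keys_hpart: "w \<in> keys (hpart n p) \<Longrightarrow> length w = n"
  by (auto simp: in_keys_iff lookup_hpart split: if_splits)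

text \<open>The half of the comparison that holds for formal reasons: each relation is homogeneous
  of degree two and differs from its deformed version by a constant, and multiplication by
  homogeneous elements preserves being a leading form.\<close>

lemma env_rel_ideal_leads:
  assumes "p \<in> env_rel_ideal"
  shows "leads \<alpha> n (hpart n p)"
proof -
  have "ideal {p. \<forall>n. leads \<alpha> n (hpart n p)} free_alg"
  proof (rule free_idealI)
    fix p q assume p: "p \<in> {p. \<forall>n. leads \<alpha> n (hpart n p)}"
    have "leads \<alpha> n (hpart n (q \<star> p))" for n
      unfolding hpart_fmul
    proof (rule leads_sum)
      fix i assume "i \<in> {..n}"
      then show "leads \<alpha> n (hpart i q \<star> hpart (n - i) p)"
        using leads_mult_left[of \<alpha> "n - i" "hpart (n - i) p" "hpart i q" i] p keys_hpart by auto
    qed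
    then show "q \<star> p \<in> {p. \<forall>n. leads \<alpha> n (hpart n p)}" by blast
    have "leads \<alpha> n (hpart n (p \<star> q))" for n
      unfolding hpart_fmul
    proof (rule leads_sum)
      fix i assume "i \<in> {..n}"
      then show "leads \<alpha> n (hpart i p \<star> hpart (n - i) q)"
        using leads_mult_right[of \<alpha> i "hpart i p" "hpart (n - i) q" "n - i"] p keys_hpart by auto
    qed
    then show "p \<star> q \<in> {p. \<forall>n. leads \<alpha> n (hpart n p)}" by blast
  qed (simp_all add: leads_0 hpart_add leads_add)
  moreover have "env_rel i \<in> {p. \<forall>n. leads \<alpha> n (hpart n p)}" if i: "i \<in> {1..6}" for i
  proof (intro CollectI allI)
    fix n
    have "hpart n (env_rel i) = (if n = 2 then env_rel i else (0 :: 'a efree))"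
      by (simp add: env_rel_def hpart_add hpart_minus hpart_single)
    moreover have "leads \<alpha> 2 (env_rel i)"
      unfolding leads_def
      by (rule bexI[of _ "single [] (if i \<in> {1,2,3} then \<alpha> i else 0)"])
        (use def_rel_in[OF i, of \<alpha>] in \<open>auto simp: def_rel_def lower_def split: if_splits\<close>)
    ultimately show "leads \<alpha> n (hpart n (env_rel i))" by (simp add: leads_0)
  qed
  ultimately have "env_rel_ideal \<subseteq> {p. \<forall>n. leads \<alpha> n (hpart n p)}"
    unfolding env_rel_ideal_def by (intro genideal_subset) auto
  then show ?thesis using assms by blast
qed

lemma leads_env_rel_ideal:
  assumes "leads \<alpha> n (hpart n p)"
  shows "hpart n p \<in> env_rel_ideal"
proof -
  obtain z where z: "z \<in> lower n" "hpart n p - z \<in> def_ideal \<alpha>" using assms unfolding leads_def by blast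
  have "hpart n (hpart n p - z) \<in> env_rel_ideal"
  proof (rule leading_part_in_env_rel_ideal[OF z(2)])
    fix w assume "w \<in> keys (hpart n p - z)"
    then have "w \<in> keys (hpart n p) \<or> w \<in> keys z"
      by (auto simp: in_keys_iff lookup_minus)
    then show "length w \<le> n" using z(1) keys_hpart by (fastforce simp: lower_def)
  qed
  then show ?thesis using z(1) by (simp add: hpart_minus hpart_hpart lower_iff)
qed

text \<open>The PBW property before the group and the quotients enter: whatever \<alpha> is, the
  leading forms of the deformed ideal make up the undeformed one. The components may be tested one
  by one because their sum is p.\<close>

lemma env_rel_ideal_iff_leads: "p \<in> env_rel_ideal \<longleftrightarrow> (\<forall>n. leads \<alpha> n (hpart n p))"
proof
  assume "\<forall>n. leads \<alpha> n (hpart n p)"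
  then have h: "\<And>n. hpart n p \<in> env_rel_ideal" using leads_env_rel_ideal by blast
  obtain N where N: "\<And>w. w \<in> keys p \<Longrightarrow> length w \<le> N"
    using finite_nat_set_iff_bounded_le[of "length ` keys p"] by auto
  show "p \<in> env_rel_ideal"
    using free_ideal_sum[OF env_rel_ideal_ideal, of "{..N}" "\<lambda>n. hpart n p"] h sum_hpart[of p N] N by auto
qed (blast intro: env_rel_ideal_leads)

section \<open>Smash products with the group of order two\<close>

lemma C2_simps [simp]:
  "carrier C2 = {0, 1}" "\<one>\<^bsub>C2\<^esub> = 0" "x \<otimes>\<^bsub>C2\<^esub> y = (x + y) mod 2"
  "inv\<^bsub>C2\<^esub> 0 = 0" "inv\<^bsub>C2\<^esub> 1 = 1"
proof -
  show c: "carrier C2 = {0, 1}" by (auto simp: carrier_integer_mod_group)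
  show "\<one>\<^bsub>C2\<^esub> = 0" "x \<otimes>\<^bsub>C2\<^esub> y = (x + y) mod 2" by (simp_all add: integer_mod_group_def)
  interpret group C2 by simp
  show "inv\<^bsub>C2\<^esub> 0 = 0" "inv\<^bsub>C2\<^esub> 1 = 1"
    by (rule inv_equality; simp add: c integer_mod_group_def)+
qed

text \<open>The pair stands for a \<otimes> 1 + b \<otimes> g. Restriction to \<open>{0, 1}\<close>
  makes it an extensional function, as the carrier of \<open>smash\<close> demands.\<close>

definition duo :: "'r \<Rightarrow> 'r \<Rightarrow> int \<Rightarrow> 'r" where
  "duo a b = (\<lambda>x\<in>{0, 1}. if x = 0 then a else b)"

lemma duo_simps [simp]: "duo a b 0 = a" "duo a b 1 = b" "duo a b (Suc 0) = b"
  by (simp_all add: duo_def)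

lemma duo_eq_iff [simp]: "duo a b = duo c d \<longleftrightarrow> a = c \<and> b = d"
  by (metis duo_simps(1,2))

lemma PiE_duo: "f \<in> {0, 1} \<rightarrow>\<^sub>E S \<longleftrightarrow> (\<exists>a\<in>S. \<exists>b\<in>S. f = duo a b)"
proof
  assume f: "f \<in> {0, 1} \<rightarrow>\<^sub>E S"
  then have "f = duo (f 0) (f 1)" by (auto simp: duo_def fun_eq_iff PiE_def extensional_def)
  then show "\<exists>a\<in>S. \<exists>b\<in>S. f = duo a b" using f by blast
next
  assume "\<exists>a\<in>S. \<exists>b\<in>S. f = duo a b"
  then obtain a b where "a \<in> S" "b \<in> S" "f = duo a b" by blast
  then show "f \<in> {0, 1} \<rightarrow>\<^sub>E S" unfolding duo_def by (simp only: restrict_PiE_iff) simp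
qed

lemma smash_duo:
  "f \<in> carrier (smash R C2 act) \<longleftrightarrow> (\<exists>a\<in>carrier R. \<exists>b\<in>carrier R. f = duo a b)"
  "f \<in> smash_part C2 S \<longleftrightarrow> (\<exists>a\<in>S. \<exists>b\<in>S. f = duo a b)"
  "duo a b \<oplus>\<^bsub>smash R C2 act\<^esub> duo c d = duo (a \<oplus>\<^bsub>R\<^esub> c) (b \<oplus>\<^bsub>R\<^esub> d)"
  "r \<odot>\<^bsub>smash R C2 act\<^esub> duo a b = duo (r \<odot>\<^bsub>R\<^esub> a) (r \<odot>\<^bsub>R\<^esub> b)"
  "\<one>\<^bsub>smash R C2 act\<^esub> = duo \<one>\<^bsub>R\<^esub> \<zero>\<^bsub>R\<^esub>" "\<zero>\<^bsub>smash R C2 act\<^esub> = duo \<zero>\<^bsub>R\<^esub> \<zero>\<^bsub>R\<^esub>"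
  "smash_left R C2 a = duo a \<zero>\<^bsub>R\<^esub>"
  "smash_right R C2 h = duo (lookup h 0 \<odot>\<^bsub>R\<^esub> \<one>\<^bsub>R\<^esub>) (lookup h 1 \<odot>\<^bsub>R\<^esub> \<one>\<^bsub>R\<^esub>)"
  by (simp_all add: smash_def smash_part_def smash_left_def smash_right_def PiE_duo)
    (auto simp: duo_def fun_eq_iff)

lemma smash_duo_mult:
  assumes "ring R" "a \<in> carrier R" "b \<in> carrier R" "c \<in> carrier R" "d \<in> carrier R"
    and act: "\<And>g x. x \<in> carrier R \<Longrightarrow> act g x \<in> carrier R"
  shows "duo a b \<otimes>\<^bsub>smash R C2 act\<^esub> duo c d =
    duo (a \<otimes>\<^bsub>R\<^esub> act 0 c \<oplus>\<^bsub>R\<^esub> b \<otimes>\<^bsub>R\<^esub> act 1 d) (a \<otimes>\<^bsub>R\<^esub> act 0 d \<oplus>\<^bsub>R\<^esub> b \<otimes>\<^bsub>R\<^esub> act 1 c)"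
proof -
  interpret ring R by fact
  show ?thesis
    using assms(2-5) act by (auto simp: smash_def fun_eq_iff duo_def[of "_ \<oplus>\<^bsub>R\<^esub> _"])
qed

abbreviation sgn1 :: "('x list \<Rightarrow>\<^sub>0 'k::field) \<Rightarrow> ('x list \<Rightarrow>\<^sub>0 'k)" where
  "sgn1 \<equiv> sign_act 1"

lemma sign_act_0 [simp]: "sign_act 0 p = p"
  by (simp add: sign_act_def)

lemma sign_act_zero [simp]: "sign_act x 0 = 0"
  by (rule poly_mapping_eqI) (simp add: lookup_sign_act)

lemma sign_act_uminus [simp]: "sign_act x (- p) = - sign_act x p"
  by (rule poly_mapping_eqI) (simp add: lookup_sign_act)

lemma sign_act_minus [simp]: "sign_act x (p - q) = sign_act x p - sign_act x q"
  by (rule poly_mapping_eqI) (simp add: lookup_sign_act lookup_minus algebra_simps)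

lemma sign_act_fmul: "sign_act x (p \<star> q) = sign_act x p \<star> sign_act x q"
  by (rule ring_hom_mult[OF sign_act_hom]) simp_all

lemma free_smash_mult:
  "duo p q \<otimes>\<^bsub>free_smash\<^esub> duo p' q' =
    duo (p \<star> p' + q \<star> sgn1 q') (p \<star> q' + q \<star> sgn1 (p' :: 'k::field efree))"
proof -
  interpret k_algebra "free_alg :: ('k, 'k efree) module"
    by (rule monoid_alg_k_algebra[OF monoid_free_monoid])
  show ?thesis by (subst smash_duo_mult[OF ring_axioms]) simp_all
qed

lemma free_smash_carrier: "f \<in> carrier (free_smash :: ('k::field, _) module) \<longleftrightarrow> (\<exists>p q. f = duo p q)"
  by (simp add: smash_duo)

lemma free_smash_minus:
  "duo p q \<ominus>\<^bsub>free_smash\<^esub> duo p' q' = (duo (p - p') (q - q') :: int \<Rightarrow> 'k::field efree)"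
proof -
  interpret k_algebra "free_smash :: ('k, int \<Rightarrow> 'k efree) module" by (rule free_smash_k_algebra)
  have "\<ominus>\<^bsub>free_smash\<^esub> duo p' q' = (duo (- p') (- q') :: int \<Rightarrow> 'k efree)"
    by (rule minus_equality) (auto simp: smash_duo)
  then show ?thesis by (simp add: a_minus_def smash_duo)
qed

lemma free_smash_finsum:
  assumes "finite S"
  shows "(\<Oplus>\<^bsub>free_smash\<^esub>i\<in>S. duo (p i) (q i)) = (duo (\<Sum>i\<in>S. p i) (\<Sum>i\<in>S. q i) :: int \<Rightarrow> 'k::field efree)"
proof -
  interpret k_algebra "free_smash :: ('k, int \<Rightarrow> 'k efree) module" by (rule free_smash_k_algebra)
  show ?thesis using assms
  proof (induction S)
    case empty
    then show ?case by (simp add: smash_duo)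
  next
    case (insert x S)
    then show ?case by (subst finsum_insert) (auto simp: smash_duo)
  qed
qed

section \<open>The grading of the free smash product\<close>

definition smash_pr :: "nat \<Rightarrow> (int \<Rightarrow> 'k::field efree) \<Rightarrow> int \<Rightarrow> 'k efree" where
  "smash_pr n f = duo (hpart n (f 0)) (hpart n (f 1))"

lemma free_smash_graded: "graded_k_algebra (free_smash :: ('k::field, int \<Rightarrow> 'k efree) module) smash_pr"
proof (intro graded_k_algebra.intro graded_k_algebra_axioms.intro free_smash_k_algebra)
  fix x y :: "int \<Rightarrow> 'k efree" and n m c
  assume "x \<in> carrier free_smash"
  then obtain p q where x: "x = duo p q" using free_smash_carrier by blast
  show "smash_pr n x \<in> carrier free_smash" by (auto simp: smash_pr_def smash_duo)
  show "smash_pr n (c \<odot>\<^bsub>free_smash\<^esub> x) = c \<odot>\<^bsub>free_smash\<^esub> smash_pr n x"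
    by (simp add: x smash_pr_def smash_duo hpart_smul)
  show "smash_pr m (smash_pr n x) = (if m = n then smash_pr n x else \<zero>\<^bsub>free_smash\<^esub>)"
    by (simp add: x smash_pr_def smash_duo hpart_hpart)
  obtain N where N: "\<And>w. w \<in> keys p \<union> keys q \<Longrightarrow> length w \<le> N"
    using finite_nat_set_iff_bounded_le[of "length ` (keys p \<union> keys q)"] by auto
  have "\<forall>m>N. smash_pr m x = \<zero>\<^bsub>free_smash\<^esub>"
    using N by (fastforce simp: smash_pr_def x smash_duo intro!: hpart_eq_0)
  moreover have "x = (\<Oplus>\<^bsub>free_smash\<^esub>i\<in>{..N}. smash_pr i x)"
    using N by (simp add: smash_pr_def free_smash_finsum x sum_hpart)
  ultimately show "\<exists>N. (\<forall>m>N. smash_pr m x = \<zero>\<^bsub>free_smash\<^esub>) \<and> x = (\<Oplus>\<^bsub>free_smash\<^esub>i\<in>{..N}. smash_pr i x)"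
    by blast
  assume "y \<in> carrier free_smash"
  then obtain p' q' where y: "y = duo p' q'" using free_smash_carrier by blast
  show "smash_pr n (x \<oplus>\<^bsub>free_smash\<^esub> y) = smash_pr n x \<oplus>\<^bsub>free_smash\<^esub> smash_pr n y"
    by (simp add: x y smash_pr_def smash_duo hpart_add)
  show "smash_pr n (x \<otimes>\<^bsub>free_smash\<^esub> y) = (\<Oplus>\<^bsub>free_smash\<^esub>i\<in>{..n}. smash_pr i x \<otimes>\<^bsub>free_smash\<^esub> smash_pr (n - i) y)"
    by (simp add: x y smash_pr_def free_smash_mult free_smash_finsum hpart_add hpart_fmul hpart_sign_act sum.distrib)
next
  show "smash_pr n \<one>\<^bsub>free_smash\<^esub> = (if n = 0 then \<one>\<^bsub>free_smash\<^esub> else \<zero>\<^bsub>free_smash\<^esub>)" for n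
    by (simp add: smash_pr_def smash_duo hpart_single)
qed

section \<open>The deformed ideal of the smash product\<close>

lemma deform_gens:
  fixes \<kappa> :: "'k::field kappa"
  shows "smash_left free_alg C2 (env_rel i) \<ominus>\<^bsub>free_smash\<^esub> smash_right free_alg C2 (\<kappa> (env_rel i)) =
    duo (env_rel i - single [] (lookup (\<kappa> (env_rel i)) 0))
      (- single [] (lookup (\<kappa> (env_rel i)) 1))"
proof -
  have "smul c (single [] (1::'k)) = (single [] c :: 'k efree)" for c
    by (rule poly_mapping_eqI) (simp add: lookup_single when_def)
  then show ?thesis by (simp add: smash_duo free_smash_minus)
qed

lemma deform_ideal_ideal: "ideal (deform_ideal \<kappa>) (free_smash :: ('k::field, _) module)"
  and deform_ideal_gens: "i \<in> {1..6} \<Longrightarrow>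
    duo (env_rel i - single [] (lookup (\<kappa> (env_rel i)) 0))
      (- single [] (lookup (\<kappa> (env_rel i)) 1)) \<in> deform_ideal (\<kappa> :: 'k kappa)"
proof -
  interpret k_algebra "free_smash :: ('k, int \<Rightarrow> 'k efree) module" by (rule free_smash_k_algebra)
  have sub: "(\<lambda>i. duo (env_rel i - single [] (lookup (\<kappa> (env_rel i)) 0))
      (- single [] (lookup (\<kappa> (env_rel i)) 1))) ` {1..6} \<subseteq> carrier free_smash"
    by (auto simp: smash_duo)
  show "ideal (deform_ideal \<kappa>) free_smash"
    unfolding deform_ideal_def deform_gens by (rule genideal_ideal[OF sub])
  show "i \<in> {1..6} \<Longrightarrow>
    duo (env_rel i - single [] (lookup (\<kappa> (env_rel i)) 0))
      (- single [] (lookup (\<kappa> (env_rel i)) 1)) \<in> deform_ideal \<kappa>"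
    unfolding deform_ideal_def deform_gens using genideal_self[OF sub] by blast
qed

lemma filtered_quotient_deform: "filtered_quotient (free_smash :: ('k::field, _) module) smash_pr (deform_ideal \<kappa>)"
  by (intro filtered_quotient.intro alg_ideal.intro free_smash_graded free_smash_k_algebra deform_ideal_ideal)

lemma below_smash:
  "graded_k_algebra.below (free_smash :: ('k::field, _) module) smash_pr n = {duo p q |p q. p \<in> lower n \<and> q \<in> lower n}"
proof -
  interpret graded_k_algebra "free_smash :: ('k, _) module" smash_pr by (rule free_smash_graded)
  show ?thesis
    unfolding below_def free_smash_carrier by (auto simp: smash_pr_def smash_duo lower_iff)
qed

lemma filt_eq: "filtered_quotient.filt (free_smash :: ('k::field, _) module) smash_pr (deform_ideal \<kappa>) = deform_filt \<kappa>"
proof -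
  interpret filtered_quotient "free_smash :: ('k, _) module" smash_pr "deform_ideal \<kappa>"
    by (rule filtered_quotient_deform)
  have "below (Suc n) = smash_part C2 (words_upto_degree n)" for n
    unfolding below_smash
    by (auto simp: smash_duo lower_def words_upto_degree_def less_Suc_eq_le)
  then show ?thesis unfolding filt_def deform_filt_def by (simp add: fun_eq_iff)
qed

definition deform_symbol :: "'k::field kappa \<Rightarrow> (int \<Rightarrow> 'k efree) \<Rightarrow> nat \<Rightarrow> (int \<Rightarrow> 'k efree) set set" where
  "deform_symbol \<kappa> = filtered_quotient.symbol free_smash smash_pr (deform_ideal \<kappa>)"

lemma deform_symbol_props:
  fixes \<kappa> :: "'k::field kappa"
  shows "deform_symbol \<kappa> \<in> alg_hom free_smash (assoc_gr (deform_alg \<kappa>) (deform_filt \<kappa>))"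
    "deform_symbol \<kappa> ` carrier free_smash = carrier (assoc_gr (deform_alg \<kappa>) (deform_filt \<kappa>))"
    "deform_symbol \<kappa> ` (smash_pr n ` carrier free_smash) = assoc_gr_part (deform_alg \<kappa>) (deform_filt \<kappa>) n"
    "deform_symbol \<kappa> (duo p q) = deform_symbol \<kappa> (duo p' q') \<longleftrightarrow>
      (\<forall>n. \<exists>y\<in>lower n. \<exists>z\<in>lower n. duo (hpart n (p - p') - y) (hpart n (q - q') - z) \<in> deform_ideal \<kappa>)"
proof -
  interpret filtered_quotient "free_smash :: ('k, _) module" smash_pr "deform_ideal \<kappa>"
    by (rule filtered_quotient_deform)
  note d = deform_symbol_def deform_alg_def filt_eq[symmetric]
  show "deform_symbol \<kappa> \<in> alg_hom free_smash (assoc_gr (deform_alg \<kappa>) (deform_filt \<kappa>))"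
    unfolding d by (rule symbol_alg_hom)
  show "deform_symbol \<kappa> ` carrier free_smash = carrier (assoc_gr (deform_alg \<kappa>) (deform_filt \<kappa>))"
    unfolding d by (rule symbol_surj)
  show "deform_symbol \<kappa> ` (smash_pr n ` carrier free_smash) = assoc_gr_part (deform_alg \<kappa>) (deform_filt \<kappa>) n"
    unfolding d by (rule symbol_part)
  have c: "duo p q \<in> carrier free_smash" for p q :: "'k efree" by (auto simp: smash_duo)
  show "deform_symbol \<kappa> (duo p q) = deform_symbol \<kappa> (duo p' q') \<longleftrightarrow>
      (\<forall>n. \<exists>y\<in>lower n. \<exists>z\<in>lower n. duo (hpart n (p - p') - y) (hpart n (q - q') - z) \<in> deform_ideal \<kappa>)"
    unfolding deform_symbol_def symbol_eq_iff[OF c c] below_smash free_smash_minus smash_pr_def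
    by (simp add: Bex_def) (metis free_smash_minus)
qed

text \<open>The deformed relations involve only words of length two and the empty word, so the sign
  action fixes them.\<close>

lemma def_ideal_sign_act:
  assumes "p \<in> def_ideal \<alpha>"
  shows "sign_act x p \<in> def_ideal \<alpha>"
proof -
  have "ideal {p. sign_act x p \<in> def_ideal \<alpha>} free_alg"
    by (rule free_idealI) (simp_all add: def_ideal_closed sign_act_fmul sign_act_add)
  moreover have "sign_act x (def_rel \<alpha> i) = def_rel \<alpha> i" for i
    by (cases "x = 0") (simp_all add: def_rel_def env_rel_def sign_act_add sign_act_single)
  ultimately have "genideal free_alg (def_rel \<alpha> ` {1..6}) \<subseteq> {p. sign_act x p \<in> def_ideal \<alpha>}"
    by (intro genideal_subset) (auto simp: def_rel_in)
  then show ?thesis using assms by (auto simp: def_ideal_def)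
qed

text \<open>For scalar \<kappa> the generators lie in the free algebra and are fixed by g, so the
  ideal they generate in the smash product is I + I g with I =
  \<open>def_ideal \<alpha>\<close>.\<close>

lemma deform_ideal_eq:
  fixes \<kappa> :: "'k::field kappa"
  assumes \<kappa>: "\<And>i. i \<in> {1..6} \<Longrightarrow> \<kappa> (env_rel i) = single 0 (if i \<in> {1,2,3} then \<alpha> i else 0)"
  shows "duo p q \<in> deform_ideal \<kappa> \<longleftrightarrow> p \<in> def_ideal \<alpha> \<and> q \<in> def_ideal \<alpha>"
proof
  interpret S: k_algebra "free_smash :: ('k, int \<Rightarrow> 'k efree) module" by (rule free_smash_k_algebra)
  interpret I: ideal "deform_ideal \<kappa>" "free_smash :: ('k, _) module" by (rule deform_ideal_ideal)
  have gen: "duo (env_rel i - single [] (lookup (\<kappa> (env_rel i)) 0))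
      (- single [] (lookup (\<kappa> (env_rel i)) 1)) = duo (def_rel \<alpha> i) 0" if "i \<in> {1..6}" for i
    using \<kappa>[OF that] by (simp add: def_rel_def lookup_single)
  let ?N = "{duo p q |p q. p \<in> def_ideal \<alpha> \<and> q \<in> def_ideal \<alpha>}"
  have "ideal ?N free_smash"
  proof (rule idealI[OF S.ring_axioms])
    show "subgroup ?N (add_monoid free_smash)"
    proof (rule S.add.subgroupI)
      fix a assume "a \<in> ?N"
      then obtain p q where a: "a = duo p q" "p \<in> def_ideal \<alpha>" "q \<in> def_ideal \<alpha>" by blast
      have "\<ominus>\<^bsub>free_smash\<^esub> a = duo (- p) (- q)"
        by (rule S.minus_equality) (auto simp: smash_duo a)
      then show "\<ominus>\<^bsub>free_smash\<^esub> a \<in> ?N" using a def_ideal_closed by auto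
      fix b assume "b \<in> ?N"
      then show "a \<oplus>\<^bsub>free_smash\<^esub> b \<in> ?N" using a def_ideal_closed by (auto simp: smash_duo)
    qed (use def_ideal_closed in \<open>auto simp: smash_duo\<close>)
    fix a x :: "int \<Rightarrow> 'k efree" assume "a \<in> ?N" "x \<in> carrier free_smash"
    then obtain p q p' q' where a: "a = duo p q" "p \<in> def_ideal \<alpha>" "q \<in> def_ideal \<alpha>" and x: "x = duo p' q'"
      by (auto simp: smash_duo)
    show "x \<otimes>\<^bsub>free_smash\<^esub> a \<in> ?N"
      using a by (auto simp: x free_smash_mult def_ideal_sign_act intro!: def_ideal_closed(2,5))
    show "a \<otimes>\<^bsub>free_smash\<^esub> x \<in> ?N"
      using a by (auto simp: x free_smash_mult def_ideal_sign_act intro!: def_ideal_closed(2,6))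
  qed
  then have "deform_ideal \<kappa> \<subseteq> ?N"
    unfolding deform_ideal_def deform_gens
    by (rule genideal_subset) (auto simp: gen def_rel_in def_ideal_closed)
  then show "p \<in> def_ideal \<alpha> \<and> q \<in> def_ideal \<alpha>" if "duo p q \<in> deform_ideal \<kappa>"
    using that by auto
  have c: "duo p q \<in> carrier free_smash" for p q :: "'k efree" by (auto simp: smash_duo)
  have add: "x \<oplus>\<^bsub>free_smash\<^esub> y \<in> deform_ideal \<kappa>" if "x \<in> deform_ideal \<kappa>" "y \<in> deform_ideal \<kappa>" for x y
    using that by (rule additive_subgroup.a_closed[OF I.additive_subgroup_axioms])
  have "ideal {p. duo p 0 \<in> deform_ideal \<kappa>} free_alg"
  proof (rule free_idealI)
    show "0 \<in> {p. duo p 0 \<in> deform_ideal \<kappa>}"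
      using additive_subgroup.zero_closed[OF I.additive_subgroup_axioms] by (simp add: smash_duo)
    fix p q assume p: "p \<in> {p. duo p 0 \<in> deform_ideal \<kappa>}"
    show "q \<star> p \<in> {p. duo p 0 \<in> deform_ideal \<kappa>}" "p \<star> q \<in> {p. duo p 0 \<in> deform_ideal \<kappa>}"
      using I.I_l_closed[of "duo p 0" "duo q 0"] I.I_r_closed[of "duo p 0" "duo q 0"] c p
      by (simp_all add: free_smash_mult)
    assume "q \<in> {p. duo p 0 \<in> deform_ideal \<kappa>}"
    then show "p + q \<in> {p. duo p 0 \<in> deform_ideal \<kappa>}" using p add[of "duo p 0" "duo q 0"] by (simp add: smash_duo)
  qed
  moreover have "def_rel \<alpha> ` {1..6} \<subseteq> {p. duo p 0 \<in> deform_ideal \<kappa>}"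
    using deform_ideal_gens[of _ \<kappa>] gen by fastforce
  ultimately have N: "def_ideal \<alpha> \<subseteq> {p. duo p 0 \<in> deform_ideal \<kappa>}"
    unfolding def_ideal_def by (rule genideal_subset)
  assume "p \<in> def_ideal \<alpha> \<and> q \<in> def_ideal \<alpha>"
  then have pq: "duo p 0 \<in> deform_ideal \<kappa>" "duo q 0 \<in> deform_ideal \<kappa>" using N by auto
  \<comment> \<open>The right factor is g itself; multiplying by it moves q to the component at
    g.\<close>
  have "duo q 0 \<otimes>\<^bsub>free_smash\<^esub> duo 0 (single [] 1) \<in> deform_ideal \<kappa>"
    using I.I_r_closed[OF pq(2)] c by blast
  then have "duo 0 q \<in> deform_ideal \<kappa>" by (simp add: free_smash_mult fmul_Nil)
  then show "duo p q \<in> deform_ideal \<kappa>" using add[OF pq(1), of "duo 0 q"] by (simp add: smash_duo)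
qed

text \<open>The right-hand side does not mention \<alpha>: all scalar deformations have the same
  associated graded algebra as the undeformed one.\<close>

lemma deform_symbol_kernel:
  fixes \<kappa> :: "'k::field kappa"
  assumes \<kappa>: "\<And>i. i \<in> {1..6} \<Longrightarrow> \<kappa> (env_rel i) = single 0 (if i \<in> {1,2,3} then \<alpha> i else 0)"
  shows "deform_symbol \<kappa> (duo p q) = deform_symbol \<kappa> (duo p' q') \<longleftrightarrow>
     p - p' \<in> env_rel_ideal \<and> q - q' \<in> env_rel_ideal"
proof -
  have "duo a b \<in> deform_ideal \<kappa> \<longleftrightarrow> a \<in> def_ideal \<alpha> \<and> b \<in> def_ideal \<alpha>" for a b
    by (rule deform_ideal_eq) (rule \<kappa>)
  then show ?thesis
    unfolding deform_symbol_props(4) env_rel_ideal_iff_leads[of _ \<alpha>] leads_def by blast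
qed

section \<open>The presentation of the enveloping algebra\<close>

definition lin :: "('a \<Rightarrow> 'b) \<Rightarrow> ('a \<Rightarrow>\<^sub>0 'k::field) \<Rightarrow> ('b \<Rightarrow>\<^sub>0 'k)" where
  "lin \<phi> p = (\<Sum>a\<in>keys p. single (\<phi> a) (lookup p a))"

lemma lin_superset:
  assumes "finite S" "keys p \<subseteq> S"
  shows "lin \<phi> p = (\<Sum>a\<in>S. single (\<phi> a) (lookup p a))"
  unfolding lin_def by (rule sum.mono_neutral_left) (use assms in \<open>auto simp: in_keys_iff\<close>)

lemma lin_add: "lin \<phi> (p + q) = lin \<phi> p + lin \<phi> q"
  using Poly_Mapping.keys_add[of p q]
  by (simp add: lin_superset[of "keys p \<union> keys q"] lookup_add single_add sum.distrib)

lemma lin_0 [simp]: "lin \<phi> 0 = 0"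
  by (simp add: lin_def)

lemma lin_single [simp]: "lin \<phi> (single a c) = single (\<phi> a) c"
  by (subst lin_superset[of "{a}"]) auto

lemma lin_uminus: "lin \<phi> (- p) = - lin \<phi> p"
  using lin_add[of \<phi> p "- p"] by (simp add: eq_neg_iff_add_eq_0 add.commute)

lemma lin_minus: "lin \<phi> (p - q) = lin \<phi> p - lin \<phi> q"
  using lin_add[of \<phi> p "- q"] by (simp add: lin_uminus)

lemma lin_sum: "lin \<phi> (\<Sum>i\<in>S. f i) = (\<Sum>i\<in>S. lin \<phi> (f i))"
  by (induction S rule: infinite_finite_induct) (simp_all add: lin_add)

lemma smul_single [simp]: "smul c (single a d) = single a (c * d :: 'k::field)"
  by (rule poly_mapping_eqI) (simp add: lookup_single when_def)

lemma smul_sum: "smul c (\<Sum>i\<in>S. f i) = (\<Sum>i\<in>S. smul c (f i :: 'a \<Rightarrow>\<^sub>0 'k::field))"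
  by (rule poly_mapping_eqI) (simp add: lookup_sum sum_distrib_left)

lemma lin_smul: "lin \<phi> (smul c p) = smul c (lin \<phi> p)"
  unfolding smult_eq_sum[of c p] lin_sum lin_single by (simp add: lin_def smul_sum)

lemma keys_lin: "keys (lin \<phi> p) \<subseteq> \<phi> ` keys p"
  unfolding lin_def by (rule order_trans[OF keys_sum]) auto

lemma monoid_alg_mult_sum:
  "p \<otimes>\<^bsub>monoid_alg M\<^esub> q = (\<Sum>b\<in>keys q. \<Sum>a\<in>keys p.
    single (a \<otimes>\<^bsub>M\<^esub> b) (lookup p a * lookup q b :: 'k::field))"
  by (subst (1) sum_single[of p], subst (1) sum_single[of q])
    (simp only: monoid_alg_sum_left monoid_alg_sum_right monoid_alg_mult_single)

lemma lin_mult: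
  assumes "\<And>a b. \<phi> (a \<otimes>\<^bsub>M\<^esub> b) = \<phi> a \<otimes>\<^bsub>N\<^esub> \<phi> b"
  shows "lin \<phi> (p \<otimes>\<^bsub>monoid_alg M\<^esub> q) = lin \<phi> p \<otimes>\<^bsub>monoid_alg N\<^esub> lin \<phi> q"
  unfolding monoid_alg_mult_sum[of M]
  by (simp add: lin_sum assms lin_def[of \<phi> p] lin_def[of \<phi> q] monoid_alg_sum_left monoid_alg_sum_right)

lemma lin_antimult:
  assumes "\<And>a b. \<phi> (a \<otimes>\<^bsub>M\<^esub> b) = \<phi> b \<otimes>\<^bsub>N\<^esub> \<phi> a"
  shows "lin \<phi> (p \<otimes>\<^bsub>monoid_alg M\<^esub> q) = lin \<phi> q \<otimes>\<^bsub>monoid_alg N\<^esub> lin \<phi> p"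
proof -
  have "lin \<phi> (p \<otimes>\<^bsub>monoid_alg M\<^esub> q) = (\<Sum>b\<in>keys q. \<Sum>a\<in>keys p.
    single (\<phi> b \<otimes>\<^bsub>N\<^esub> \<phi> a) (lookup q b * lookup p a))"
    unfolding monoid_alg_mult_sum[of M] by (simp add: lin_sum assms mult.commute)
  also have "\<dots> = (\<Sum>a\<in>keys p. \<Sum>b\<in>keys q.
    single (\<phi> b \<otimes>\<^bsub>N\<^esub> \<phi> a) (lookup q b * lookup p a))"
    by (rule sum.swap)
  also have "\<dots> = lin \<phi> q \<otimes>\<^bsub>monoid_alg N\<^esub> lin \<phi> p"
    by (simp add: lin_def[of \<phi> p] lin_def[of \<phi> q] monoid_alg_sum_left monoid_alg_sum_right)
  finally show ?thesis .
qed

lemma monoid_alg_coset_eq_iff: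
  assumes M: "monoid M" and I: "ideal I (monoid_alg M :: ('k::field, 'm \<Rightarrow>\<^sub>0 'k) module)"
    and p: "keys p \<subseteq> carrier M" and q: "keys q \<subseteq> carrier M"
  shows "I +>\<^bsub>monoid_alg M\<^esub> p = I +>\<^bsub>monoid_alg M\<^esub> q \<longleftrightarrow> p - q \<in> I"
  using alg_ideal.coset_eq_iff[OF monoid_alg_quot_ideal[OF M I], of p q] p q
  by (simp add: a_minus_def monoid_alg_a_inv[OF M])

lemma monoid_alg_coset_mem:
  assumes M: "monoid M" and I: "ideal I (monoid_alg M :: ('k::field, 'm \<Rightarrow>\<^sub>0 'k) module)"
  shows "q \<in> I +>\<^bsub>monoid_alg M\<^esub> p \<longleftrightarrow> q - p \<in> I"
  unfolding a_r_coset_def' by (auto simp: algebra_simps intro!: bexI[of _ "q - p"])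

section \<open>The Jordan plane and its two copies in the free algebra\<close>

abbreviation jrel :: "'k::field jfree" where
  "jrel \<equiv> word [Jv, Ju] - word [Ju, Jv] + word [Jv, Jv]"

lemma jordan_ideal_ideal: "ideal jordan_ideal free_alg" and jrel_in: "jrel \<in> jordan_ideal"
  unfolding jordan_ideal_def using monoid_alg_genideal[OF monoid_free_monoid, of "{jrel}"] by auto

lemma jordan_class_eq_iff: "jordan_class p = jordan_class q \<longleftrightarrow> p - q \<in> jordan_ideal"
  unfolding jordan_class_def by (rule monoid_alg_coset_eq_iff[OF monoid_free_monoid jordan_ideal_ideal]) auto

lemma jordan_plane_simps:
  "carrier jordan_plane = range (jordan_class :: _ \<Rightarrow> 'k::field jordan_elem)"
  "\<one>\<^bsub>jordan_plane\<^esub> = (jordan_class (word []) :: 'k jordan_elem)"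
  "jordan_class p \<otimes>\<^bsub>jordan_plane\<^esub> jordan_class q = (jordan_class (p \<star> q) :: 'k jordan_elem)"
  "jordan_class p \<oplus>\<^bsub>jordan_plane\<^esub> jordan_class q = (jordan_class (p + q) :: 'k jordan_elem)"
  "c \<odot>\<^bsub>jordan_plane\<^esub> jordan_class p = (jordan_class (smul c p) :: 'k jordan_elem)"
proof -
  interpret alg_ideal "free_alg :: ('k, 'k jfree) module" jordan_ideal
    by (rule monoid_alg_quot_ideal[OF monoid_free_monoid jordan_ideal_ideal])
  show "carrier jordan_plane = range (jordan_class :: _ \<Rightarrow> 'k::field jordan_elem)"
    by (simp add: jordan_plane_def alg_quot_simps jordan_class_def fun_eq_iff image_def)
  show "\<one>\<^bsub>jordan_plane\<^esub> = (jordan_class (word []) :: 'k jordan_elem)"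
    by (simp add: jordan_plane_def alg_quot_simps jordan_class_def)
  show "jordan_class p \<otimes>\<^bsub>jordan_plane\<^esub> jordan_class q = (jordan_class (p \<star> q) :: 'k jordan_elem)"
    "jordan_class p \<oplus>\<^bsub>jordan_plane\<^esub> jordan_class q = (jordan_class (p + q) :: 'k jordan_elem)"
    "c \<odot>\<^bsub>jordan_plane\<^esub> jordan_class p = (jordan_class (smul c p) :: 'k jordan_elem)"
    unfolding jordan_plane_def jordan_class_def
    by (simp_all add: alg_quot_mult alg_quot_add alg_quot_smult)
qed

lemma opp_alg_simps [simp]:
  "carrier (opp_alg A) = carrier A" "x \<otimes>\<^bsub>opp_alg A\<^esub> y = y \<otimes>\<^bsub>A\<^esub> x" "x \<oplus>\<^bsub>opp_alg A\<^esub> y = x \<oplus>\<^bsub>A\<^esub> y"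
  "\<one>\<^bsub>opp_alg A\<^esub> = \<one>\<^bsub>A\<^esub>" "c \<odot>\<^bsub>opp_alg A\<^esub> y = c \<odot>\<^bsub>A\<^esub> y"
  by (simp_all add: opp_alg_def)

lemma jordan_ideal_sign_act:
  fixes p :: "'k::field jfree"
  assumes "p \<in> jordan_ideal"
  shows "sign_act x p \<in> jordan_ideal"
proof -
  have "ideal {p :: 'k jfree. sign_act x p \<in> jordan_ideal} free_alg"
    by (rule free_idealI)
      (simp_all add: sign_act_fmul sign_act_add free_ideal_closed[OF jordan_ideal_ideal])
  moreover have "sign_act x jrel = (jrel :: 'k jfree)"
    by (rule poly_mapping_eqI) (auto simp: lookup_sign_act lookup_add lookup_minus lookup_single when_def)
  ultimately have "genideal free_alg {jrel} \<subseteq> {p :: 'k jfree. sign_act x p \<in> jordan_ideal}"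
    using jrel_in by (intro genideal_subset) auto
  then show ?thesis using assms by (auto simp: jordan_ideal_def)
qed

lemma jordan_act_class: "jordan_act x (jordan_class p) = jordan_class (sign_act x p)"
proof -
  have mem: "q \<in> jordan_class p \<longleftrightarrow> q - p \<in> jordan_ideal" for q
    unfolding jordan_class_def by (rule monoid_alg_coset_mem[OF monoid_free_monoid jordan_ideal_ideal])
  show ?thesis unfolding jordan_act_def
  proof (rule UN_constant_eq)
    show "p \<in> jordan_class p" by (simp add: mem free_ideal_closed[OF jordan_ideal_ideal])
    show "\<forall>q\<in>jordan_class p. jordan_class (sign_act x q) = jordan_class (sign_act x p)"
      using jordan_ideal_sign_act by (auto simp: mem jordan_class_eq_iff simp flip: sign_act_minus)
  qed
qed

fun left_emb :: "jgen \<Rightarrow> egen" where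
  "left_emb Ju = Eu" | "left_emb Jv = Ev"

fun right_emb :: "jgen \<Rightarrow> egen" where
  "right_emb Ju = Eu'" | "right_emb Jv = Ev'"

definition lemb :: "'k::field jfree \<Rightarrow> 'k efree" where
  "lemb = lin (map left_emb)"

text \<open>Reversing the words makes this multiplicative on the opposite algebra. It sends the
  Jordan relation to -\<open>r\<^sub>2\<close>, which explains the sign of v'^2 there.\<close>

definition remb :: "'k::field jfree \<Rightarrow> 'k efree" where
  "remb = lin (\<lambda>w. rev (map right_emb w))"

lemma lemb_fmul: "lemb (p \<star> q) = lemb p \<star> lemb q"
  unfolding lemb_def by (rule lin_mult) simp

lemma remb_fmul: "remb (p \<star> q) = remb q \<star> remb p"
  unfolding remb_def by (rule lin_antimult) simp

lemma emb_linear: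
  "lemb (p + q) = lemb p + lemb q" "lemb (p - q) = lemb p - lemb q" "lemb (smul c p) = smul c (lemb p)" "lemb 0 = 0"
  "remb (p + q) = remb p + remb q" "remb (p - q) = remb p - remb q" "remb (smul c p) = smul c (remb p)" "remb 0 = 0"
  by (simp_all add: lemb_def remb_def lin_add lin_minus lin_smul)

lemma emb_jordan_ideal:
  fixes p :: "'k::field jfree"
  assumes "p \<in> jordan_ideal"
  shows "lemb p \<in> env_rel_ideal" "remb p \<in> env_rel_ideal"
proof -
  have l: "lemb jrel = (env_rel 1 :: 'k efree)" and r: "remb jrel = (- env_rel 2 :: 'k efree)"
    by (simp_all add: emb_linear env_rel_def) (simp_all add: lemb_def remb_def)
  have "ideal {p :: 'k jfree. lemb p \<in> env_rel_ideal} free_alg"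
    by (rule free_idealI) (simp_all add: lemb_fmul emb_linear env_rel_ideal_closed)
  moreover have "ideal {p :: 'k jfree. remb p \<in> env_rel_ideal} free_alg"
    by (rule free_idealI) (simp_all add: remb_fmul emb_linear env_rel_ideal_closed)
  moreover have "lemb jrel \<in> (env_rel_ideal :: 'k efree set)"
    unfolding l by (rule env_rel_in) simp
  moreover have "remb jrel \<in> (env_rel_ideal :: 'k efree set)"
    unfolding r by (intro env_rel_ideal_closed(3) env_rel_in) simp
  ultimately have "jordan_ideal \<subseteq> {p :: 'k jfree. lemb p \<in> env_rel_ideal}"
    "jordan_ideal \<subseteq> {p :: 'k jfree. remb p \<in> env_rel_ideal}"
    unfolding jordan_ideal_def by (intro genideal_subset; blast)+
  then show "lemb p \<in> env_rel_ideal" "remb p \<in> env_rel_ideal" using assms by auto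
qed

lemma env_eqv_fmul: "p \<approx> p' \<Longrightarrow> q \<approx> q' \<Longrightarrow> p \<star> q \<approx> p' \<star> q'"
proof -
  assume "p \<approx> p'" "q \<approx> q'"
  then have "p \<star> q - p' \<star> q \<in> env_rel_ideal" "p' \<star> q - p' \<star> q' \<in> env_rel_ideal"
    unfolding env_eqv_def using env_rel_ideal_closed(5)[of "q - q'" p'] env_rel_ideal_closed(6)[of "p - p'" q]
    by (simp_all add: fmul_distrib)
  then have "p \<star> q \<approx> p' \<star> q" "p' \<star> q \<approx> p' \<star> q'" by (simp_all add: env_eqv_def)
  then show ?thesis by (rule env_eqv_trans)
qed

lemma env_eqv_smul: "p \<approx> q \<Longrightarrow> smul c p \<approx> smul c q"
  using env_eqv_fmul[of "single [] c" "single [] c" p q] by (simp add: fmul_Nil)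

lemma env_eqv_sum: "(\<And>i. i \<in> S \<Longrightarrow> f i \<approx> g i) \<Longrightarrow> (\<Sum>i\<in>S. f i) \<approx> (\<Sum>i\<in>S. g i)"
  by (induction S rule: infinite_finite_induct) (simp_all add: env_eqv_add)

lemma gens_commute:
  "word (a @ [right_emb y, left_emb x] @ b) \<approx> (word (a @ [left_emb x, right_emb y] @ b) :: 'k::field efree)"
  by (cases x; cases y) (simp_all only: left_emb.simps right_emb.simps env_eqv_rel env_eqv_sym[OF env_eqv_rel(3)]
      env_eqv_sym[OF env_eqv_rel(4)] env_eqv_sym[OF env_eqv_rel(5)] env_eqv_sym[OF env_eqv_rel(6)])

lemma gen_commute_word:
  "word (a @ right_emb y # map left_emb v @ b) \<approx>
    (word (a @ map left_emb v @ right_emb y # b) :: 'k::field efree)"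
proof (induction v arbitrary: a)
  case (Cons x v)
  have "word (a @ right_emb y # map left_emb (x # v) @ b) \<approx>
      (word ((a @ [left_emb x]) @ right_emb y # map left_emb v @ b) :: 'k efree)"
    using gens_commute[of a y x "map left_emb v @ b"] by simp
  also have "\<dots> \<approx> word ((a @ [left_emb x]) @ map left_emb v @ right_emb y # b)"
    by (rule Cons.IH)
  finally show ?case by simp
qed simp

lemma words_commute:
  "word (map right_emb w @ map left_emb v) \<approx> (word (map left_emb v @ map right_emb w) :: 'k::field efree)"
proof (induction w)
  case (Cons y w)
  have "word (map right_emb (y # w) @ map left_emb v) \<approx>
      (word (right_emb y # map left_emb v @ map right_emb w) :: 'k efree)"
    using env_eqv_fmul[OF env_eqv_refl Cons.IH, of "word [right_emb y]"] by simp
  also have "\<dots> \<approx> word (map left_emb v @ map right_emb (y # w))"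
    using gen_commute_word[of "[]" y v "map right_emb w"] by simp
  finally show ?case .
qed simp

text \<open>By \<open>r\<^sub>3\<close> to \<open>r\<^sub>6\<close> every primed letter commutes
  with every unprimed one, and this passes from letters to words and to combinations of
  words.\<close>

lemma emb_commute: "remb q \<star> lemb p \<approx> lemb p \<star> remb q"
proof -
  let ?a = "\<lambda>a. single (map left_emb a) (lookup p a)"
  let ?b = "\<lambda>b. single (rev (map right_emb b)) (lookup q b)"
  have s: "?b b \<star> ?a a \<approx> ?a a \<star> ?b b" for a b
    using env_eqv_smul[OF words_commute[of "rev b" a], of "lookup p a * lookup q b"]
    by (simp add: rev_map mult.commute)
  have "remb q \<star> lemb p = (\<Sum>a\<in>keys p. \<Sum>b\<in>keys q. ?b b \<star> ?a a)"
    unfolding lemb_def remb_def lin_def by (simp only: monoid_alg_sum_left monoid_alg_sum_right)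
  also have "\<dots> \<approx> (\<Sum>a\<in>keys p. \<Sum>b\<in>keys q. ?a a \<star> ?b b)"
    by (intro env_eqv_sum s)
  also have "\<dots> = (\<Sum>b\<in>keys q. \<Sum>a\<in>keys p. ?a a \<star> ?b b)"
    by (rule sum.swap)
  also have "\<dots> = lemb p \<star> remb q"
    unfolding lemb_def remb_def lin_def by (simp only: monoid_alg_sum_left monoid_alg_sum_right)
  finally show ?thesis .
qed

section \<open>From the tensor product back to the free algebra\<close>

abbreviation "JJ \<equiv> jordan_plane \<times>\<times> opp_alg jordan_plane"

lemma JJ_monoid: "monoid (JJ :: ('k::field jordan_elem \<times> 'k jordan_elem) monoid)"
proof -
  interpret A: k_algebra "jordan_plane :: ('k, _) module" by (rule jordan_plane_k_algebra)
  interpret B: k_algebra "opp_alg (jordan_plane :: ('k, _) module)" by (rule opp_k_algebra[OF jordan_plane_k_algebra])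
  show ?thesis by (rule DirProd_monoid[OF A.monoid_axioms B.monoid_axioms])
qed

lemma JJ_simps:
  "carrier JJ = range jordan_class \<times> range jordan_class"
  "(X, Y) \<otimes>\<^bsub>JJ\<^esub> (X', Y') = (X \<otimes>\<^bsub>jordan_plane\<^esub> X', Y' \<otimes>\<^bsub>jordan_plane\<^esub> Y)"
  "\<one>\<^bsub>JJ\<^esub> = (jordan_class (word []), jordan_class (word []))"
  by (simp_all add: DirProd_def jordan_plane_simps)

definition rep :: "'k::field jordan_elem \<Rightarrow> 'k jfree" where
  "rep X = (SOME p. jordan_class p = X)"

lemma rep_class: "rep (jordan_class p) - p \<in> jordan_ideal"
proof -
  have "jordan_class (rep (jordan_class p)) = jordan_class p" unfolding rep_def by (rule someI) (rule refl)
  then show ?thesis by (simp add: jordan_class_eq_iff)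
qed

text \<open>The tensor of X and Y becomes a product of chosen representatives. The choice matters
  only up to the relations, so all facts about it are stated with \<open>\<approx>\<close>.\<close>

definition unpair :: "'k::field jordan_elem \<times> 'k jordan_elem \<Rightarrow> 'k efree" where
  "unpair XY = lemb (rep (fst XY)) \<star> remb (rep (snd XY))"

lemma unpair_class: "unpair (jordan_class p, jordan_class q) \<approx> lemb p \<star> remb q"
proof -
  have "lemb (rep (jordan_class p)) \<approx> lemb p" "remb (rep (jordan_class q)) \<approx> remb q"
    using emb_jordan_ideal(1)[OF rep_class] emb_jordan_ideal(2)[OF rep_class] by (simp_all add: env_eqv_def emb_linear)
  then show ?thesis unfolding unpair_def by (simp add: env_eqv_fmul)
qed

text \<open>The inner factors \<open>remb q\<close> and \<open>lemb p'\<close> have to change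
  places, which is \<open>emb_commute\<close>; the reversed product in the second component is
  absorbed by \<open>remb\<close>.\<close>

lemma unpair_mult:
  assumes "A \<in> carrier JJ" "B \<in> carrier JJ"
  shows "unpair (A \<otimes>\<^bsub>JJ\<^esub> B) \<approx> unpair A \<star> unpair B"
proof -
  obtain p q p' q' where AB: "A = (jordan_class p, jordan_class q)" "B = (jordan_class p', jordan_class q')"
    using assms unfolding JJ_simps by blast
  have "unpair (A \<otimes>\<^bsub>JJ\<^esub> B) \<approx> lemb p \<star> (lemb p' \<star> remb q) \<star> remb q'"
    using unpair_class[of "p \<star> p'" "q' \<star> q"] by (simp add: AB JJ_simps jordan_plane_simps lemb_fmul remb_fmul fmul_assoc)
  also have "\<dots> \<approx> lemb p \<star> (remb q \<star> lemb p') \<star> remb q'"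
    by (rule env_eqv_mult) (rule env_eqv_sym[OF emb_commute])
  also have "\<dots> = (lemb p \<star> remb q) \<star> (lemb p' \<star> remb q')" by (simp add: fmul_assoc)
  also have "\<dots> \<approx> unpair A \<star> unpair B"
    unfolding AB by (intro env_eqv_fmul env_eqv_sym[OF unpair_class])
  finally show ?thesis .
qed

text \<open>A left inverse of the map from the free algebra to the tensor product, modulo the relations.\<close>

definition untensor :: "('k::field jordan_elem \<times> 'k jordan_elem \<Rightarrow>\<^sub>0 'k) \<Rightarrow> 'k efree" where
  "untensor r = (\<Sum>A\<in>keys r. smul (lookup r A) (unpair A))"

lemma untensor_superset:
  assumes "finite S" "keys r \<subseteq> S"
  shows "untensor r = (\<Sum>A\<in>S. smul (lookup r A) (unpair A))"
proof -
  have z: "smul 0 p = 0" for p :: "'a efree" by (rule poly_mapping_eqI) simp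
  show ?thesis
    unfolding untensor_def by (rule sum.mono_neutral_left) (use assms in \<open>auto simp: in_keys_iff z\<close>)
qed

lemma untensor_add: "untensor (r + s) = untensor r + untensor s"
proof -
  have z: "smul (c + d) p = smul c p + smul d p" for p :: "'a efree" and c d
    by (rule poly_mapping_eqI) (simp add: lookup_add distrib_right)
  show ?thesis
    using Poly_Mapping.keys_add[of r s]
    by (simp add: untensor_superset[of "keys r \<union> keys s"] lookup_add z sum.distrib)
qed

lemma untensor_single: "untensor (single A c) = smul c (unpair A)"
  by (subst untensor_superset[of "{A}"]) auto

lemma untensor_0 [simp]: "untensor 0 = 0"
  by (simp add: untensor_def)

lemma untensor_uminus: "untensor (- p) = - untensor p"
  using untensor_add[of p "- p"] by (simp add: eq_neg_iff_add_eq_0 add.commute)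

lemma untensor_minus: "untensor (p - q) = untensor p - untensor q"
  using untensor_add[of p "- q"] by (simp add: untensor_uminus)

lemma untensor_sum: "untensor (\<Sum>i\<in>S. f i) = (\<Sum>i\<in>S. untensor (f i))"
  by (induction S rule: infinite_finite_induct) (simp_all add: untensor_add)

lemma smul_fmul: "smul c p \<star> smul d q = smul (c * d) (p \<star> (q :: 'x list \<Rightarrow>\<^sub>0 'k::field))"
  by (simp add: flip: fmul_Nil(1)) (metis (no_types, lifting) append_Nil fmul_Nil(1,2) fmul_assoc free_monoid_simps(2) monoid_alg_mult_single)

lemma untensor_mult:
  assumes "keys r \<subseteq> carrier JJ" "keys s \<subseteq> carrier JJ"
  shows "untensor (r \<otimes>\<^bsub>monoid_alg JJ\<^esub> s) \<approx> untensor r \<star> untensor s"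
proof -
  have "untensor (r \<otimes>\<^bsub>monoid_alg JJ\<^esub> s) = (\<Sum>b\<in>keys s. \<Sum>a\<in>keys r.
     smul (lookup r a * lookup s b) (unpair (a \<otimes>\<^bsub>JJ\<^esub> b)))"
    by (simp add: monoid_alg_mult_sum[of JJ] untensor_sum untensor_single)
  also have "\<dots> \<approx> (\<Sum>b\<in>keys s. \<Sum>a\<in>keys r.
     smul (lookup r a * lookup s b) (unpair a \<star> unpair b))"
    by (intro env_eqv_sum env_eqv_smul unpair_mult) (use assms in auto)
  also have "\<dots> = untensor r \<star> untensor s"
    by (simp add: untensor_def monoid_alg_sum_left monoid_alg_sum_right smul_fmul)
  finally show ?thesis .
qed

text \<open>Makes \<open>untensor\<close> well defined on the tensor product, up to the relations.
  Each bilinearity relation follows from the linearity of \<open>lemb\<close> and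
  \<open>remb\<close> once the chosen representatives are replaced by given ones.\<close>

lemma bilinear_rels_untensor:
  assumes "r \<in> bilinear_rels jordan_plane (opp_alg (jordan_plane :: ('k::field, _) module))"
  shows "untensor r \<in> env_rel_ideal"
proof -
  let ?C = "jordan_class :: _ \<Rightarrow> 'k jordan_elem"
  have 1: "unpair (?C (p + p'), ?C q) \<approx> unpair (?C p, ?C q) + unpair (?C p', ?C q)" for p p' q
  proof -
    have "unpair (?C (p + p'), ?C q) \<approx> lemb p \<star> remb q + lemb p' \<star> remb q"
      using unpair_class[of "p + p'" q] by (simp add: emb_linear fmul_distrib)
    also have "\<dots> \<approx> unpair (?C p, ?C q) + unpair (?C p', ?C q)"
      by (intro env_eqv_add env_eqv_sym[OF unpair_class])
    finally show ?thesis .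
  qed
  have 2: "unpair (?C p, ?C (q + q')) \<approx> unpair (?C p, ?C q) + unpair (?C p, ?C q')" for p q q'
  proof -
    have "unpair (?C p, ?C (q + q')) \<approx> lemb p \<star> remb q + lemb p \<star> remb q'"
      using unpair_class[of p "q + q'"] by (simp add: emb_linear fmul_distrib)
    also have "\<dots> \<approx> unpair (?C p, ?C q) + unpair (?C p, ?C q')"
      by (intro env_eqv_add env_eqv_sym[OF unpair_class])
    finally show ?thesis .
  qed
  have 3: "unpair (?C (smul c p), ?C q) \<approx> smul c (unpair (?C p, ?C q))" for c p q
  proof -
    have "unpair (?C (smul c p), ?C q) \<approx> smul c (lemb p \<star> remb q)"
      using unpair_class[of "smul c p" q] smul_fmul[of c "lemb p" 1 "remb q"] by (simp add: emb_linear)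
    also have "\<dots> \<approx> smul c (unpair (?C p, ?C q))"
      by (intro env_eqv_smul env_eqv_sym[OF unpair_class])
    finally show ?thesis .
  qed
  have 4: "unpair (?C p, ?C (smul c q)) \<approx> smul c (unpair (?C p, ?C q))" for c p q
  proof -
    have "unpair (?C p, ?C (smul c q)) \<approx> smul c (lemb p \<star> remb q)"
      using unpair_class[of p "smul c q"] smul_fmul[of 1 "lemb p" c "remb q"] by (simp add: emb_linear)
    also have "\<dots> \<approx> smul c (unpair (?C p, ?C q))"
      by (intro env_eqv_smul env_eqv_sym[OF unpair_class])
    finally show ?thesis .
  qed
  note e = 1 2 3 4
  show ?thesis
    using assms e unfolding bilinear_rels_def
    by (auto simp: jordan_plane_simps untensor_minus untensor_add untensor_single env_eqv_def diff_diff_eq)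
qed

lemma bilinear_rels_carrier:
  "bilinear_rels jordan_plane (opp_alg jordan_plane) \<subseteq> carrier (monoid_alg JJ :: ('k::field, _) module)"
proof -
  have s: "keys (p - q) \<subseteq> S" if "keys p \<subseteq> S" "keys q \<subseteq> S"
    for p q :: "'k jordan_elem \<times> 'k jordan_elem \<Rightarrow>\<^sub>0 'k" and S
  proof -
    have "keys (p - q) \<subseteq> keys p \<union> keys q"
      by (auto simp: in_keys_iff lookup_minus)
    then show ?thesis using that by auto
  qed
  show ?thesis
  proof
    fix r :: "'k jordan_elem \<times> 'k jordan_elem \<Rightarrow>\<^sub>0 'k"
    assume "r \<in> bilinear_rels jordan_plane (opp_alg jordan_plane)"
    then have "keys r \<subseteq> carrier JJ"
      unfolding bilinear_rels_def
      by (elim UnE CollectE exE conjE; hypsubst; intro s; auto simp: JJ_simps jordan_plane_simps split: if_splits)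
    then show "r \<in> carrier (monoid_alg JJ)" by simp
  qed
qed

abbreviation tideal :: "('k::field jordan_elem \<times> 'k jordan_elem \<Rightarrow>\<^sub>0 'k) set" where
  "tideal \<equiv> tensor_ideal jordan_plane (opp_alg jordan_plane)"

lemma tideal_ideal: "ideal tideal (monoid_alg JJ)"
  and tideal_rels: "bilinear_rels jordan_plane (opp_alg jordan_plane) \<subseteq> tideal"
  unfolding tensor_ideal_def by (rule monoid_alg_genideal[OF JJ_monoid bilinear_rels_carrier])+

lemmas tideal_closed = monoid_alg_ideal_closed[OF JJ_monoid tideal_ideal]

lemma tideal_untensor:
  assumes "r \<in> tideal"
  shows "untensor r \<in> env_rel_ideal"
proof -
  let ?N = "{r \<in> carrier (monoid_alg JJ :: ('a, _) module). untensor r \<in> env_rel_ideal}"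
  have m: "untensor (p \<otimes>\<^bsub>monoid_alg JJ\<^esub> q) \<in> env_rel_ideal"
    if "keys p \<subseteq> carrier JJ" "keys q \<subseteq> carrier JJ"
      "untensor p \<in> env_rel_ideal \<or> untensor q \<in> env_rel_ideal" for p q :: "_ \<Rightarrow>\<^sub>0 'a"
  proof -
    have "untensor p \<star> untensor q \<in> env_rel_ideal" using that(3) env_rel_ideal_closed(5,6) by blast
    then show ?thesis
      using env_rel_ideal_closed(2)[OF untensor_mult[OF that(1,2), unfolded env_eqv_def]] by fastforce
  qed
  have "ideal ?N (monoid_alg JJ)"
  proof (rule monoid_alg_idealI[OF JJ_monoid])
    fix p q assume p: "p \<in> ?N"
    show "p + q \<in> ?N" if "q \<in> ?N"
      using p that Poly_Mapping.keys_add[of p q] by (auto simp: untensor_add env_rel_ideal_closed)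
    assume q: "keys q \<subseteq> carrier JJ"
    show "q \<otimes>\<^bsub>monoid_alg JJ\<^esub> p \<in> ?N"
      using p q m[of q p] keys_mult_monoid_alg[OF JJ_monoid, of q p] by simp
    show "p \<otimes>\<^bsub>monoid_alg JJ\<^esub> q \<in> ?N"
      using p q m[of p q] keys_mult_monoid_alg[OF JJ_monoid, of p q] by simp
  qed (auto simp: env_rel_ideal_closed)
  then have "tideal \<subseteq> ?N"
    unfolding tensor_ideal_def
    by (rule genideal_subset) (use bilinear_rels_carrier bilinear_rels_untensor in blast)
  then show ?thesis using assms by blast
qed

section \<open>From the free algebra to the tensor product\<close>

fun lword :: "egen list \<Rightarrow> jgen list" where
  "lword [] = []"
| "lword (Eu # w) = Ju # lword w"
| "lword (Ev # w) = Jv # lword w"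
| "lword (Eu' # w) = lword w"
| "lword (Ev' # w) = lword w"

text \<open>The primed letters are collected in reverse order, since the second factor multiplies in
  the opposite order; this makes \<open>word_pair\<close> multiplicative.\<close>

fun rword :: "egen list \<Rightarrow> jgen list" where
  "rword [] = []"
| "rword (Eu # w) = rword w"
| "rword (Ev # w) = rword w"
| "rword (Eu' # w) = rword w @ [Ju]"
| "rword (Ev' # w) = rword w @ [Jv]"

lemma lword_append: "lword (v @ w) = lword v @ lword w"
  by (induction v rule: lword.induct) simp_all

lemma rword_append: "rword (v @ w) = rword w @ rword v"
  by (induction v rule: rword.induct) simp_all

lemma length_lword_rword: "length (lword w) + length (rword w) = length w"
  by (induction w rule: lword.induct) simp_all

lemma lword_rword_emb:
  "lword (map left_emb a @ rev (map right_emb b)) = a" "rword (map left_emb a @ rev (map right_emb b)) = b"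
proof -
  have l: "lword (map left_emb a) = a" "rword (map left_emb a) = []" for a
  proof (induction a)
    case (Cons x a)
    { case 1 then show ?case using Cons by (cases x) simp_all }
    { case 2 then show ?case using Cons by (cases x) simp_all }
  qed simp_all
  have r: "lword (rev (map right_emb b)) = []" "rword (rev (map right_emb b)) = b" for b
  proof (induction b)
    case (Cons x b)
    { case 1 then show ?case using Cons by (cases x) (simp_all add: lword_append) }
    { case 2 then show ?case using Cons by (cases x) (simp_all add: rword_append) }
  qed simp_all
  show "lword (map left_emb a @ rev (map right_emb b)) = a" "rword (map left_emb a @ rev (map right_emb b)) = b"
    by (simp_all only: lword_append rword_append l r append_Nil append_Nil2)
qed

definition word_pair :: "egen list \<Rightarrow> 'k::field jordan_elem \<times> 'k jordan_elem" where
  "word_pair w = (jordan_class (word (lword w)), jordan_class (word (rword w)))"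

lemma word_pair_append: "word_pair (v @ w) = word_pair v \<otimes>\<^bsub>JJ\<^esub> word_pair w"
  by (simp add: word_pair_def JJ_simps jordan_plane_simps lword_append rword_append)

lemma word_pair_carrier: "word_pair w \<in> carrier JJ"
  by (simp add: word_pair_def jordan_plane_simps(1))

text \<open>Sorting a word so that unprimed letters precede primed ones uses only the commutation
  relations and keeps the order within each kind; reversing \<open>rword\<close> restores the order
  of the primed letters.\<close>

lemma unpair_word_pair: "unpair (word_pair w) \<approx> (word w :: 'k::field efree)"
proof -
  have "unpair (word_pair w) \<approx> (word (map left_emb (lword w) @ rev (map right_emb (rword w))) :: 'k efree)"
    using unpair_class[of "word (lword w)" "word (rword w)"] by (simp add: word_pair_def lemb_def remb_def)
  also have "\<dots> \<approx> word w"
  proof (induction w)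
    case (Cons x w)
    let ?l = "map left_emb (lword w)" and ?r = "rev (map right_emb (rword w))"
    have IH: "word (x # ?l @ ?r) \<approx> (word (x # w) :: 'k efree)"
      using env_eqv_fmul[OF env_eqv_refl Cons.IH, of "word [x]"] by simp
    show ?case
    proof (cases x)
      case Eu' 
      have "word (?l @ Eu' # ?r) \<approx> (word (Eu' # ?l @ ?r) :: 'k efree)"
        using env_eqv_sym[OF gen_commute_word[of "[]" Ju "lword w" ?r]] by simp
      then show ?thesis using env_eqv_trans IH by (simp add: Eu') blast
    next
      case Ev' 
      have "word (?l @ Ev' # ?r) \<approx> (word (Ev' # ?l @ ?r) :: 'k efree)"
        using env_eqv_sym[OF gen_commute_word[of "[]" Jv "lword w" ?r]] by simp
      then show ?thesis using env_eqv_trans IH by (simp add: Ev') blast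
    qed (use IH in simp_all)
  qed simp
  finally show ?thesis .
qed

lemma keys_lin_word_pair: "keys (lin word_pair p) \<subseteq> carrier JJ"
  using keys_lin[of word_pair p] word_pair_carrier by blast

lemma untensor_lin_word_pair: "untensor (lin word_pair p) \<approx> p"
proof -
  have "untensor (lin word_pair p) = (\<Sum>w\<in>keys p. smul (lookup p w) (unpair (word_pair w)))"
    by (simp add: lin_def untensor_sum untensor_single)
  also have "\<dots> \<approx> (\<Sum>w\<in>keys p. smul (lookup p w) (word w))"
    by (intro env_eqv_sum env_eqv_smul unpair_word_pair)
  also have "\<dots> = p" by (subst (3) sum_single[of p]) simp
  finally show ?thesis .
qed

text \<open>The algebra map sending the free generators to u \<otimes> 1, v \<otimes> 1, 1 \<otimes>
  u and 1 \<otimes> v; see \<open>env_map_gens\<close>.\<close>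

definition env_map :: "'k::field efree \<Rightarrow> 'k env_elem" where
  "env_map p = tensor_class jordan_plane (opp_alg jordan_plane) (lin word_pair p)"

abbreviation tclass where "tclass \<equiv> tensor_class jordan_plane (opp_alg jordan_plane)"

lemma tclass_eq_iff:
  assumes "keys r \<subseteq> carrier JJ" "keys s \<subseteq> carrier JJ"
  shows "tclass r = tclass s \<longleftrightarrow> r - s \<in> tideal"
  unfolding tensor_class_def by (rule monoid_alg_coset_eq_iff[OF JJ_monoid tideal_ideal assms])

lemma jordan_env_simps:
  "carrier jordan_env = tclass ` {r :: _ \<Rightarrow>\<^sub>0 'k::field. keys r \<subseteq> carrier JJ}"
  "\<one>\<^bsub>jordan_env\<^esub> = tclass (single \<one>\<^bsub>JJ\<^esub> (1::'k))"
  "keys r \<subseteq> carrier JJ \<Longrightarrow> keys s \<subseteq> carrier JJ \<Longrightarrow>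
    tclass r \<otimes>\<^bsub>jordan_env\<^esub> tclass s = tclass (r \<otimes>\<^bsub>monoid_alg JJ\<^esub> s)"
  "keys r \<subseteq> carrier JJ \<Longrightarrow> keys s \<subseteq> carrier JJ \<Longrightarrow>
    tclass r \<oplus>\<^bsub>jordan_env\<^esub> tclass s = tclass (r + s :: _ \<Rightarrow>\<^sub>0 'k)"
  "keys r \<subseteq> carrier JJ \<Longrightarrow> c \<odot>\<^bsub>jordan_env\<^esub> tclass r = tclass (smul (c::'k) r)"
proof -
  interpret alg_ideal "monoid_alg JJ :: ('k, _) module" tideal
    by (rule monoid_alg_quot_ideal[OF JJ_monoid tideal_ideal])
  show "carrier jordan_env = tclass ` {r :: _ \<Rightarrow>\<^sub>0 'k::field. keys r \<subseteq> carrier JJ}"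
    unfolding jordan_env_def tensor_alg_def tensor_class_def by (simp add: alg_quot_simps)
  show "\<one>\<^bsub>jordan_env\<^esub> = tclass (single \<one>\<^bsub>JJ\<^esub> (1::'k))"
    unfolding jordan_env_def tensor_alg_def tensor_class_def by (simp add: alg_quot_simps)
  show "keys r \<subseteq> carrier JJ \<Longrightarrow> keys s \<subseteq> carrier JJ \<Longrightarrow>
    tclass r \<otimes>\<^bsub>jordan_env\<^esub> tclass s = tclass (r \<otimes>\<^bsub>monoid_alg JJ\<^esub> s)"
    "keys r \<subseteq> carrier JJ \<Longrightarrow> keys s \<subseteq> carrier JJ \<Longrightarrow>
    tclass r \<oplus>\<^bsub>jordan_env\<^esub> tclass s = tclass (r + s :: _ \<Rightarrow>\<^sub>0 'k)"
    "keys r \<subseteq> carrier JJ \<Longrightarrow> c \<odot>\<^bsub>jordan_env\<^esub> tclass r = tclass (smul (c::'k) r)"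
    unfolding jordan_env_def tensor_alg_def tensor_class_def
    by (simp_all add: alg_quot_mult alg_quot_add alg_quot_smult)
qed

lemma env_map_alg_hom: "env_map \<in> alg_hom free_alg (jordan_env :: ('k::field, 'k env_elem) module)"
proof (rule alg_homI)
  fix p q :: "'k efree" and c
  note k = keys_lin_word_pair[simplified]
  show "env_map p \<in> carrier jordan_env" using k by (auto simp: env_map_def jordan_env_simps)
  have "lin word_pair (p \<star> q) = lin word_pair p \<otimes>\<^bsub>monoid_alg JJ\<^esub> lin (word_pair :: _ \<Rightarrow> (_ \<Rightarrow>\<^sub>0 'k) set \<times> _) q"
    by (rule lin_mult) (simp add: word_pair_append)
  then show "env_map (p \<otimes>\<^bsub>free_alg\<^esub> q) = env_map p \<otimes>\<^bsub>jordan_env\<^esub> env_map q"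
    by (simp add: env_map_def jordan_env_simps k)
  show "env_map (p \<oplus>\<^bsub>free_alg\<^esub> q) = env_map p \<oplus>\<^bsub>jordan_env\<^esub> env_map q"
    by (simp add: env_map_def jordan_env_simps k lin_add)
  show "env_map (c \<odot>\<^bsub>free_alg\<^esub> p) = c \<odot>\<^bsub>jordan_env\<^esub> env_map p"
    by (simp add: env_map_def jordan_env_simps k lin_smul)
qed (simp add: env_map_def jordan_env_simps word_pair_def jordan_plane_simps)

abbreviation tns where "tns p q \<equiv> single (jordan_class p, jordan_class q)"

lemma tensor_bilinear:
  fixes p q p' q' :: "'k::field jfree"
  shows "tns (p + p') q 1 - tns p q 1 - tns p' q 1 \<in> tideal" "tns p (q + q') 1 - tns p q 1 - tns p q' 1 \<in> tideal"
    "tns (smul c p) q 1 - tns p q c \<in> tideal" "tns p (smul c q) 1 - tns p q c \<in> tideal"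
proof -
  have "tns (p + p') q 1 - tns p q 1 - tns p' q 1 \<in> bilinear_rels jordan_plane (opp_alg jordan_plane)"
    "tns p (q + q') 1 - tns p q 1 - tns p q' 1 \<in> bilinear_rels jordan_plane (opp_alg jordan_plane)"
    "tns (smul c p) q 1 - tns p q c \<in> bilinear_rels jordan_plane (opp_alg jordan_plane)"
    "tns p (smul c q) 1 - tns p q c \<in> bilinear_rels jordan_plane (opp_alg jordan_plane)"
    unfolding bilinear_rels_def
    subgoal by (rule UnI1, rule UnI1, rule UnI1, rule CollectI, rule exI[of _ "jordan_class p"],
          rule exI[of _ "jordan_class p'"], rule exI[of _ "jordan_class q"]) (simp add: jordan_plane_simps)
    subgoal by (rule UnI1, rule UnI1, rule UnI2, rule CollectI, rule exI[of _ "jordan_class p"],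
          rule exI[of _ "jordan_class q"], rule exI[of _ "jordan_class q'"]) (simp add: jordan_plane_simps)
    subgoal by (rule UnI1, rule UnI2, rule CollectI, rule exI[of _ c],
          rule exI[of _ "jordan_class p"], rule exI[of _ "jordan_class q"]) (simp add: jordan_plane_simps)
    subgoal by (rule UnI2, rule CollectI, rule exI[of _ c],
          rule exI[of _ "jordan_class p"], rule exI[of _ "jordan_class q"]) (simp add: jordan_plane_simps)
    done
  then show "tns (p + p') q 1 - tns p q 1 - tns p' q 1 \<in> tideal" "tns p (q + q') 1 - tns p q 1 - tns p q' 1 \<in> tideal"
    "tns (smul c p) q 1 - tns p q c \<in> tideal" "tns p (smul c q) 1 - tns p q c \<in> tideal"
    using tideal_rels by blast+
qed

text \<open>Bilinearity reduces the claim to multiples of words, where the letters of the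
  concatenated word separate again into the two given words and the two sides differ only by moving
  scalars.\<close>

lemma tensor_expand:
  fixes p q :: "'k::field jfree"
  shows "single (jordan_class p, jordan_class q) 1 - lin word_pair (lemb p \<star> remb q) \<in> tideal"
proof -
  note B = tensor_bilinear[where 'k = 'k]
  note cl = tideal_closed[where 'k = 'k]
  define P where "P p q \<longleftrightarrow> tns p q 1 - lin word_pair (lemb p \<star> remb q) \<in> tideal" for p q :: "'k jfree"
  have zero: "P 0 q" "P p 0" for p q
  proof -
    have "smul 0 p = 0" for p :: "'k jfree" by (rule poly_mapping_eqI) simp
    then show "P 0 q" "P p 0" using B(3)[of 0 0 q] B(4)[of p 0 0] by (simp_all add: P_def emb_linear)
  qed
  have add: "P (p + p') q" if "P p q" "P p' q" for p p' q
    using cl(2)[OF cl(2)[OF B(1)[of p p' q] that(1)[unfolded P_def]] that(2)[unfolded P_def]]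
    by (simp add: P_def emb_linear fmul_distrib lin_add algebra_simps)
  have add': "P p (q + q')" if "P p q" "P p q'" for p q q'
    using cl(2)[OF cl(2)[OF B(2)[of p q q'] that(1)[unfolded P_def]] that(2)[unfolded P_def]]
    by (simp add: P_def emb_linear fmul_distrib lin_add algebra_simps)
  have base:  "P (single a c) (single b d)" for a b and c d :: 'k
  proof -
    let ?a = "word a :: 'k jfree" and ?b = "word b :: 'k jfree"
    \<comment> \<open>Pulling c out of the first factor leaves a symbol with coefficient c, so the
      rule for d is used in its c-fold multiple.\<close>
    have "smul c (tns ?a (smul d ?b) 1 - tns ?a ?b d) = tns ?a (smul d ?b) c - tns ?a ?b (c * d)"
      by (rule poly_mapping_eqI) (simp add: lookup_minus lookup_single when_def algebra_simps)
    then have "tns ?a (smul d ?b) c - tns ?a ?b (c * d) \<in> tideal"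
      using cl(3)[OF B(4)[of ?a d ?b], of c] by simp
    from cl(2)[OF B(3)[of c ?a "smul d ?b"] this]
    have "tns (smul c ?a) (smul d ?b) 1 - tns ?a ?b (c * d) \<in> tideal" by simp
    moreover have "lin word_pair (lemb (single a c) \<star> remb (single b d)) = tns ?a ?b (c * d)"
      by (simp add: lemb_def remb_def word_pair_def lword_rword_emb)
    ultimately show ?thesis by (simp add: P_def)
  qed
  have s1: "P (\<Sum>i\<in>S. f i) q" if "\<And>i. i \<in> S \<Longrightarrow> P (f i) q" for f q and S :: "jgen list set"
    using that by (induction S rule: infinite_finite_induct) (simp_all add: zero add)
  have s2: "P p (\<Sum>i\<in>S. f i)" if "\<And>i. i \<in> S \<Longrightarrow> P p (f i)" for f p and S :: "jgen list set"
    using that by (induction S rule: infinite_finite_induct) (simp_all add: zero add')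
  have "P p q"
    by (subst sum_single[of p], rule s1, subst sum_single[of q], rule s2, rule base)
  then show ?thesis by (simp add: P_def)
qed

text \<open>Surjectivity relative to a subspace W of the free algebra. With W everything it shows
  that \<open>env_map\<close> is onto; with W the words of degree n it identifies the homogeneous
  components.\<close>

lemma env_map_onto:
  fixes r :: "'k::field jordan_elem \<times> 'k jordan_elem \<Rightarrow>\<^sub>0 'k"
  assumes W: "0 \<in> W" "\<And>p q. p \<in> W \<Longrightarrow> q \<in> W \<Longrightarrow> p + q \<in> W" "\<And>c p. p \<in> W \<Longrightarrow> smul c p \<in> W"
    and S: "\<And>X Y. (X, Y) \<in> S \<Longrightarrow> \<exists>p q. X = jordan_class p \<and> Y = jordan_class q \<and> lemb p \<star> remb q \<in> W"
    and r: "keys r \<subseteq> S"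
  shows "\<exists>p\<in>W. r - lin word_pair p \<in> tideal"
proof -
  note cl = tideal_closed[where 'k = 'k]
  let ?Q = "\<lambda>r. \<exists>p\<in>W. r - lin word_pair p \<in> tideal"
  have sum: "?Q (\<Sum>i\<in>I. f i)" if "\<And>i. i \<in> I \<Longrightarrow> ?Q (f i)" for I f
    using that
  proof (induction I rule: infinite_finite_induct)
    case (insert x I)
    then obtain p q where "p \<in> W" "f x - lin word_pair p \<in> tideal" "q \<in> W" "sum f I - lin word_pair q \<in> tideal"
      by blast
    then show ?case using cl(2)[of "f x - lin word_pair p" "sum f I - lin word_pair q"] insert W(2)[of p q]
      by (intro bexI[of _ "p + q"]) (simp_all add: lin_add algebra_simps)
  qed (use W(1) cl(1) in \<open>auto intro!: bexI[of _ 0]\<close>)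
  have "?Q (single A (lookup r A))" if "A \<in> keys r" for A
  proof -
    obtain X Y where A: "A = (X, Y)" by (cases A)
    then have "(X, Y) \<in> S" using r that by blast
    from S[OF this] obtain p q where pq: "A = (jordan_class p, jordan_class q)" "lemb p \<star> remb q \<in> W"
      using A by blast
    have "smul (lookup r A) (single A 1 - lin word_pair (lemb p \<star> remb q)) \<in> tideal"
      unfolding pq(1) by (rule cl(3)[OF tensor_expand])
    moreover have "smul c (u - v) = smul c u - smul c v" for c and u v :: "'k jordan_elem \<times> 'k jordan_elem \<Rightarrow>\<^sub>0 'k"
      by (rule poly_mapping_eqI) (simp add: lookup_minus algebra_simps)
    ultimately show ?thesis using W(3)[OF pq(2)]
      by (intro bexI[of _ "smul (lookup r A) (lemb p \<star> remb q)"]) (simp_all add: lin_smul)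
  qed
  then have "?Q (\<Sum>A\<in>keys r. single A (lookup r A))" by (rule sum)
  then show ?thesis using sum_single[of r] by simp
qed

lemma JJ_rep: "(X, Y) \<in> carrier JJ \<Longrightarrow> \<exists>p q. X = jordan_class p \<and> Y = jordan_class q \<and> lemb p \<star> remb q \<in> UNIV"
  by (auto simp: jordan_plane_simps)

lemma tideal_iff:
  fixes r :: "'k::field jordan_elem \<times> 'k jordan_elem \<Rightarrow>\<^sub>0 'k"
  assumes r: "keys r \<subseteq> carrier JJ"
  shows "r \<in> tideal \<longleftrightarrow> untensor r \<in> env_rel_ideal"
proof
  assume u: "untensor r \<in> env_rel_ideal"
  note cl = tideal_closed[where 'k = 'k]
  have map_rel: "lin word_pair p \<in> tideal" if "p \<in> env_rel_ideal" for p :: "'k efree"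
  proof -
    interpret I: ideal tideal "monoid_alg JJ :: ('k, _) module" by (rule tideal_ideal)
    have m: "lin word_pair (p \<star> q) = lin word_pair p \<otimes>\<^bsub>monoid_alg JJ\<^esub> lin (word_pair :: _ \<Rightarrow> (_ \<Rightarrow>\<^sub>0 'k) set \<times> _) q"
      for p q :: "'k efree"
      by (rule lin_mult) (simp add: word_pair_append)
    have car: "lin word_pair p \<in> carrier (monoid_alg JJ)" for p :: "'k efree"
      using keys_lin_word_pair by (simp only: monoid_alg_simps mem_Collect_eq)
    have "ideal {p :: 'k efree. lin word_pair p \<in> tideal} free_alg"
    proof (rule free_idealI)
      fix p q assume p: "p \<in> {p :: 'k efree. lin word_pair p \<in> tideal}"
      then have p': "lin word_pair p \<in> tideal" by simp
      show "q \<star> p \<in> {p :: 'k efree. lin word_pair p \<in> tideal}"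
        using I.I_l_closed[OF p' car[of q]] by (simp add: m)
      show "p \<star> q \<in> {p :: 'k efree. lin word_pair p \<in> tideal}"
        using I.I_r_closed[OF p' car[of q]] by (simp add: m)
      show "p + q \<in> {p :: 'k efree. lin word_pair p \<in> tideal}"
        if "q \<in> {p :: 'k efree. lin word_pair p \<in> tideal}"
        using p' that cl(2) by (simp add: lin_add)
    qed (simp add: cl)
    moreover have "lin word_pair (env_rel i :: 'k efree) \<in> tideal" if "i \<in> {1..6}" for i
    proof -
      \<comment> \<open>A tensor with a zero factor vanishes. Since \<open>jrel\<close> has class
        zero, expanding its tensors with 1 puts the images of \<open>r\<^sub>1\<close> and
        \<open>r\<^sub>2\<close> into the tensor ideal.\<close>
      have z: "tns 0 q 1 \<in> tideal" "tns q 0 1 \<in> tideal" for q :: "'k jfree"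
        using tensor_expand[of 0 q] tensor_expand[of q 0] by (simp_all add: emb_linear)
      have c0: "jordan_class jrel = jordan_class (0 :: 'k jfree)" by (simp add: jordan_class_eq_iff jrel_in)
      have "lin word_pair (lemb jrel \<star> remb (word []) :: 'k efree) \<in> tideal"
        using cl(4)[OF z(1)[of "word []"] tensor_expand[of jrel "word []"]] by (simp add: c0)
      then have 1: "lin word_pair (env_rel 1 :: 'k efree) \<in> tideal"
        by (simp add: emb_linear env_rel_def fmul_distrib lin_add lin_minus) (simp add: lemb_def remb_def)
      have "lin word_pair (lemb (word []) \<star> remb jrel :: 'k efree) \<in> tideal"
        using cl(4)[OF z(2)[of "word []"] tensor_expand[of "word []" jrel]] by (simp add: c0)
      moreover have "lemb (word []) \<star> remb jrel = (- env_rel 2 :: 'k efree)"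
        by (simp add: emb_linear env_rel_def fmul_distrib) (simp add: lemb_def remb_def)
      ultimately have 2: "lin word_pair (env_rel 2 :: 'k efree) \<in> tideal"
        using cl(4)[OF cl(1), of "lin word_pair (- env_rel 2)"] by (simp add: lin_uminus)
      have 3: "lin word_pair (env_rel i :: 'k efree) \<in> tideal" if "i \<in> {3,4,5,6}" for i
        \<comment> \<open>Both words of a commutation relation have the same pair of subwords, so
          its image is zero already on symbols.\<close>
        using that by (auto simp: env_rel_def lin_minus word_pair_def cl)
      have "i = 1 \<or> i = 2 \<or> i \<in> {3,4,5,6}" using that by auto
      then show ?thesis using 1 2 3 by blast
    qed
    ultimately have "env_rel_ideal \<subseteq> {p :: 'k efree. lin word_pair p \<in> tideal}"
      unfolding env_rel_ideal_def by (intro genideal_subset) auto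
    then show ?thesis using that by blast
  qed
  \<comment> \<open>Modulo the tensor ideal r is the image of some p. Then p agrees with
    \<open>untensor r\<close> up to the relations, hence is itself a relation and its image
    vanishes.\<close>
  obtain p where p: "r - lin word_pair p \<in> tideal"
    using env_map_onto[of UNIV "carrier JJ" r] JJ_rep r by blast
  have "untensor r - untensor (lin word_pair p) \<in> env_rel_ideal"
    using tideal_untensor[OF p] by (simp add: untensor_minus)
  then have "untensor (lin word_pair p) \<in> env_rel_ideal"
    using env_rel_ideal_closed(4)[OF u] by fastforce
  then have "p \<in> env_rel_ideal"
    using env_rel_ideal_closed(4)[OF _ untensor_lin_word_pair[of p, unfolded env_eqv_def]] by fastforce
  from map_rel[OF this] show "r \<in> tideal" using cl(2)[OF p] by fastforce
qed (rule tideal_untensor)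

lemma env_map_eq_iff: "env_map p = env_map q \<longleftrightarrow> p - q \<in> env_rel_ideal"
proof -
  have k: "keys (lin word_pair p - lin word_pair q) \<subseteq> carrier JJ"
    using keys_lin_word_pair[of "p - q"] by (simp only: lin_minus)
  have "env_map p = env_map q \<longleftrightarrow> untensor (lin word_pair p - lin word_pair q) \<in> env_rel_ideal"
    unfolding env_map_def tclass_eq_iff[OF keys_lin_word_pair keys_lin_word_pair] tideal_iff[OF k] ..
  also have "\<dots> \<longleftrightarrow> untensor (lin word_pair (p - q)) \<in> env_rel_ideal" by (simp only: lin_minus)
  also have "\<dots> \<longleftrightarrow> p - q \<in> env_rel_ideal"
  proof -
    have d: "untensor (lin word_pair (p - q)) - (p - q) \<in> env_rel_ideal"
      using untensor_lin_word_pair[of "p - q"] by (simp add: env_eqv_def)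
    show ?thesis
    proof
      assume "untensor (lin word_pair (p - q)) \<in> env_rel_ideal"
      from env_rel_ideal_closed(4)[OF this d] show "p - q \<in> env_rel_ideal" by simp
    next
      assume "p - q \<in> env_rel_ideal"
      from env_rel_ideal_closed(2)[OF d this] show "untensor (lin word_pair (p - q)) \<in> env_rel_ideal" by simp
    qed
  qed
  finally show ?thesis .
qed

lemma env_map_surj: "range env_map = carrier (jordan_env :: ('k::field, 'k env_elem) module)"
proof
  show "range env_map \<subseteq> carrier (jordan_env :: ('k, 'k env_elem) module)"
    using alg_homD(1)[OF env_map_alg_hom] by auto
  show "carrier (jordan_env :: ('k, 'k env_elem) module) \<subseteq> range env_map"
  proof
    fix X assume "X \<in> carrier (jordan_env :: ('k, 'k env_elem) module)"
    then obtain r where r: "keys r \<subseteq> carrier JJ" "X = tclass r"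
      unfolding jordan_env_simps by blast
    obtain p where "r - lin word_pair p \<in> tideal"
      using env_map_onto[of UNIV "carrier JJ" r] JJ_rep r by blast
    then have "X = env_map p" unfolding env_map_def r(2) using tclass_eq_iff[OF r(1) keys_lin_word_pair] by blast
    then show "X \<in> range env_map" by blast
  qed
qed

section \<open>Compatibility with the grading and the group action\<close>

lemma words_of_degree_iff:
  "p \<in> words_of_degree n \<longleftrightarrow> (\<forall>w. lookup p w \<noteq> 0 \<longrightarrow> length w = n)"
  by (auto simp: words_of_degree_def in_keys_iff)

text \<open>The lengths of the two subwords of a word add up to its length; conversely, homogeneous
  representatives of the two factors embed as a product of the right degree.\<close>

lemma env_map_grade: "env_map ` words_of_degree n = (env_grade n :: 'k::field env_elem set)"
proof
  show "env_map ` words_of_degree n \<subseteq> (env_grade n :: 'k env_elem set)"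
  proof
    fix X assume "X \<in> env_map ` (words_of_degree n :: 'k efree set)"
    then obtain p where p: "p \<in> words_of_degree n" "X = env_map p" by blast
    have "keys (lin word_pair p) \<subseteq> (\<Union>i\<le>n. jordan_grade i \<times> jordan_grade (n - i))"
    proof
      fix A assume "A \<in> keys (lin word_pair p)"
      then obtain w where w: "w \<in> keys p" "A = word_pair w" using keys_lin[of word_pair p] by blast
      have "length (lword w) + length (rword w) = n"
        using p(1) w(1) by (simp add: words_of_degree_def length_lword_rword)
      then have "A \<in> jordan_grade (length (lword w)) \<times> jordan_grade (n - length (lword w))" "length (lword w) \<le> n"
        by (auto simp: w word_pair_def jordan_grade_def words_of_degree_def)
      then show "A \<in> (\<Union>i\<le>n. jordan_grade i \<times> jordan_grade (n - i))" by blast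
    qed
    then show "X \<in> env_grade n"
      unfolding env_grade_def tensor_grade_def p(2) env_map_def by blast
  qed
  show "(env_grade n :: 'k env_elem set) \<subseteq> env_map ` words_of_degree n"
  proof
    fix X :: "'k env_elem" assume "X \<in> env_grade n"
    then obtain r where r: "keys r \<subseteq> (\<Union>i\<le>n. jordan_grade i \<times> jordan_grade (n - i))" "X = tclass r"
      unfolding env_grade_def tensor_grade_def by blast
    note d = words_of_degree_iff
    have "\<exists>p\<in>words_of_degree n. r - lin word_pair p \<in> tideal"
    proof (rule env_map_onto[OF _ _ _ _ r(1)])
      show "0 \<in> words_of_degree n" by (simp add: d)
      show "p + q \<in> words_of_degree n" if "p \<in> words_of_degree n" "q \<in> words_of_degree n" for p q :: "'k efree"
        using that unfolding d lookup_add by (metis add.right_neutral)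
      show "smul c p \<in> words_of_degree n" if "p \<in> words_of_degree n" for p :: "'k efree" and c
        using that by (simp add: d)
      fix X Y assume "(X, Y) \<in> (\<Union>i\<le>n. jordan_grade i \<times> jordan_grade (n - i) :: ('k jordan_elem \<times> 'k jordan_elem) set)"
      then obtain i p q where i: "i \<le> n" and pq: "X = jordan_class p" "Y = jordan_class q"
          "p \<in> words_of_degree i" "q \<in> words_of_degree (n - i)"
        unfolding jordan_grade_def by auto
      have "lemb p \<star> remb q \<in> words_of_degree n"
        unfolding words_of_degree_def
      proof (intro CollectI ballI)
        fix w assume "w \<in> keys (lemb p \<star> remb q)"
        then obtain a b where ab: "a \<in> keys (lemb p)" "b \<in> keys (remb q)" "w = a @ b"
          by (rule keys_fmul_length)
        have "length a = i"
          using ab(1) keys_lin[of "map left_emb" p] pq(3) unfolding lemb_def words_of_degree_def by auto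
        moreover have "length b = n - i"
          using ab(2) keys_lin[of "\<lambda>w. rev (map right_emb w)" q] pq(4) unfolding remb_def words_of_degree_def by auto
        ultimately show "length w = n" using ab(3) i by simp
      qed
      then show "\<exists>p q. X = jordan_class p \<and> Y = jordan_class q \<and> lemb p \<star> remb q \<in> words_of_degree n"
        using pq by blast
    qed
    then obtain p where p: "p \<in> words_of_degree n" "r - lin word_pair p \<in> tideal" by blast
    have "keys r \<subseteq> carrier JJ" using r(1) unfolding JJ_simps jordan_grade_def by blast
    then have "X = env_map p"
      unfolding env_map_def r(2) using tclass_eq_iff[OF _ keys_lin_word_pair] p(2) by blast
    then show "X \<in> env_map ` words_of_degree n" using p(1) by blast
  qed
qed

lemma env_rel_ideal_sign_act: "p \<in> env_rel_ideal \<Longrightarrow> sign_act x p \<in> env_rel_ideal"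
  using def_ideal_sign_act[of p no_def] by (simp add: def_ideal_zero)

lemma sign_act_smul: "sign_act x (smul c p) = smul c (sign_act x p)"
  by (rule poly_mapping_eqI) (simp add: lookup_sign_act)

lemma env_eqv_sign_act: "p \<approx> q \<Longrightarrow> sign_act x p \<approx> sign_act x q"
  unfolding env_eqv_def sign_act_minus[symmetric] by (rule env_rel_ideal_sign_act)

lemma emb_sign_act: "lemb (sign_act x p) = sign_act x (lemb p)" "remb (sign_act x p) = sign_act x (remb p)"
proof -
  have e: "sign_act x p = (\<Sum>w\<in>keys p. single w ((if x = 0 then 1 else (- 1) ^ length w) * lookup p w))"
    by (subst (1) sum_single[of p]) (simp only: sign_act_sum sign_act_single)
  show "lemb (sign_act x p) = sign_act x (lemb p)" "remb (sign_act x p) = sign_act x (remb p)"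
    unfolding e lemb_def remb_def lin_sum lin_single
    by (cases "x = 0"; simp add: lin_def sign_act_sum sign_act_single)+
qed

lemma untensor_act:
  assumes "keys r \<subseteq> carrier JJ"
  shows "untensor (lin (map_prod (jordan_act x) (jordan_act x)) r) \<approx> sign_act x (untensor r)"
proof -
  have s: "unpair (map_prod (jordan_act x) (jordan_act x) A) \<approx> sign_act x (unpair A)" if AJ: "A \<in> carrier JJ" for A :: "'a jordan_elem \<times> 'a jordan_elem"
  proof -
    obtain p q where A: "A = (jordan_class p, jordan_class q)" using AJ unfolding JJ_simps by blast
    have "unpair (map_prod (jordan_act x) (jordan_act x) A) \<approx> sign_act x (lemb p \<star> remb q)"
      using unpair_class[of "sign_act x p" "sign_act x q"] by (simp add: A jordan_act_class emb_sign_act sign_act_fmul)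
    also have "\<dots> \<approx> sign_act x (unpair A)"
      unfolding A by (rule env_eqv_sign_act[OF env_eqv_sym[OF unpair_class]])
    finally show ?thesis .
  qed
  have "untensor (lin (map_prod (jordan_act x) (jordan_act x)) r) =
     (\<Sum>A\<in>keys r. smul (lookup r A) (unpair (map_prod (jordan_act x) (jordan_act x) A)))"
    by (simp add: lin_def untensor_sum untensor_single)
  also have "\<dots> \<approx> (\<Sum>A\<in>keys r. smul (lookup r A) (sign_act x (unpair A)))"
    by (intro env_eqv_sum env_eqv_smul s) (use assms in blast)
  also have "\<dots> = sign_act x (untensor r)"
    by (simp add: untensor_def sign_act_sum sign_act_smul)
  finally show ?thesis .
qed

text \<open>The diagonal action comes from the sign action on the free algebra. Equality in the
  tensor product is tested by applying \<open>untensor\<close>, which intertwines the two actions up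
  to the relations.\<close>

lemma env_act_map: "env_act x (env_map p) = env_map (sign_act x (p :: 'k::field efree))"
proof -
  let ?E = "lin (map_prod (jordan_act x) (jordan_act x)) :: ('k jordan_elem \<times> 'k jordan_elem \<Rightarrow>\<^sub>0 'k) \<Rightarrow> _"
  have mem: "r \<in> env_map p \<longleftrightarrow> r - lin word_pair p \<in> tideal" for r
    unfolding env_map_def tensor_class_def by (rule monoid_alg_coset_mem[OF JJ_monoid tideal_ideal])
  have main: "tclass (?E r) = env_map (sign_act x p)" if "r \<in> env_map p" for r
  proof -
    have d: "r - lin word_pair p \<in> tideal" using that mem by simp
    have kr: "keys r \<subseteq> carrier JJ"
    proof -
      have "keys ((r - lin word_pair p) + lin word_pair p) \<subseteq> carrier JJ"
        by (rule subset_trans[OF Poly_Mapping.keys_add Un_least[OF tideal_closed(5)[OF d] keys_lin_word_pair]])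
      then show ?thesis by simp
    qed
    have kE: "keys (?E r) \<subseteq> carrier JJ"
    proof
      fix A assume "A \<in> keys (?E r)"
      then have "A \<in> map_prod (jordan_act x) (jordan_act x) ` keys r"
        by (rule subsetD[OF keys_lin])
      then obtain B where B: "B \<in> keys r" "A = map_prod (jordan_act x) (jordan_act x) B" by (rule imageE)
      obtain p q where "B = (jordan_class p, jordan_class q)"
        using subsetD[OF kr B(1)] unfolding JJ_simps by blast
      then show "A \<in> carrier JJ" unfolding JJ_simps by (simp add: B(2) jordan_act_class)
    qed
    have "untensor (?E r) \<approx> sign_act x (untensor r)" by (rule untensor_act[OF kr])
    also have "\<dots> \<approx> sign_act x (untensor (lin word_pair p))"
      by (rule env_eqv_sign_act) (use tideal_untensor[OF d] in \<open>simp add: env_eqv_def untensor_minus\<close>)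
    also have "\<dots> \<approx> sign_act x p" by (rule env_eqv_sign_act[OF untensor_lin_word_pair])
    also have "\<dots> \<approx> untensor (lin word_pair (sign_act x p))" by (rule env_eqv_sym[OF untensor_lin_word_pair])
    finally have u: "untensor (?E r - lin word_pair (sign_act x p)) \<in> env_rel_ideal"
      by (simp add: env_eqv_def untensor_minus)
    have k: "keys (?E r - lin word_pair (sign_act x p)) \<subseteq> carrier JJ"
    proof -
      have "keys (?E r - lin word_pair (sign_act x p)) \<subseteq>
          keys (?E r) \<union> keys (lin word_pair (sign_act x p))"
        by (auto simp: in_keys_iff lookup_minus)
      then show ?thesis by (rule subset_trans) (rule Un_least[OF kE keys_lin_word_pair])
    qed
    show ?thesis
      unfolding env_map_def tclass_eq_iff[OF kE keys_lin_word_pair] tideal_iff[OF k] by (rule u)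
  qed
  have p: "lin word_pair p \<in> env_map p" by (simp add: mem tideal_closed)
  have "env_act x (env_map p) = (\<Union>r\<in>env_map p. tclass (?E r))"
    by (simp add: env_act_def tensor_map_def lin_def)
  also have "\<dots> = env_map (sign_act x p)"
    by (rule UN_constant_eq[OF p]) (use main in blast)
  finally show ?thesis .
qed

lemma env_rel_ideal_quot: "alg_ideal (free_alg :: ('k::field, 'k efree) module) env_rel_ideal"
  by (rule monoid_alg_quot_ideal[OF monoid_free_monoid env_rel_ideal_ideal])

lemma env_map_gens:
  "env_map (word [Eu]) = env_tensor (jordan_class (word [Ju])) \<one>\<^bsub>jordan_plane\<^esub>"
  "env_map (word [Ev]) = env_tensor (jordan_class (word [Jv])) \<one>\<^bsub>jordan_plane\<^esub>"
  "env_map (word [Eu']) = env_tensor \<one>\<^bsub>jordan_plane\<^esub> (jordan_class (word [Ju]))"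
  "env_map (word [Ev']) = env_tensor \<one>\<^bsub>jordan_plane\<^esub> (jordan_class (word [Jv]))"
  by (simp_all add: env_map_def pure_tensor_def word_pair_def jordan_plane_simps)

lemma presentation:
  "\<exists>\<phi> \<in> alg_iso (alg_quot free_alg env_rel_ideal) (jordan_env :: ('k::field, 'k env_elem) module).
    \<forall>p. \<phi> (env_rel_ideal +>\<^bsub>free_alg\<^esub> p) = env_map p"
proof -
  interpret alg_ideal "free_alg :: ('k, 'k efree) module" env_rel_ideal
    by (rule env_rel_ideal_quot)
  have ker: "(env_rel_ideal +>\<^bsub>free_alg\<^esub> p = env_rel_ideal +>\<^bsub>free_alg\<^esub> q) \<longleftrightarrow> env_map p = env_map q"
    for p q :: "'k efree"
    unfolding env_map_eq_iff by (rule monoid_alg_coset_eq_iff[OF monoid_free_monoid env_rel_ideal_ideal]) simp_all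
  have surj: "(\<lambda>p. env_rel_ideal +>\<^bsub>free_alg\<^esub> p) ` carrier free_alg =
      carrier (alg_quot free_alg (env_rel_ideal :: 'k efree set))"
    by (simp add: alg_quot_simps)
  have surj': "env_map ` carrier free_alg = carrier (jordan_env :: ('k, 'k env_elem) module)"
    using env_map_surj by simp
  obtain h where h: "h \<in> alg_iso (alg_quot free_alg env_rel_ideal) (jordan_env :: ('k, 'k env_elem) module)"
    "\<And>p. p \<in> carrier free_alg \<Longrightarrow> h (env_rel_ideal +>\<^bsub>free_alg\<^esub> p) = env_map p"
    using alg_iso_of_same_kernel[OF k_algebra_axioms quot_map_alg_hom surj env_map_alg_hom surj' ker] by blast
  then show ?thesis by (intro bexI[of _ h]) simp_all
qed

section \<open>The smash product as a quotient of the free smash product\<close>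

definition env_smash :: "(int \<Rightarrow> 'k::field efree) \<Rightarrow> int \<Rightarrow> 'k env_elem" where
  "env_smash f = duo (env_map (f 0)) (env_map (f 1))"

lemma env_map_closed: "env_map p \<in> carrier (jordan_env :: ('k::field, 'k env_elem) module)"
  using alg_homD(1)[OF env_map_alg_hom] by simp

lemma env_smash_alg_hom:
  "env_smash \<in> alg_hom free_smash (smash (jordan_env :: ('k::field, 'k env_elem) module) C2 env_act)"
proof -
  interpret E: k_algebra "jordan_env :: ('k, 'k env_elem) module" by (rule jordan_env_k_algebra)
  note hom = alg_homD[OF env_map_alg_hom, simplified]
  have act: "env_act g x \<in> carrier (jordan_env :: ('k, 'k env_elem) module)"
    if x: "x \<in> carrier (jordan_env :: ('k, 'k env_elem) module)" for g x
  proof -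
    obtain p where "x = env_map p" using x env_map_surj by blast
    then show ?thesis using env_map_closed by (simp add: env_act_map)
  qed
  have z: "env_map 0 = \<zero>\<^bsub>jordan_env :: ('k, 'k env_elem) module\<^esub>"
    using hom(3)[of 0 0] env_map_closed[of 0] by (metis E.add.l_cancel_one' E.zero_closed E.r_zero add_0)
  show ?thesis
  proof (rule alg_homI)
    fix f g :: "int \<Rightarrow> 'k efree" and c
    assume "f \<in> carrier free_smash"
    then obtain p q where f: "f = duo p q" using free_smash_carrier by blast
    show "env_smash f \<in> carrier (smash jordan_env C2 env_act)"
      using env_map_closed by (auto simp: env_smash_def smash_duo)
    show "env_smash (c \<odot>\<^bsub>free_smash\<^esub> f) = c \<odot>\<^bsub>smash jordan_env C2 env_act\<^esub> env_smash f"
      by (simp add: f env_smash_def smash_duo hom)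
    assume "g \<in> carrier free_smash"
    then obtain p' q' where g: "g = duo p' q'" using free_smash_carrier by blast
    show "env_smash (f \<oplus>\<^bsub>free_smash\<^esub> g) = env_smash f \<oplus>\<^bsub>smash jordan_env C2 env_act\<^esub> env_smash g"
      by (simp add: f g env_smash_def smash_duo hom)
    show "env_smash (f \<otimes>\<^bsub>free_smash\<^esub> g) = env_smash f \<otimes>\<^bsub>smash jordan_env C2 env_act\<^esub> env_smash g"
      unfolding f g env_smash_def free_smash_mult duo_simps
      by (subst smash_duo_mult[OF E.ring_axioms]) (simp_all add: env_map_closed act env_act_map hom)
  qed (simp add: env_smash_def smash_duo hom z)
qed

lemma env_smash_surj:
  "env_smash ` carrier free_smash = carrier (smash (jordan_env :: ('k::field, 'k env_elem) module) C2 env_act)"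
proof
  show "env_smash ` carrier free_smash \<subseteq> carrier (smash (jordan_env :: ('k, 'k env_elem) module) C2 env_act)"
    using alg_homD(1)[OF env_smash_alg_hom] by blast
  show "carrier (smash (jordan_env :: ('k, 'k env_elem) module) C2 env_act) \<subseteq> env_smash ` carrier free_smash"
  proof
    fix F assume "F \<in> carrier (smash (jordan_env :: ('k, 'k env_elem) module) C2 env_act)"
    then obtain p q where "F = duo (env_map p) (env_map q)"
      unfolding smash_duo env_map_surj[symmetric] by blast
    then have "F = env_smash (duo p q)" by (simp add: env_smash_def)
    then show "F \<in> env_smash ` carrier free_smash" using free_smash_carrier by blast
  qed
qed

lemma hpart_range: "range (hpart n) = (words_of_degree n :: ('x list \<Rightarrow>\<^sub>0 'k::field) set)"
proof
  show "range (hpart n) \<subseteq> (words_of_degree n :: ('x list \<Rightarrow>\<^sub>0 'k) set)" by (auto simp: words_of_degree_iff lookup_hpart)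
  show "(words_of_degree n :: ('x list \<Rightarrow>\<^sub>0 'k) set) \<subseteq> range (hpart n)"
  proof
    fix p :: "'x list \<Rightarrow>\<^sub>0 'k" assume "p \<in> words_of_degree n"
    then have "p = hpart n p" by (intro poly_mapping_eqI) (auto simp: words_of_degree_iff lookup_hpart)
    then show "p \<in> range (hpart n)" by blast
  qed
qed

lemma smash_pr_range:
  "smash_pr n ` carrier (free_smash :: ('k::field, _) module) = {duo p q |p q. p \<in> words_of_degree n \<and> q \<in> words_of_degree n}"
proof
  show "smash_pr n ` carrier (free_smash :: ('k, _) module) \<subseteq> {duo p q |p q. p \<in> words_of_degree n \<and> q \<in> words_of_degree n}"
    by (auto simp: smash_pr_def words_of_degree_iff lookup_hpart)
  show "{duo p q |p q. p \<in> words_of_degree n \<and> q \<in> words_of_degree n} \<subseteq> smash_pr n ` carrier (free_smash :: ('k, _) module)"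
  proof
    fix f :: "int \<Rightarrow> 'k efree" assume "f \<in> {duo p q |p q. p \<in> words_of_degree n \<and> q \<in> words_of_degree n}"
    then obtain p q where "f = duo (hpart n p) (hpart n q)" unfolding hpart_range[symmetric] by blast
    then have "f = smash_pr n (duo p q)" by (simp add: smash_pr_def)
    then show "f \<in> smash_pr n ` carrier free_smash" using free_smash_carrier by blast
  qed
qed

lemma env_smash_part:
  "env_smash ` (smash_pr n ` carrier free_smash) = smash_part C2 (env_grade n :: 'k::field env_elem set)"
proof
  show "env_smash ` (smash_pr n ` carrier free_smash) \<subseteq> smash_part C2 (env_grade n :: 'k env_elem set)"
    unfolding smash_pr_range env_map_grade[symmetric] by (auto simp: env_smash_def smash_duo)
  show "smash_part C2 (env_grade n :: 'k env_elem set) \<subseteq> env_smash ` (smash_pr n ` carrier free_smash)"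
  proof
    fix F assume "F \<in> smash_part C2 (env_grade n :: 'k env_elem set)"
    then obtain p q where pq: "p \<in> words_of_degree n" "q \<in> words_of_degree n" "F = duo (env_map p) (env_map q)"
      unfolding smash_duo env_map_grade[symmetric] by blast
    then have "F = env_smash (duo p q)" by (simp add: env_smash_def)
    then show "F \<in> env_smash ` (smash_pr n ` carrier free_smash)" using pq unfolding smash_pr_range by blast
  qed
qed

section \<open>PBW deformations\<close>

text \<open>The associated graded algebra and the smash product are images of the free smash product
  with the same kernel. Both surjections carry the degree n part onto the degree n part, so the
  induced isomorphism is graded.\<close>

lemma PBW_if_scalar:
  fixes \<kappa> :: "'k::field kappa"
  assumes \<kappa>: "\<And>i. i \<in> {1..6} \<Longrightarrow> \<kappa> (env_rel i) = single 0 (if i \<in> {1,2,3} then \<alpha> i else 0)"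
  shows "is_PBW \<kappa>"
proof -
  have ker: "deform_symbol \<kappa> f = deform_symbol \<kappa> g \<longleftrightarrow> env_smash f = env_smash g"
    if fg: "f \<in> carrier free_smash" "g \<in> carrier free_smash" for f g
  proof -
    obtain p q p' q' where "f = duo p q" "g = duo p' q'" using fg free_smash_carrier by metis
    moreover have "deform_symbol \<kappa> (duo p q) = deform_symbol \<kappa> (duo p' q') \<longleftrightarrow>
       p - p' \<in> env_rel_ideal \<and> q - q' \<in> env_rel_ideal"
      by (rule deform_symbol_kernel) (rule \<kappa>)
    ultimately show ?thesis by (simp add: env_smash_def env_map_eq_iff)
  qed
  obtain h where h: "h \<in> alg_iso (assoc_gr (deform_alg \<kappa>) (deform_filt \<kappa>)) (smash jordan_env C2 env_act)"
    "\<And>f. f \<in> carrier free_smash \<Longrightarrow> h (deform_symbol \<kappa> f) = env_smash f"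
    using alg_iso_of_same_kernel[OF free_smash_k_algebra deform_symbol_props(1,2) env_smash_alg_hom env_smash_surj ker]
    by blast
  have "h ` assoc_gr_part (deform_alg \<kappa>) (deform_filt \<kappa>) n = smash_part C2 (env_grade n)" for n
  proof -
    have "smash_pr n ` carrier (free_smash :: ('k, _) module) \<subseteq> carrier free_smash"
      using free_smash_carrier by (auto simp: smash_pr_def)
    then have "h ` deform_symbol \<kappa> ` (smash_pr n ` carrier free_smash) = env_smash ` (smash_pr n ` carrier free_smash)"
      unfolding image_image[of h] by (intro image_cong refl h(2)) blast
    then show ?thesis by (simp only: deform_symbol_props(3) env_smash_part)
  qed
  then show ?thesis
    unfolding is_PBW_def PBW_deformation_def graded_alg_iso_def using h(1) by blast
qed

section \<open>Coordinates on the part of degree one\<close>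

instance egen :: finite
proof
  have "(UNIV :: egen set) = {Eu, Ev, Eu', Ev'}" using egen.exhaust by blast
  then show "finite (UNIV :: egen set)" by (metis finite.simps)
qed

text \<open>The eight coordinates of a degree-one element of the free smash product:
  \<open>False\<close> marks the component at 1, \<open>True\<close> the one at g.\<close>

definition gen_comb :: "'k::field ^ (egen \<times> bool) \<Rightarrow> bool \<Rightarrow> 'k efree" where
  "gen_comb c s = (\<Sum>x\<in>UNIV. single [x] (c $ (x, s)))"

definition smash_comb :: "'k::field ^ (egen \<times> bool) \<Rightarrow> int \<Rightarrow> 'k efree" where
  "smash_comb c = duo (gen_comb c False) (gen_comb c True)"

lemma lookup_gen_comb: "lookup (gen_comb c s) w = (case w of [x] \<Rightarrow> c $ (x, s) | _ \<Rightarrow> 0)"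
  by (auto simp: gen_comb_def lookup_sum lookup_single when_def sum.delta split: list.splits)

lemma gen_comb_linear:
  "gen_comb (c + d) s = gen_comb c s + gen_comb d s" "gen_comb (r *s c) s = smul r (gen_comb c s)"
  by (rule poly_mapping_eqI; auto simp: lookup_gen_comb lookup_add split: list.splits)+

lemma smash_comb_linear:
  "smash_comb (c + d) = smash_comb c \<oplus>\<^bsub>free_smash\<^esub> smash_comb d"
  "smash_comb (r *s c) = r \<odot>\<^bsub>free_smash\<^esub> smash_comb c"
  by (simp_all add: smash_comb_def smash_duo gen_comb_linear)

lemma words_of_degree_1:
  assumes "p \<in> words_of_degree 1" "q \<in> words_of_degree 1"
  shows "duo p q = smash_comb (\<chi> i. lookup (if snd i then q else p) [fst i])"
proof -
  have "lookup r w = 0" if "r \<in> words_of_degree 1" "length w \<noteq> 1" for r :: "'a efree" and w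
    using that by (auto simp: words_of_degree_iff)
  then show ?thesis using assms unfolding smash_comb_def duo_eq_iff
    by (auto intro!: poly_mapping_eqI simp: lookup_gen_comb split: list.splits)
qed

lemma smash_comb_range: "smash_pr 1 ` carrier free_smash = range smash_comb"
proof
  show "smash_pr 1 ` carrier free_smash \<subseteq> range (smash_comb :: 'k::field ^ (egen \<times> bool) \<Rightarrow> _)"
    unfolding smash_pr_range using words_of_degree_1 by blast
  have "gen_comb c s \<in> words_of_degree 1" for c :: "'k::field ^ (egen \<times> bool)" and s
    by (auto simp: words_of_degree_iff lookup_gen_comb split: list.splits)
  then show "range (smash_comb :: 'k::field ^ (egen \<times> bool) \<Rightarrow> _) \<subseteq> smash_pr 1 ` carrier free_smash"
    unfolding smash_pr_range smash_comb_def by blast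
qed

text \<open>Single letters are normal words, hence independent modulo the relations.\<close>

lemma degree_1_env_rel_ideal:
  assumes "p \<in> env_rel_ideal" "p \<in> words_of_degree 1"
  shows "p = 0"
proof -
  have "[x] \<in> range normal_word" for x
  proof (cases x)
    case Eu then have "[x] = normal_word (1, 0, 0, 0)" by simp then show ?thesis by blast
  next
    case Ev then have "[x] = normal_word (0, 1, 0, 0)" by simp then show ?thesis by blast
  next
    case Eu' then have "[x] = normal_word (0, 0, 1, 0)" by simp then show ?thesis by blast
  next
    case Ev' then have "[x] = normal_word (0, 0, 0, 1)" by simp then show ?thesis by blast
  qed
  then have k: "keys p \<subseteq> range normal_word"
    using assms(2) by (auto simp: words_of_degree_def length_Suc_conv)
  have "lookup p (normal_word m) = 0" for m
    using pol_value_normal[OF k, of m] assms(1) unfolding env_rel_ideal_iff_pol_value by simp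
  then have "keys p = {}" using k by (auto simp: in_keys_iff simp del: normal_word.simps keys_eq_empty)
  then show ?thesis by simp
qed

lemma env_smash_comb_inj:
  assumes "env_smash (smash_comb c) = env_smash (smash_comb d)"
  shows "c = (d :: 'k::field ^ (egen \<times> bool))"
proof -
  have e: "gen_comb c s = gen_comb d s" for s
  proof -
    have "gen_comb c s - gen_comb d s \<in> env_rel_ideal"
      using assms by (cases s) (simp_all add: env_smash_def smash_comb_def env_map_eq_iff)
    moreover have "gen_comb c s - gen_comb d s \<in> words_of_degree 1"
      by (auto simp: words_of_degree_iff lookup_minus lookup_gen_comb split: list.splits)
    ultimately show ?thesis using degree_1_env_rel_ideal by fastforce
  qed
  show ?thesis
  proof (rule vec_eq_iff[THEN iffD2], rule allI)
    fix i :: "egen \<times> bool"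
    show "c $ i = d $ i"
      using arg_cong[OF e[of "snd i"], of "\<lambda>p. lookup p [fst i]"] by (simp add: lookup_gen_comb)
  qed
qed

text \<open>Under the PBW property, passing to degree one of the associated graded algebra is a surjective,
  hence injective, linear map between \<open>8\<close>-dimensional spaces.\<close>

lemma PBW_degree_1:
  fixes \<kappa> :: "'k::field kappa"
  assumes "is_PBW \<kappa>" and I: "duo p q \<in> deform_ideal \<kappa>" and pq: "p \<in> words_of_degree 1" "q \<in> words_of_degree 1"
  shows "p = 0" "q = 0"
proof -
  let ?S = "smash (jordan_env :: ('k, 'k env_elem) module) C2 env_act"
  let ?G = "assoc_gr (deform_alg \<kappa>) (deform_filt \<kappa>)"
  obtain h where h: "h \<in> alg_iso ?G ?S"
    "\<And>n. h ` assoc_gr_part (deform_alg \<kappa>) (deform_filt \<kappa>) n = smash_part C2 (env_grade n)"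
    using assms(1) unfolding is_PBW_def PBW_deformation_def graded_alg_iso_def by blast
  have h': "h \<in> alg_hom ?G ?S" using h(1) by (auto simp: alg_iso_def alg_hom_def ring_iso_def)
  \<comment> \<open>Nothing is known about \<open>h\<close> besides being a graded isomorphism. Its
    composite H with the symbol map is therefore compared with the known injective coordinate map P;
    they have the same range, so H = P o L for an endomorphism L of k^8.\<close>
  define H where "H c = h (deform_symbol \<kappa> (smash_comb c))" for c :: "'k ^ (egen \<times> bool)"
  define P where "P c = env_smash (smash_comb c)" for c :: "'k ^ (egen \<times> bool)"
  have car: "smash_comb c \<in> carrier free_smash" for c :: "'k ^ (egen \<times> bool)"
    unfolding smash_comb_def using free_smash_carrier by blast
  note sym = alg_homD[OF deform_symbol_props(1)[of \<kappa>]] and hh = alg_homD[OF h'] and es = alg_homD[OF env_smash_alg_hom]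
  have H: "H (c + d) = H c \<oplus>\<^bsub>?S\<^esub> H d" "H (r *s c) = r \<odot>\<^bsub>?S\<^esub> H c" for c d r
    unfolding H_def smash_comb_linear
    by (simp_all only: sym(3)[OF car car] sym(5)[OF car] hh(3)[OF sym(1)[OF car] sym(1)[OF car]] hh(5)[OF sym(1)[OF car]])
  have P: "P (c + d) = P c \<oplus>\<^bsub>?S\<^esub> P d" "P (r *s c) = r \<odot>\<^bsub>?S\<^esub> P c" for c d r
    unfolding P_def smash_comb_linear by (simp_all only: es(3)[OF car car] es(5)[OF car])
  have P_inj: "c = d" if "P c = P d" for c d using env_smash_comb_inj that unfolding P_def by blast
  have rP: "range P = smash_part C2 (env_grade 1)"
    unfolding env_smash_part[symmetric] smash_comb_range P_def by (simp add: image_image)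
  have rH: "range H = smash_part C2 (env_grade 1)"
    unfolding h(2)[symmetric] deform_symbol_props(3)[symmetric] smash_comb_range H_def by (simp add: image_image)
  have eq: "range H = range P" using rP rH by simp
  have ex: "\<exists>d. P d = H c" for c
  proof -
    have "H c \<in> range P" unfolding eq[symmetric] by (rule rangeI)
    then obtain d where "H c = P d" by (rule rangeE)
    then show ?thesis by (intro exI[of _ d]) simp
  qed
  from choice[of "\<lambda>c d. P d = H c"] ex obtain L where L: "\<And>c. P (L c) = H c" by blast
  have "Vector_Spaces.linear (*s) (*s) L"
    by unfold_locales (rule P_inj, simp only: L P H)+
  moreover have "surj L"
  proof (rule surjI)
    fix d
    have "P d \<in> range H" unfolding eq by (rule rangeI)
    then have "\<exists>c. H c = P d" by auto
    then have "H (SOME c. H c = P d) = P d" by (rule someI_ex)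
    then show "L (SOME c. H c = P d) = d" using L P_inj by simp
  qed
  ultimately have "inj L" by (rule vec.linear_surj_imp_inj)
  define d where "d = (\<chi> i. lookup (if snd i then q else p) [fst i])"
  have d: "duo p q = smash_comb d" unfolding d_def by (rule words_of_degree_1[OF pq])
  have c0: "smash_comb 0 = duo 0 (0 :: 'k efree)"
    by (auto simp: smash_comb_def intro!: poly_mapping_eqI simp: lookup_gen_comb split: list.splits)
  interpret ideal "deform_ideal \<kappa>" "free_smash :: ('k, _) module" by (rule deform_ideal_ideal)
  \<comment> \<open>A degree-one element of the deformed ideal has zero symbol, so its coordinate
    vector d lies in the kernel of the injective L.\<close>
  have "deform_symbol \<kappa> (duo p q) = deform_symbol \<kappa> (duo 0 0)"
    unfolding deform_symbol_props(4)
  proof (intro allI)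
    fix n
    have hp: "hpart n r = (if n = 1 then r else 0)" if "r \<in> words_of_degree 1" for r :: "'k efree"
      using that by (intro poly_mapping_eqI) (auto simp: lookup_hpart words_of_degree_iff)
    have "duo 0 0 \<in> deform_ideal \<kappa>"
      using additive_subgroup.zero_closed[OF additive_subgroup_axioms] by (simp add: smash_duo)
    then show "\<exists>y\<in>lower n. \<exists>z\<in>lower n. duo (hpart n (p - 0) - y) (hpart n (q - 0) - z) \<in> deform_ideal \<kappa>"
      using I by (intro bexI[of _ 0]) (auto simp: hp[OF pq(1)] hp[OF pq(2)] lower_0)
  qed
  then have "H d = H 0" unfolding H_def d[symmetric] c0 by simp
  then have "L d = L 0" by (intro P_inj) (simp add: L)
  then have "d = 0" using \<open>inj L\<close> by (simp add: inj_eq)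
  then have "duo p q = duo 0 0" using d c0 by simp
  then show "p = 0" "q = 0" by simp_all
qed

section \<open>Overlaps of the relations\<close>

context
  fixes \<kappa> :: "'k::field kappa" and a b :: "nat \<Rightarrow> 'k"
  defines "a \<equiv> \<lambda>i. lookup (\<kappa> (env_rel i)) 0" and "b \<equiv> \<lambda>i. lookup (\<kappa> (env_rel i)) 1"
begin

lemma deform_ideal_add: "duo p q \<in> deform_ideal \<kappa> \<Longrightarrow> duo p' q' \<in> deform_ideal \<kappa> \<Longrightarrow> duo (p + p') (q + q') \<in> deform_ideal \<kappa>"
proof -
  interpret ideal "deform_ideal \<kappa>" "free_smash :: ('k, _) module" by (rule deform_ideal_ideal)
  assume "duo p q \<in> deform_ideal \<kappa>" "duo p' q' \<in> deform_ideal \<kappa>"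
  then show ?thesis
    using additive_subgroup.a_closed[OF additive_subgroup_axioms, of "duo p q" "duo p' q'"] by (simp add: smash_duo)
qed

lemma deform_ideal_uminus: "duo p q \<in> deform_ideal \<kappa> \<Longrightarrow> duo (- p) (- q) \<in> deform_ideal \<kappa>"
proof -
  interpret ideal "deform_ideal \<kappa>" "free_smash :: ('k, _) module" by (rule deform_ideal_ideal)
  assume I: "duo p q \<in> deform_ideal \<kappa>"
  have "duo (single [] (-1)) 0 \<in> carrier (free_smash :: ('k, _) module)"
    using free_smash_carrier by blast
  from I_l_closed[OF I this] show ?thesis
    by (simp add: free_smash_mult single_uminus monoid_alg_uminus_left fmul_Nil)
qed

lemma deform_ideal_minus: "duo p q \<in> deform_ideal \<kappa> \<Longrightarrow> duo p' q' \<in> deform_ideal \<kappa> \<Longrightarrow> duo (p - p') (q - q') \<in> deform_ideal \<kappa>"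
  using deform_ideal_add[OF _ deform_ideal_uminus, of p q p' q'] by simp

text \<open>Moving x from the right through g changes its sign, so the coefficient b appears here
  with the sign opposite to that in \<open>deform_rel_left\<close>, while a appears with the same
  sign.\<close>

lemma deform_rel_right:
  assumes "i \<in> {1..6}"
  shows "duo (env_rel i \<star> word [x] - single [x] (a i)) (single [x] (b i)) \<in> deform_ideal \<kappa>"
proof -
  interpret ideal "deform_ideal \<kappa>" "free_smash :: ('k, _) module" by (rule deform_ideal_ideal)
  have c: "duo (word [x]) 0 \<in> carrier (free_smash :: ('k, _) module)" using free_smash_carrier by blast
  show ?thesis
    using I_r_closed[OF deform_ideal_gens[OF assms, of \<kappa>] c]
    by (simp add: free_smash_mult fmul_distrib sign_act_single single_uminus a_def b_def)
qed

lemma deform_rel_left: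
  assumes "i \<in> {1..6}"
  shows "duo (word [x] \<star> env_rel i - single [x] (a i)) (- single [x] (b i)) \<in> deform_ideal \<kappa>"
proof -
  interpret ideal "deform_ideal \<kappa>" "free_smash :: ('k, _) module" by (rule deform_ideal_ideal)
  have c: "duo (word [x]) 0 \<in> carrier (free_smash :: ('k, _) module)" using free_smash_carrier by blast
  show ?thesis
    using I_l_closed[OF deform_ideal_gens[OF assms, of \<kappa>] c]
    by (simp add: free_smash_mult fmul_distrib a_def b_def)
qed

text \<open>The overlaps of \<open>r\<^sub>1\<close> with \<open>u'\<close> and \<open>v'\<close> and of \<open>r\<^sub>2\<close> with \<open>u\<close>. The group element
  anticommutes with the generators, so that the coefficients \<open>b\<close> of the group element add up where the
  coefficients \<open>a\<close> cancel.\<close>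

lemma overlap_left:
  assumes "(i, j, x) \<in> {(3, 4, Eu'), (5, 6, Ev')}"
  shows "duo (single [Ev] (2 * a j))
    (single [x] (2 * b 1) - single [Eu] (2 * b j) + single [Ev] (2 * b i)) \<in> deform_ideal \<kappa>"
proof -
  have i: "(1::nat) \<in> {1..6}" "i \<in> {1..6}" "j \<in> {1..6}" using assms by auto
  note R = deform_rel_right and L = deform_rel_left and add = deform_ideal_add and minus = deform_ideal_minus
  \<comment> \<open>The combination is [\<open>r\<^sub>1\<close>, x] + [u, \<open>r\<^sub>j\<close>]
    - [v, \<open>r\<^sub>i\<close>] - (\<open>r\<^sub>j\<close> v + v \<open>r\<^sub>j\<close>),
    which is zero in the free algebra: here \<open>r\<^sub>i\<close> = [u, x],
    \<open>r\<^sub>j\<close> = [v, x] and \<open>r\<^sub>1\<close> = [v, u] + v^2, so it is the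
    Jacobi identity together with [v^2, x] = v [v, x] + [v, x] v. Only the constants remain: the
    anticommutator doubles \<open>a j\<close>, the commutators double the b's.\<close>
  note main = minus[OF add[OF minus[OF minus[OF minus[OF add[OF minus[OF
     R[OF i(1), of x] R[OF i(3), of Eu]] R[OF i(2), of Ev]] R[OF i(3), of Ev]] L[OF i(1), of x]] L[OF i(2), of Ev]]
     L[OF i(3), of Eu]] L[OF i(3), of Ev]]
  have d: "single w (2 * c) = single w c + single w (c :: 'k)" for w :: "egen list" and c
    by (simp flip: single_add)
  consider "i = 3" "j = 4" "x = Eu'" | "i = 5" "j = 6" "x = Ev'" using assms by auto
  then show ?thesis
  proof cases
    case 1
    show ?thesis using main unfolding d 1 by (simp add: env_rel_def fmul_distrib algebra_simps)
  next
    case 2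
    show ?thesis using main unfolding d 2 by (simp add: env_rel_def fmul_distrib algebra_simps)
  qed
qed

lemma overlap_right:
  "duo (single [Ev'] (2 * a 5))
    (single [Eu] (2 * b 2) + single [Eu'] (2 * b 5) - single [Ev'] (2 * b 3)) \<in> deform_ideal \<kappa>"
proof -
  have i: "(2::nat) \<in> {1..6}" "(3::nat) \<in> {1..6}" "(5::nat) \<in> {1..6}" by auto
  note R = deform_rel_right and L = deform_rel_left and add = deform_ideal_add and minus = deform_ideal_minus
  \<comment> \<open>Here the combination is [\<open>r\<^sub>2\<close>, u] +
    [\<open>r\<^sub>5\<close>, u'] - [\<open>r\<^sub>3\<close>, v'] - (\<open>r\<^sub>5\<close> v' +
    v' \<open>r\<^sub>5\<close>), zero in the free algebra by the Jacobi identity for u, u', v' and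
    the product rule for [u, v'^2].\<close>
  note main = minus[OF minus[OF add[OF minus[OF minus[OF minus[OF add[OF
     R[OF i(1), of Eu] R[OF i(3), of Eu']] R[OF i(2), of Ev']] R[OF i(3), of Ev']] L[OF i(1), of Eu]]
     L[OF i(2), of Ev']] L[OF i(3), of Eu']] L[OF i(3), of Ev']]
  have d: "single w (2 * c) = single w c + single w (c :: 'k)" for w :: "egen list" and c
    by (simp flip: single_add)
  show ?thesis
    using main unfolding d by (simp add: env_rel_def fmul_distrib algebra_simps)
qed

text \<open>The overlaps have degree one, so the PBW property forces them to be zero, and the
  letters in each are distinct, so their coefficients vanish separately. The a's come from the first
  components; the first overlap yields b 1, b 3, b 4, the second b 5 and b 6, the third b 2.\<close>

lemma PBW_coefficients:
  assumes "is_PBW \<kappa>" and two: "(2 :: 'k) \<noteq> 0"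
  shows "a 4 = 0" "a 5 = 0" "a 6 = 0" "\<And>i. i \<in> {1..6} \<Longrightarrow> b i = 0"
proof -
  have w: "single [x] c \<in> words_of_degree 1" for x :: egen and c :: 'k
    by (auto simp: words_of_degree_iff lookup_single when_def)
  have w': "p + q \<in> words_of_degree 1" "p - q \<in> words_of_degree 1"
    if "p \<in> words_of_degree 1" "q \<in> words_of_degree 1" for p q :: "'k efree"
    using that unfolding words_of_degree_iff lookup_add lookup_minus by (metis add.right_neutral diff_0_right)+
  note D = PBW_degree_1[OF assms(1)]
  have s: "c = 0" if "single [x] (2 * c) = (0 :: 'k efree)" for x c
    using arg_cong[OF that, of "\<lambda>p. lookup p [x]"] two by simp
  have 3: "a 4 = 0" "single [Eu'] (2 * b 1) - single [Eu] (2 * b 4) + single [Ev] (2 * b 3) = 0"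
  proof -
    have "(3, 4, Eu') \<in> {(3, 4, Eu'), (5, 6, Ev')}" by simp
    note o = overlap_left[OF this]
    show "a 4 = 0" by (rule s[OF D(1)[OF o w]]) (intro w w')
    show "single [Eu'] (2 * b 1) - single [Eu] (2 * b 4) + single [Ev] (2 * b 3) = 0"
      by (rule D(2)[OF o w]) (intro w w')
  qed
  have 5: "a 6 = 0" "single [Ev'] (2 * b 1) - single [Eu] (2 * b 6) + single [Ev] (2 * b 5) = 0"
  proof -
    have "(5, 6, Ev') \<in> {(3, 4, Eu'), (5, 6, Ev')}" by simp
    note o = overlap_left[OF this]
    show "a 6 = 0" by (rule s[OF D(1)[OF o w]]) (intro w w')
    show "single [Ev'] (2 * b 1) - single [Eu] (2 * b 6) + single [Ev] (2 * b 5) = 0"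
      by (rule D(2)[OF o w]) (intro w w')
  qed
  have 2: "a 5 = 0" "single [Eu] (2 * b 2) + single [Eu'] (2 * b 5) - single [Ev'] (2 * b 3) = 0"
  proof -
    show "a 5 = 0" by (rule s[OF D(1)[OF overlap_right w]]) (intro w w')
    show "single [Eu] (2 * b 2) + single [Eu'] (2 * b 5) - single [Ev'] (2 * b 3) = 0"
      by (rule D(2)[OF overlap_right w]) (intro w w')
  qed
  have at: "lookup p [x] = 0" if "p = 0" for p :: "'k efree" and x using that by simp
  note coeff = lookup_add lookup_minus lookup_single two
  have "b 1 = 0"
    "b 2 = 0"
    "b 3 = 0"
    "b 4 = 0"
    "b 5 = 0"
    "b 6 = 0"
    using at[OF 3(2), of Eu']
      at[OF 2(2), of Eu]
      at[OF 3(2), of Ev]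
      at[OF 3(2), of Eu]
      at[OF 5(2), of Ev]
      at[OF 5(2), of Eu]
    by (simp_all add: coeff)
  moreover have "i = 1 \<or> i = 2 \<or> i = 3 \<or> i = 4 \<or> i = 5 \<or> i = 6" if "i \<in> {1..6}" for i :: nat using that by auto
  ultimately show "\<And>i. i \<in> {1..6} \<Longrightarrow> b i = 0" by blast
  show "a 4 = 0" "a 5 = 0" "a 6 = 0" by (fact 3 2 5)+
qed

end

section \<open>The classification\<close>

lemma env_rel_in_space: "i \<in> {1..6} \<Longrightarrow> env_rel i \<in> (env_rel_space :: 'k::field efree set)"
proof -
  assume i: "i \<in> {1..6}"
  have z: "smul 0 p = 0" for p :: "'k efree" by (rule poly_mapping_eqI) simp
  have "(\<Sum>j=1..6. (if j = i then 1 else 0) \<odot>\<^bsub>free_alg\<^esub> (env_rel j :: 'k efree)) =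
      (\<Sum>j=1..6. if j = i then env_rel j else 0)"
    by (intro sum.cong refl) (simp add: z)
  also have "\<dots> = env_rel i" using i by (simp add: sum.delta)
  finally show ?thesis unfolding env_rel_space_def
    by (intro CollectI exI[of _ "\<lambda>j. if j = i then 1 else 0"]) simp
qed

text \<open>Each of the words vu, v'u', uu' occurs in exactly one of the six relations, with
  coefficient 1. Reading off these coefficients therefore gives a linear map with prescribed values
  on the relations, and the independence of the relations does not have to be argued.\<close>

definition kappa_of :: "(nat \<Rightarrow> 'k) \<Rightarrow> 'k::field kappa" where
  "kappa_of \<alpha> p = single 0
     (\<alpha> 1 * lookup p [Ev, Eu] + \<alpha> 2 * lookup p [Ev', Eu'] + \<alpha> 3 * lookup p [Eu, Eu'])"

lemma kappa_of_linear: "kappa_of \<alpha> \<in> linear_maps_on S free_alg kC2"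
  by (auto simp: linear_maps_on_def kappa_of_def lookup_add algebra_simps simp flip: single_add split: if_splits)

lemma kappa_of_rel:
  "i \<in> {1..6} \<Longrightarrow> kappa_of \<alpha> (env_rel i) = single 0 (if i \<in> {1,2,3} then \<alpha> i else 0)"
  by (auto simp: kappa_of_def env_rel_def lookup_add lookup_minus lookup_single)

lemma kC2_scalar: "c \<odot>\<^bsub>kC2\<^esub> \<one>\<^bsub>kC2\<^esub> = (single 0 c :: int \<Rightarrow>\<^sub>0 'k::field)"
  by (simp only: monoid_alg_simps C2_simps smul_single mult_1_right)

theorem proposition5p3:
  assumes "odd CHAR('k::field)"
  shows
    "(\<exists>\<phi>. \<phi> \<in> alg_iso (alg_quot free_alg env_rel_ideal) (jordan_env :: ('k, 'k env_elem) module) \<and>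
        \<phi> (env_rel_ideal +>\<^bsub>free_alg\<^esub> word [Eu]) = env_tensor (jordan_class (word [Ju])) \<one>\<^bsub>jordan_plane\<^esub> \<and>
        \<phi> (env_rel_ideal +>\<^bsub>free_alg\<^esub> word [Ev]) = env_tensor (jordan_class (word [Jv])) \<one>\<^bsub>jordan_plane\<^esub> \<and>
        \<phi> (env_rel_ideal +>\<^bsub>free_alg\<^esub> word [Eu']) = env_tensor \<one>\<^bsub>jordan_plane\<^esub> (jordan_class (word [Ju])) \<and>
        \<phi> (env_rel_ideal +>\<^bsub>free_alg\<^esub> word [Ev']) = env_tensor \<one>\<^bsub>jordan_plane\<^esub> (jordan_class (word [Jv]))) \<and>
     (\<forall>\<alpha> :: nat \<Rightarrow> 'k. \<exists>\<kappa> \<in> linear_maps_on env_rel_space free_alg kC2.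
        (\<forall>i\<in>{1,2,3}. \<kappa> (env_rel i) = \<alpha> i \<odot>\<^bsub>kC2\<^esub> \<one>\<^bsub>kC2\<^esub>) \<and>
        (\<forall>j\<in>{4,5,6}. \<kappa> (env_rel j) = \<zero>\<^bsub>kC2\<^esub>) \<and>
        is_PBW \<kappa>) \<and>
     (\<forall>\<kappa> \<in> linear_maps_on env_rel_space free_alg (kC2 :: ('k, int \<Rightarrow>\<^sub>0 'k) module).
        is_PBW \<kappa> \<longrightarrow>
        (\<exists>\<alpha> :: nat \<Rightarrow> 'k.
          (\<forall>i\<in>{1,2,3}. \<kappa> (env_rel i) = \<alpha> i \<odot>\<^bsub>kC2\<^esub> \<one>\<^bsub>kC2\<^esub>) \<and>
          (\<forall>j\<in>{4,5,6}. \<kappa> (env_rel j) = \<zero>\<^bsub>kC2\<^esub>)))"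
proof (intro conjI allI ballI impI)
  obtain \<phi> where "\<phi> \<in> alg_iso (alg_quot free_alg env_rel_ideal) (jordan_env :: ('k, 'k env_elem) module)"
    "\<forall>p. \<phi> (env_rel_ideal +>\<^bsub>free_alg\<^esub> p) = env_map p"
    using presentation by blast
  then show "\<exists>\<phi>. \<phi> \<in> alg_iso (alg_quot free_alg env_rel_ideal) (jordan_env :: ('k, 'k env_elem) module) \<and>
        \<phi> (env_rel_ideal +>\<^bsub>free_alg\<^esub> word [Eu]) = env_tensor (jordan_class (word [Ju])) \<one>\<^bsub>jordan_plane\<^esub> \<and>
        \<phi> (env_rel_ideal +>\<^bsub>free_alg\<^esub> word [Ev]) = env_tensor (jordan_class (word [Jv])) \<one>\<^bsub>jordan_plane\<^esub> \<and>
        \<phi> (env_rel_ideal +>\<^bsub>free_alg\<^esub> word [Eu']) = env_tensor \<one>\<^bsub>jordan_plane\<^esub> (jordan_class (word [Ju])) \<and>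
        \<phi> (env_rel_ideal +>\<^bsub>free_alg\<^esub> word [Ev']) = env_tensor \<one>\<^bsub>jordan_plane\<^esub> (jordan_class (word [Jv]))"
    by (intro exI[of _ \<phi>]) (simp add: env_map_gens)
next
  fix \<alpha> :: "nat \<Rightarrow> 'k"
  have "is_PBW (kappa_of \<alpha>)" by (rule PBW_if_scalar) (rule kappa_of_rel)
  moreover have "\<forall>i\<in>{1,2,3}. kappa_of \<alpha> (env_rel i) = \<alpha> i \<odot>\<^bsub>kC2\<^esub> \<one>\<^bsub>kC2\<^esub>"
    "\<forall>j\<in>{4,5,6}. kappa_of \<alpha> (env_rel j) = \<zero>\<^bsub>kC2\<^esub>"
    unfolding kC2_scalar using kappa_of_rel[of _ \<alpha>] by auto
  ultimately show "\<exists>\<kappa> \<in> linear_maps_on env_rel_space free_alg kC2.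
        (\<forall>i\<in>{1,2,3}. \<kappa> (env_rel i) = \<alpha> i \<odot>\<^bsub>kC2\<^esub> \<one>\<^bsub>kC2\<^esub>) \<and>
        (\<forall>j\<in>{4,5,6}. \<kappa> (env_rel j) = \<zero>\<^bsub>kC2\<^esub>) \<and> is_PBW \<kappa>"
    using kappa_of_linear by blast
next
  fix \<kappa> :: "'k kappa"
  assume lin: "\<kappa> \<in> linear_maps_on env_rel_space free_alg kC2" and "is_PBW \<kappa>"
  \<comment> \<open>Parity excludes characteristics 0 and 2, and a field never has characteristic
    1.\<close>
  have "\<not> CHAR('k) dvd 2"
  proof
    assume "CHAR('k) dvd 2"
    then have "CHAR('k) \<le> 2" by (rule dvd_imp_le) simp
    then have "CHAR('k) = 0 \<or> CHAR('k) = Suc 0 \<or> CHAR('k) = 2" by linarith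
    then show False using assms by auto
  qed
  then have two: "(2 :: 'k) \<noteq> 0" using of_nat_eq_0_iff_char_dvd[where 'a = 'k, of 2] by simp
  note c = PBW_coefficients[OF \<open>is_PBW \<kappa>\<close> two]
  have \<kappa>: "\<kappa> (env_rel i) = single 0 (lookup (\<kappa> (env_rel i)) 0)" if i: "i \<in> {1..6}" for i
  proof -
    \<comment> \<open>As \<kappa> takes values in the group algebra, an integer other than 0 and 1
      cannot occur as a key; with the coefficient at g zero, only a scalar is left.\<close>
    have "keys (\<kappa> (env_rel i)) \<subseteq> {0, 1}"
      using lin env_rel_in_space[OF i] unfolding linear_maps_on_def by auto
    then show ?thesis
      using c(4)[OF i] by (intro poly_mapping_eqI) (auto simp: lookup_single when_def in_keys_iff)
  qed
  have "\<forall>i\<in>{1,2,3}. \<kappa> (env_rel i) = lookup (\<kappa> (env_rel i)) 0 \<odot>\<^bsub>kC2\<^esub> \<one>\<^bsub>kC2\<^esub>"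
    unfolding kC2_scalar by (intro ballI \<kappa>) auto
  moreover have "\<forall>j\<in>{4,5,6}. \<kappa> (env_rel j) = \<zero>\<^bsub>kC2\<^esub>"
  proof
    fix j :: nat assume j: "j \<in> {4,5,6}"
    then have "\<kappa> (env_rel j) = single 0 (lookup (\<kappa> (env_rel j)) 0)"
      by (intro \<kappa>) auto
    also have "lookup (\<kappa> (env_rel j)) 0 = 0" using c(1-3) j by blast
    finally show "\<kappa> (env_rel j) = \<zero>\<^bsub>kC2\<^esub>" by simp
  qed
  ultimately show "\<exists>\<alpha> :: nat \<Rightarrow> 'k. (\<forall>i\<in>{1,2,3}. \<kappa> (env_rel i) = \<alpha> i \<odot>\<^bsub>kC2\<^esub> \<one>\<^bsub>kC2\<^esub>) \<and>
          (\<forall>j\<in>{4,5,6}. \<kappa> (env_rel j) = \<zero>\<^bsub>kC2\<^esub>)"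
    by (intro exI[of _ "\<lambda>i. lookup (\<kappa> (env_rel i)) 0"] conjI)
qed

end
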